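(* Let $n(\varepsilon,d)$ denote, for a class $F_d$ of real functions on a domain $\Omega_d\subset\mathbb{R}^d$ and a norm $\|\cdot\|$ on functions on $\Omega_d$, the minimal number $n$ of function values such that some algorithm using only $n$ values of $f$ approximates every $f\in F_d$ with error $\|f-A(f)\|\le\varepsilon$. Then: (i) Uniform approximation (error measured in $\|\cdot\|_\infty$ on $[-1/2,1/2]^d$) of functions from the class $$F_d^1=\Bigl\{f\in C^\infty([-1/2,1/2]^d):\ \sup_{k\in\mathbb{N}_0}\sum_{\beta\in\mathbb{N}_0^d,\ |\beta|=k}\frac{\|D^\beta f\|_\infty}{\beta!}\le 1\Bigr\}$$ is quasi-polynomially tractable, i.e. there exist constants $C,t>0$ such that $n(\varepsilon,d)\le C\exp\{t(1+\ln(1/\varepsilon))(1+\ln d)\}$ for all $0<\varepsilon<1$ and all $d\in\mathbb{N}$. (ii) For each $d$ let $r_d>0$ be such that the Euclidean ball $B(0,r_d)=\{x\in\mathbb{R}^d:\|x\|_2\le r_d\}$ has volume (Lebesgue measure) one. Uniform approximation (error measured in $\|\cdot\|_\infty$ on $B(0,r_d)$) of functions from the class $$F_d^2=\Bigl\{f\in C^\infty(B(0,r_d)):\ \sup_{k\in\mathbb{N}_0}\|\partial_\nu^k f\|_\infty\le 1\Bigr\}$$ is weakly tractable, i.e. $\lim_{\varepsilon^{-1}+d\to\infty}\frac{\ln n(\varepsilon,d)}{\varepsilon^{-1}+d}=0$. (iii) With $r_d$ as in (ii), approximation in the $L_1(B(0,r_d))$-norm of functions from the class $$F_d^3=\Bigl\{f\in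 C^\infty(B(0,r_d)):\ \sup_{k\in\mathbb{N}_0}\int_0^{r_d}S(\partial_\nu^k f,r)\,dr\le 1\Bigr\}$$ is weakly tractable, i.e. $\lim_{\varepsilon^{-1}+d\to\infty}\frac{\ln n(\varepsilon,d)}{\varepsilon^{-1}+d}=0$.
   Context: Multi-index notation: for $\alpha\in\mathbb{N}_0^d$, $|\alpha|=\alpha_1+\dots+\alpha_d$, $\alpha!=\alpha_1!\cdots\alpha_d!$, and $D^\alpha f=\partial^{|\alpha|}f/\partial x_1^{\alpha_1}\cdots\partial x_d^{\alpha_d}$. For $x\neq 0$, $(\partial_\nu^k f)(x)$ denotes the $k$-th derivative of $f$ at $x$ in the "normal" direction $x/\|x\|_2$, i.e. $\frac{d^k}{ds^k}f\bigl(x+s\,x/\|x\|_2\bigr)\big|_{s=0}$ (with $\partial_\nu^0 f=f$). For a function $g$ and $0<r\le r_d$, $S(g,r)=\frac{1}{\sigma(r\mathbb{S}^{d-1})}\int_{r\mathbb{S}^{d-1}}|g(y)|\,d\sigma(y)$ is the average of $|g|$ over the sphere of radius $r$, where $\sigma$ is the $(d-1)$-dimensional surface (Hausdorff) measure and $\mathbb{S}^{d-1}$ the unit sphere. Here $n(\varepsilon,d)$ is the information complexity: the minimal number of function evaluations needed by an algorithm to achieve worst-case error at most $\varepsilon$ over the class $F_d$ in the stated norm. *)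

theory Defs
  imports "HOL-Analysis.Analysis"
begin

definition Rd :: "nat \<Rightarrow> (nat \<Rightarrow> real) set" where
  "Rd d = PiE {..<d} (\<lambda>_. (UNIV :: real set))"

definition norm2 :: "nat \<Rightarrow> (nat \<Rightarrow> real) \<Rightarrow> real" where
  "norm2 d x = sqrt (\<Sum>i<d. (x i)\<^sup>2)"

definition zerod :: "nat \<Rightarrow> (nat \<Rightarrow> real)" where
  "zerod d = restrict (\<lambda>_. 0) {..<d}"

definition lebd :: "nat \<Rightarrow> (nat \<Rightarrow> real) measure" where
  "lebd d = PiM {..<d} (\<lambda>_. lborel)"

definition cube :: "nat \<Rightarrow> (nat \<Rightarrow> real) set" where
  "cube d = PiE {..<d} (\<lambda>_. {-1/2..1/2})"

definition ocube :: "nat \<Rightarrow> (nat \<Rightarrow> real) set" where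
  "ocube d = PiE {..<d} (\<lambda>_. {-1/2<..<1/2})"

definition cballd :: "nat \<Rightarrow> real \<Rightarrow> (nat \<Rightarrow> real) set" where
  "cballd d r = {x \<in> Rd d. norm2 d x \<le> r}"

definition oballd :: "nat \<Rightarrow> real \<Rightarrow> (nat \<Rightarrow> real) set" where
  "oballd d r = {x \<in> Rd d. norm2 d x < r}"

definition sphered :: "nat \<Rightarrow> real \<Rightarrow> (nat \<Rightarrow> real) set" where
  "sphered d r = {x \<in> Rd d. norm2 d x = r}"

definition partial :: "nat \<Rightarrow> ((nat \<Rightarrow> real) \<Rightarrow> real) \<Rightarrow> (nat \<Rightarrow> real) \<Rightarrow> real" where
  "partial i f x = deriv (\<lambda>t. f (x(i := x i + t))) 0"

fun pd_list :: "nat list \<Rightarrow> ((nat \<Rightarrow> real) \<Rightarrow> real) \<Rightarrow> (nat \<Rightarrow> real) \<Rightarrow> real" where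
  "pd_list [] f = f"
| "pd_list (i # is) f = partial i (pd_list is f)"

definition Dmulti :: "nat \<Rightarrow> (nat \<Rightarrow> nat) \<Rightarrow> ((nat \<Rightarrow> real) \<Rightarrow> real) \<Rightarrow> (nat \<Rightarrow> real) \<Rightarrow> real" where
  "Dmulti d \<beta> f = pd_list (concat (map (\<lambda>i. replicate (\<beta> i) i) [0..<d])) f"

definition mindices :: "nat \<Rightarrow> nat \<Rightarrow> (nat \<Rightarrow> nat) set" where
  "mindices d k = {\<beta>. (\<forall>i\<ge>d. \<beta> i = 0) \<and> (\<Sum>i<d. \<beta> i) = k}"

text \<open>C^infinity(K) for a closed domain K with interior U: f continuous on K, all iterated
  partial derivatives exist at every point of U and extend continuously to K.\<close>
definition smooth_on :: "nat \<Rightarrow> (nat \<Rightarrow> real) set \<Rightarrow> (nat \<Rightarrow> real) set \<Rightarrow> ((nat \<Rightarrow> real) \<Rightarrow> real) \<Rightarrow> bool" where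
  "smooth_on d U K f \<longleftrightarrow> continuous_on K f \<and>
     (\<forall>is. set is \<subseteq> {..<d} \<longrightarrow>
        (\<forall>i<d. \<forall>x\<in>U. (\<lambda>t. pd_list is f (x(i := x i + t))) differentiable (at 0)) \<and>
        (\<exists>g. continuous_on K g \<and> (\<forall>x\<in>U. g x = pd_list is f x)))"

text \<open>k-th derivative in the normal direction x/||x||_2 (for x \<noteq> 0).\<close>
definition ndiff :: "nat \<Rightarrow> nat \<Rightarrow> ((nat \<Rightarrow> real) \<Rightarrow> real) \<Rightarrow> (nat \<Rightarrow> real) \<Rightarrow> real" where
  "ndiff d k f x = (deriv ^^ k) (\<lambda>s. f (restrict (\<lambda>i. x i + s * x i / norm2 d x) {..<d})) 0"

definition supn :: "(nat \<Rightarrow> real) set \<Rightarrow> ((nat \<Rightarrow> real) \<Rightarrow> real) \<Rightarrow> ennreal" where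
  "supn U g = (SUP x\<in>U. ennreal \<bar>g x\<bar>)"

definition ediam :: "nat \<Rightarrow> (nat \<Rightarrow> real) set \<Rightarrow> ennreal" where
  "ediam d C = (SUP x\<in>C. SUP y\<in>C. ennreal (norm2 d (\<lambda>i. x i - y i)))"

definition hconst :: "nat \<Rightarrow> real" where
  "hconst s = pi powr (real s / 2) / Gamma (real s / 2 + 1)"

definition haus_delta :: "nat \<Rightarrow> nat \<Rightarrow> real \<Rightarrow> (nat \<Rightarrow> real) set \<Rightarrow> ennreal" where
  "haus_delta d s \<delta> A =
     (INF C \<in> {C :: nat \<Rightarrow> (nat \<Rightarrow> real) set. A \<subseteq> (\<Union>n. C n) \<and> (\<forall>n. ediam d (C n) \<le> ennreal \<delta>)}.
        (\<Sum>n. (if C n = {} then 0 else ennreal (hconst s) * (ediam d (C n) / 2) ^ s)))"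

definition haus_outer :: "nat \<Rightarrow> nat \<Rightarrow> (nat \<Rightarrow> real) set \<Rightarrow> ennreal" where
  "haus_outer d s A = (SUP \<delta>\<in>{0<..}. haus_delta d s \<delta> A)"

definition hausdorff :: "nat \<Rightarrow> nat \<Rightarrow> (nat \<Rightarrow> real) measure" where
  "hausdorff d s = measure_of (Rd d) (sets (lebd d)) (haus_outer d s)"

definition sph_avg :: "nat \<Rightarrow> ((nat \<Rightarrow> real) \<Rightarrow> real) \<Rightarrow> real \<Rightarrow> ennreal" where
  "sph_avg d g r =
     (\<integral>\<^sup>+ y \<in> sphered d r. ennreal \<bar>g y\<bar> \<partial>hausdorff d (d - 1))
       / emeasure (hausdorff d (d - 1)) (sphered d r)"

fun info :: "(real list \<Rightarrow> 'p) \<Rightarrow> ('p \<Rightarrow> real) \<Rightarrow> nat \<Rightarrow> real list" where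
  "info \<psi> f 0 = []"
| "info \<psi> f (Suc k) = (let ys = info \<psi> f k in ys @ [f (\<psi> ys)])"

definition achieves :: "'p set \<Rightarrow> ('p \<Rightarrow> real) set \<Rightarrow> (('p \<Rightarrow> real) \<Rightarrow> ('p \<Rightarrow> real) \<Rightarrow> ennreal)
    \<Rightarrow> real \<Rightarrow> nat \<Rightarrow> bool" where
  "achieves \<Omega> F err \<epsilon> n \<longleftrightarrow>
     (\<exists>\<psi> \<phi>. (\<forall>ys. \<psi> ys \<in> \<Omega>) \<and> (\<forall>f\<in>F. err f (\<phi> (info \<psi> f n)) \<le> ennreal \<epsilon>))"

text \<open>n(eps,d); infinity if no algorithm exists.\<close>
definition infc :: "'p set \<Rightarrow> ('p \<Rightarrow> real) set \<Rightarrow> (('p \<Rightarrow> real) \<Rightarrow> ('p \<Rightarrow> real) \<Rightarrow> ennreal)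
    \<Rightarrow> real \<Rightarrow> enat" where
  "infc \<Omega> F err \<epsilon> = (INF n \<in> {n. achieves \<Omega> F err \<epsilon> n}. enat n)"

definition err_sup :: "(nat \<Rightarrow> real) set \<Rightarrow> ((nat \<Rightarrow> real) \<Rightarrow> real) \<Rightarrow> ((nat \<Rightarrow> real) \<Rightarrow> real) \<Rightarrow> ennreal" where
  "err_sup K f g = (SUP x\<in>K. ennreal \<bar>f x - g x\<bar>)"

definition err_L1 :: "nat \<Rightarrow> (nat \<Rightarrow> real) set \<Rightarrow> ((nat \<Rightarrow> real) \<Rightarrow> real) \<Rightarrow> ((nat \<Rightarrow> real) \<Rightarrow> real) \<Rightarrow> ennreal" where
  "err_L1 d K f g = (if g \<in> borel_measurable (lebd d)
       then (\<integral>\<^sup>+ x \<in> K. ennreal \<bar>f x - g x\<bar> \<partial>lebd d) else \<infinity>)"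

definition F1 :: "nat \<Rightarrow> ((nat \<Rightarrow> real) \<Rightarrow> real) set" where
  "F1 d = {f. smooth_on d (ocube d) (cube d) f \<and>
     (\<forall>k. (\<Sum>\<beta>\<in>mindices d k. supn (ocube d) (Dmulti d \<beta> f) / ennreal (\<Prod>i<d. fact (\<beta> i))) \<le> 1)}"

definition F2 :: "nat \<Rightarrow> real \<Rightarrow> ((nat \<Rightarrow> real) \<Rightarrow> real) set" where
  "F2 d r = {f. smooth_on d (oballd d r) (cballd d r) f \<and>
     (\<forall>k. supn (oballd d r - {zerod d}) (ndiff d k f) \<le> 1)}"

definition F3 :: "nat \<Rightarrow> real \<Rightarrow> ((nat \<Rightarrow> real) \<Rightarrow> real) set" where
  "F3 d r = {f. smooth_on d (oballd d r) (cballd d r) f \<and>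
     (\<forall>k. (\<integral>\<^sup>+ \<rho> \<in> {0<..<r}. sph_avg d (ndiff d k f) \<rho> \<partial>lborel) \<le> 1)}"

definition quasi_poly_tractable :: "(real \<Rightarrow> nat \<Rightarrow> enat) \<Rightarrow> bool" where
  "quasi_poly_tractable N \<longleftrightarrow> (\<exists>C t. C > 0 \<and> t > 0 \<and>
     (\<forall>\<epsilon> d. 0 < \<epsilon> \<and> \<epsilon> < 1 \<and> d \<ge> 1 \<longrightarrow>
        (\<exists>n. N \<epsilon> d = enat n \<and> real n \<le> C * exp (t * (1 + ln (1 / \<epsilon>)) * (1 + ln (real d))))))"

definition weakly_tractable :: "(real \<Rightarrow> nat \<Rightarrow> enat) \<Rightarrow> bool" where
  "weakly_tractable N \<longleftrightarrow>
     (\<forall>\<epsilon> d. 0 < \<epsilon> \<and> \<epsilon> < 1 \<and> d \<ge> 1 \<longrightarrow> N \<epsilon> d \<noteq> \<infinity>) \<and>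
     (\<forall>\<eta>>0. \<exists>M. \<forall>\<epsilon> d. 0 < \<epsilon> \<and> \<epsilon> < 1 \<and> d \<ge> 1 \<and> 1 / \<epsilon> + real d \<ge> M \<longrightarrow>
        \<bar>ln (real (the_enat (N \<epsilon> d))) / (1 / \<epsilon> + real d)\<bar> < \<eta>)"

end

theory Submission
  imports Defs "HOL-Computational_Algebra.Polynomial" "HOL-Real_Asymp.Real_Asymp"
begin

text \<open>
  In all three classes a function is approximated by its Taylor polynomial of order \<open>k\<close> at the
  origin, whose error decays like \<open>2\<^sup>-\<^sup>k\<close> on the cube and like \<open>R\<^sup>k / k!\<close> on the ball of radius
  \<open>R \<le> sqrt d / 2\<close>; so \<open>k = O(ln (1/\<epsilon>))\<close>, respectively \<open>k = O(sqrt d + ln (1/\<epsilon>))\<close>, is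
  enough. The Taylor polynomial lies in a space of dimension at most \<open>(d + 1)\<^sup>k\<^sup>-\<^sup>1\<close> and is determined, up
  to an arbitrarily small error, by that many values of \<open>f\<close> at points \<open>h \<cdot> p\<close>, where the points \<open>p\<close> are
  unisolvent for polynomials of degree less than \<open>k\<close>: if \<open>|f(x) - T(x)| \<le> C |x|\<^sup>k\<close> uniformly over the
  class near the origin, then the error of the reconstruction is of order \<open>h\<close>.

  For the third class the \<open>L\<^sub>1\<close> error is estimated along rays. This needs that averaging over
  directions with respect to Lebesgue measure is the same as averaging with respect to the
  normalised Hausdorff measure of a sphere, for which rotation invariance of both suffices. The
  local bound \<open>C |x|\<^sup>k\<close> follows since the homogeneous Taylor terms are controlled pointwise by
  their \<open>L\<^sub>1\<close> norms (a form of degree \<open>k\<close> is annihilated by \<open>k + 1\<close> differences), with a constant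
  that is geometric in \<open>k\<close>.
\<close>

subsection \<open>Open sets and continuity in coordinates\<close>

text \<open>The sample count is fixed by d and the order k alone. The constant C and the
  neighbourhood in the local bound may therefore depend on d and k in any way: they only decide how
  small h must be. Quantitative care goes into the remainder on the whole domain, because it
  determines k. This is why constants exponential in d are harmless in the local bound for the third
  class. No reconstruction formula is evaluated either: the algorithm picks any member of the class
  that has the observed data, and two members with the same data are shown to have almost the same
  Taylor polynomial. The main obstacle is the third class, which controls f and its derivatives only
  through integrals, so that a pointwise local bound has to be extracted from these. The comparison
  of directional and spherical averages is made as an inequality for continuous nonnegative
  integrands.\<close>

definition boxopen :: "nat \<Rightarrow> (nat \<Rightarrow> real) set \<Rightarrow> bool" where
  "boxopen d U \<longleftrightarrow> U \<subseteq> Rd d \<and> (\<forall>x\<in>U. \<exists>e>0. \<forall>y\<in>Rd d. (\<forall>i<d. \<bar>y i - x i\<bar> < e) \<longrightarrow> y \<in> U)"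

lemma boxopenD:
  assumes "boxopen d U" "x \<in> U"
  obtains e where "e > 0" "\<And>y. y \<in> Rd d \<Longrightarrow> (\<And>i. i < d \<Longrightarrow> \<bar>y i - x i\<bar> < e) \<Longrightarrow> y \<in> U"
  using assms unfolding boxopen_def by meson

lemma Rd_eqI: "x \<in> Rd d \<Longrightarrow> y \<in> Rd d \<Longrightarrow> (\<And>i. i < d \<Longrightarrow> x i = y i) \<Longrightarrow> x = y"
  unfolding Rd_def by (auto intro: PiE_ext)

lemma restrict_in_Rd [simp]: "restrict f {..<d} \<in> Rd d"
  by (auto simp: Rd_def)

lemma Rd_undefined: "x \<in> Rd d \<Longrightarrow> \<not> i < d \<Longrightarrow> x i = undefined"
  by (simp add: Rd_def PiE_def extensional_def)

lemma zerod_in_Rd [simp]: "zerod d \<in> Rd d"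
  by (simp add: zerod_def)

lemma upd_in_Rd: "x \<in> Rd d \<Longrightarrow> i < d \<Longrightarrow> x(i := t) \<in> Rd d"
  by (auto simp: Rd_def PiE_def extensional_def)

lemma tendsto_coordinates:
  fixes f :: "'a \<Rightarrow> nat \<Rightarrow> real"
  assumes "\<And>i. ((\<lambda>n. f n i) \<longlongrightarrow> l i) F"
  shows "(f \<longlongrightarrow> l) F"
proof -
  have "limitin (product_topology (\<lambda>_. euclidean) UNIV) f l F"
    using assms by (auto simp: limitin_componentwise)
  then show ?thesis
    by (simp add: euclidean_product_topology)
qed

text \<open>Continuity refers to the product topology on all functions from \<open>nat\<close>; this
  is its epsilon-delta form in d coordinates. A sequence of counterexamples would converge
  coordinatewise, because the coordinates from d on are constant on \<open>Rd d\<close>.\<close>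

lemma continuous_on_box:
  assumes F: "continuous_on U F" and U: "U \<subseteq> Rd d" and x: "x \<in> U" and e: "e > (0::real)"
  shows "\<exists>\<delta>>0. \<forall>y\<in>U. (\<forall>i<d. \<bar>y i - x i\<bar> < \<delta>) \<longrightarrow> \<bar>F y - F x\<bar> < e"
proof (rule ccontr)
  assume neg: "\<not> ?thesis"
  have "\<forall>n::nat. \<exists>y\<in>U. (\<forall>i<d. \<bar>y i - x i\<bar> < 1 / Suc n) \<and> \<not> \<bar>F y - F x\<bar> < e"
  proof
    fix n :: nat
    have "1 / real (Suc n) > 0" by simp
    then show "\<exists>y\<in>U. (\<forall>i<d. \<bar>y i - x i\<bar> < 1 / Suc n) \<and> \<not> \<bar>F y - F x\<bar> < e"
      using neg by blast
  qed
  then obtain y where y: "\<And>n. y n \<in> U" "\<And>n i. i < d \<Longrightarrow> \<bar>y n i - x i\<bar> < 1 / Suc n"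
    "\<And>n. \<not> \<bar>F (y n) - F x\<bar> < e" by metis
  have "y \<longlonglongrightarrow> x"
  proof (rule tendsto_coordinates)
    fix i
    show "(\<lambda>n. y n i) \<longlonglongrightarrow> x i"
    proof (cases "i < d")
      case True
      have "(\<lambda>n. y n i - x i) \<longlonglongrightarrow> 0"
        by (rule Lim_null_comparison[OF _ LIMSEQ_inverse_real_of_nat])
           (use y(2)[OF True] in \<open>auto intro!: always_eventually less_imp_le simp: inverse_eq_divide\<close>)
      then show ?thesis by (simp add: LIM_zero_iff)
    next
      case False
      then have "y n i = x i" for n
        using y(1)[of n] x U by (simp add: Rd_undefined[of _ d] subset_iff)
      then show ?thesis by simp
    qed
  qed
  then have "(\<lambda>n. F (y n)) \<longlonglongrightarrow> F x"
    by (rule continuous_on_tendsto_compose[OF F]) (use x y(1) in auto)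
  then have "\<forall>\<^sub>F n in sequentially. dist (F (y n)) (F x) < e"
    using e by (simp add: tendsto_iff)
  then show False
    using y(3) by (auto simp: eventually_sequentially dist_real_def)
qed

subsection \<open>Chain rule along lines\<close>

text \<open>\<open>restrict\<close> makes every point of the line extensional, so x and v may be
  arbitrary functions of which only the first d values enter.\<close>

definition line :: "nat \<Rightarrow> (nat \<Rightarrow> real) \<Rightarrow> (nat \<Rightarrow> real) \<Rightarrow> real \<Rightarrow> nat \<Rightarrow> real" where
  "line d x v s = restrict (\<lambda>i. x i + s * v i) {..<d}"

lemma line_in_Rd [simp]: "line d x v s \<in> Rd d"
  by (simp add: line_def)

lemma line_nth [simp]: "i < d \<Longrightarrow> line d x v s i = x i + s * v i"
  by (simp add: line_def)

lemma line_0: "x \<in> Rd d \<Longrightarrow> line d x v 0 = x"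
  by (rule Rd_eqI) auto

lemma line_line: "line d (line d x v s) v t = line d x v (s + t)"
  by (rule Rd_eqI[of _ d]) (auto simp: algebra_simps)

definition pdiff_on :: "nat \<Rightarrow> (nat \<Rightarrow> real) set \<Rightarrow> ((nat \<Rightarrow> real) \<Rightarrow> real) \<Rightarrow> bool" where
  "pdiff_on d U F \<longleftrightarrow> (\<forall>i<d. \<forall>x\<in>U. (\<lambda>t. F (x(i := x i + t))) differentiable (at 0))"

lemma pdiff_on_DERIV:
  assumes "pdiff_on d U F" "i < d" "x(i := t) \<in> U"
  shows "((\<lambda>t. F (x(i := t))) has_real_derivative partial i F (x(i := t))) (at t)"
proof -
  define y where "y = x(i := t)"
  have "(\<lambda>s. F (y(i := y i + s))) differentiable (at 0)"
    using assms unfolding pdiff_on_def y_def by blast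
  then have "((\<lambda>s. F (y(i := y i + s))) has_real_derivative partial i F y) (at 0)"
    unfolding partial_def using DERIV_deriv_iff_real_differentiable by blast
  moreover have "(\<lambda>s. F (y(i := y i + s))) = (\<lambda>s. F (x(i := t + s)))"
    by (simp add: y_def)
  ultimately have "((\<lambda>s. F (x(i := t + s))) has_real_derivative partial i F y) (at 0)"
    by simp
  then show ?thesis
    unfolding y_def using DERIV_shift[of "\<lambda>s. F (x(i := s))" _ 0 t] by (simp add: add.commute)
qed

lemma partial_cong:
  assumes U: "boxopen d U" and FG: "\<And>y. y \<in> U \<Longrightarrow> F y = G y" and x: "x \<in> U" and i: "i < d"
  shows "partial i F x = partial i G x"
proof -
  obtain e where e: "e > 0" "\<And>y. y \<in> Rd d \<Longrightarrow> (\<And>i. i < d \<Longrightarrow> \<bar>y i - x i\<bar> < e) \<Longrightarrow> y \<in> U"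
    using boxopenD[OF U x] by blast
  have xR: "x \<in> Rd d" using U x by (auto simp: boxopen_def)
  have "\<forall>\<^sub>F t in nhds 0. F (x(i := x i + t)) = G (x(i := x i + t))"
  proof -
    have "\<forall>\<^sub>F t in nhds (0::real). \<bar>t\<bar> < e"
      using e(1) eventually_nhds_metric[of "\<lambda>t. \<bar>t\<bar> < e" "0::real"] by (auto simp: dist_real_def)
    then show ?thesis
      by eventually_elim (rule FG, rule e(2), auto intro: upd_in_Rd xR i simp: e(1))
  qed
  then show ?thesis unfolding partial_def by (rule deriv_cong_ev) simp
qed

text \<open>Measured by distances from \<open>a\<close>, so that the increment may be positive,
  negative or zero; the coordinate increments \<open>s * v n\<close> have no fixed sign.\<close>

lemma mvt_segment:
  fixes g :: "real \<Rightarrow> real"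
  assumes "\<And>t. \<bar>t - a\<bar> \<le> \<bar>b - a\<bar> \<Longrightarrow> (g has_real_derivative g' t) (at t)"
    and "\<And>t. \<bar>t - a\<bar> \<le> \<bar>b - a\<bar> \<Longrightarrow> \<bar>g' t - D\<bar> \<le> e"
  shows "\<bar>g b - g a - (b - a) * D\<bar> \<le> e * \<bar>b - a\<bar>"
proof -
  have "\<exists>t. \<bar>t - a\<bar> \<le> \<bar>b - a\<bar> \<and> g b - g a = (b - a) * g' t"
  proof (cases a b rule: linorder_cases)
    case less
    then obtain t where "t > a" "t < b" "g b - g a = (b - a) * g' t"
      using MVT2[of a b g g'] assms(1) by auto
    then show ?thesis by (intro exI[of _ t]) auto
  next
    case greater
    then obtain t where "t > b" "t < a" "g a - g b = (a - b) * g' t"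
      using MVT2[of b a g g'] assms(1) by auto
    then show ?thesis by (intro exI[of _ t]) (auto simp: algebra_simps)
  qed auto
  then obtain t where t: "\<bar>t - a\<bar> \<le> \<bar>b - a\<bar>" "g b - g a = (b - a) * g' t" by blast
  have "g b - g a - (b - a) * D = (b - a) * (g' t - D)"
    using t(2) by (simp add: algebra_simps)
  then have "\<bar>g b - g a - (b - a) * D\<bar> = \<bar>b - a\<bar> * \<bar>g' t - D\<bar>"
    by (simp add: abs_mult)
  also have "\<dots> \<le> \<bar>b - a\<bar> * e"
    by (rule mult_left_mono) (use assms(2) t(1) in auto)
  finally show ?thesis by (simp add: mult.commute)
qed

text \<open>The classical argument that continuous partial derivatives imply differentiability: go
  from x to the point on the line by changing one coordinate at a time, and apply the mean value
  theorem to each change.\<close>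

lemma chain_rule_line_0:
  assumes U: "boxopen d U" and F: "pdiff_on d U F" and x: "x \<in> U"
    and C: "\<And>i. i < d \<Longrightarrow> continuous_on U (partial i F)"
  shows "((\<lambda>s. F (line d x v s)) has_real_derivative (\<Sum>i<d. partial i F x * v i)) (at 0)"
proof -
  have UR: "U \<subseteq> Rd d" and xR: "x \<in> Rd d" using U x by (auto simp: boxopen_def)
  obtain e0 where e0: "e0 > 0" "\<And>y. y \<in> Rd d \<Longrightarrow> (\<And>i. i < d \<Longrightarrow> \<bar>y i - x i\<bar> < e0) \<Longrightarrow> y \<in> U"
    using boxopenD[OF U x] by blast
  \<comment> \<open>A bound on the entries of v that stays positive for v = 0, so that radii can be
    divided by it.\<close>
  define V where "V = 1 + (\<Sum>i<d. \<bar>v i\<bar>)"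
  have V: "V > 0" "\<And>i. i < d \<Longrightarrow> \<bar>v i\<bar> \<le> V"
  proof -
    have "(\<Sum>i<d. \<bar>v i\<bar>) \<ge> 0" by (rule sum_nonneg) auto
    then show "V > 0" unfolding V_def by linarith
    fix i assume "i < d"
    then have "\<bar>v i\<bar> \<le> (\<Sum>i<d. \<bar>v i\<bar>)" by (intro member_le_sum) auto
    then show "\<bar>v i\<bar> \<le> V" by (simp add: V_def)
  qed
  have key: "\<exists>\<delta>>0. \<forall>s. \<bar>s\<bar> < \<delta> \<longrightarrow> \<bar>F (line d x v s) - F x - s * (\<Sum>i<d. partial i F x * v i)\<bar> \<le> e * V * \<bar>s\<bar>"
    if e: "e > 0" for e
  proof -
    have "\<forall>i\<in>{..<d}. \<exists>\<delta>>0. \<forall>y\<in>U. (\<forall>j<d. \<bar>y j - x j\<bar> < \<delta>) \<longrightarrow> \<bar>partial i F y - partial i F x\<bar> < e"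
      using continuous_on_box[OF C UR x e] by auto
    then obtain \<delta> where \<delta>: "\<And>i. i < d \<Longrightarrow> \<delta> i > 0"
      "\<And>i y. i < d \<Longrightarrow> y \<in> U \<Longrightarrow> (\<And>j. j < d \<Longrightarrow> \<bar>y j - x j\<bar> < \<delta> i) \<Longrightarrow> \<bar>partial i F y - partial i F x\<bar> < e"
      by (metis lessThan_iff)
    define \<delta>0 where "\<delta>0 = Min (insert e0 (\<delta> ` {..<d}))"
    have \<delta>0: "\<delta>0 > 0" "\<delta>0 \<le> e0" "\<And>i. i < d \<Longrightarrow> \<delta>0 \<le> \<delta> i"
      unfolding \<delta>0_def using \<delta>(1) e0(1) by (auto intro!: Min_le)
    show ?thesis
    proof (intro exI[of _ "\<delta>0 / V"] conjI allI impI)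
      show "\<delta>0 / V > 0" using \<delta>0 V by simp
      fix s assume s: "\<bar>s\<bar> < \<delta>0 / V"
      have sv: "\<bar>s * v i\<bar> < \<delta>0" if "i < d" for i
      proof -
        have "\<bar>s * v i\<bar> \<le> \<bar>s\<bar> * V" using V(2)[OF that] by (simp add: abs_mult mult_left_mono)
        also have "\<dots> < \<delta>0" using s V by (simp add: field_simps)
        finally show ?thesis .
      qed
      \<comment> \<open>In \<open>p n\<close> the first n coordinates have already been
        moved.\<close>
      define p where "p n = restrict (\<lambda>i. if i < n then x i + s * v i else x i) {..<d}" for n
      have pd: "p d = line d x v s" and p0: "p 0 = x"
        using xR by (auto intro!: Rd_eqI[of _ d] simp: p_def)
      have step: "\<bar>F (p (Suc n)) - F (p n) - s * (partial n F x * v n)\<bar> \<le> e * \<bar>s * v n\<bar>" if n: "n < d" for n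
      proof -
        have pS: "p (Suc n) = (p n)(n := x n + s * v n)" and pn: "p n = (p n)(n := x n)"
          using n by (auto simp: p_def fun_eq_iff less_Suc_eq)
        have inU: "(p n)(n := t) \<in> U \<and> \<bar>partial n F ((p n)(n := t)) - partial n F x\<bar> \<le> e"
          if t: "\<bar>t - x n\<bar> \<le> \<bar>(x n + s * v n) - x n\<bar>" for t
        proof -
          have R: "(p n)(n := t) \<in> Rd d" using n by (intro upd_in_Rd) (auto simp: p_def)
          have c: "\<bar>((p n)(n := t)) i - x i\<bar> < \<delta>0" if "i < d" for i
            using that sv[OF that] sv[OF n] t \<delta>0(1) by (auto simp: p_def)
          have "(p n)(n := t) \<in> U" by (rule e0(2)[OF R]) (use c \<delta>0(2) in fastforce)
          moreover have "\<bar>partial n F ((p n)(n := t)) - partial n F x\<bar> < e"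
            by (rule \<delta>(2)[OF n calculation]) (use c \<delta>0(3)[OF n] in fastforce)
          ultimately show ?thesis by simp
        qed
        have "\<bar>F ((p n)(n := x n + s * v n)) - F ((p n)(n := x n)) - ((x n + s * v n) - x n) * partial n F x\<bar>
           \<le> e * \<bar>(x n + s * v n) - x n\<bar>"
          by (rule mvt_segment[where g = "\<lambda>t. F ((p n)(n := t))"])
             (use inU pdiff_on_DERIV[OF F n] in auto)
        then show ?thesis using pS pn by (simp add: algebra_simps)
      qed
      have "F (line d x v s) - F x = (\<Sum>n<d. F (p (Suc n)) - F (p n))"
        by (simp add: sum_lessThan_telescope[of "\<lambda>n. F (p n)"] pd p0)
      then have "F (line d x v s) - F x - s * (\<Sum>i<d. partial i F x * v i)
          = (\<Sum>n<d. F (p (Suc n)) - F (p n) - s * (partial n F x * v n))"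
        by (simp add: sum_subtractf sum_distrib_left)
      also have "\<bar>\<dots>\<bar> \<le> (\<Sum>n<d. e * \<bar>s * v n\<bar>)"
        by (rule order_trans[OF sum_abs sum_mono]) (use step in auto)
      also have "\<dots> = e * \<bar>s\<bar> * (\<Sum>n<d. \<bar>v n\<bar>)"
        by (simp add: sum_distrib_left abs_mult mult.assoc)
      also have "\<dots> \<le> e * \<bar>s\<bar> * V"
        using e by (intro mult_left_mono) (auto simp: V_def)
      finally show "\<bar>F (line d x v s) - F x - s * (\<Sum>i<d. partial i F x * v i)\<bar> \<le> e * V * \<bar>s\<bar>"
        by (simp add: mult.commute mult.left_commute)
    qed
  qed
  show ?thesis
    unfolding has_field_derivative_def has_derivative_at_alt
  proof (intro conjI allI impI)
    show "bounded_linear ((*) (\<Sum>i<d. partial i F x * v i))" by (rule bounded_linear_mult_right)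
    fix e :: real assume "e > 0"
    then have "e / V > 0" using V by simp
    from key[OF this] obtain \<delta> where "\<delta> > 0"
      "\<forall>s. \<bar>s\<bar> < \<delta> \<longrightarrow> \<bar>F (line d x v s) - F x - s * (\<Sum>i<d. partial i F x * v i)\<bar> \<le> e / V * V * \<bar>s\<bar>"
      by blast
    then show "\<exists>da>0. \<forall>y. norm (y - 0) < da \<longrightarrow>
      norm (F (line d x v y) - F (line d x v 0) - (\<Sum>i<d. partial i F x * v i) * (y - 0)) \<le> e * norm (y - 0)"
      using V(1) by (intro exI[of _ \<delta>]) (auto simp: line_0[OF xR] mult.commute)
  qed
qed

lemma chain_rule_line:
  assumes U: "boxopen d U" and F: "pdiff_on d U F" and x: "line d x v s \<in> U"
    and C: "\<And>i. i < d \<Longrightarrow> continuous_on U (partial i F)"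
  shows "((\<lambda>s. F (line d x v s)) has_real_derivative (\<Sum>i<d. partial i F (line d x v s) * v i)) (at s)"
proof -
  have "((\<lambda>t. F (line d (line d x v s) v t)) has_real_derivative
     (\<Sum>i<d. partial i F (line d x v s) * v i)) (at 0)"
    by (rule chain_rule_line_0[OF U F x C])
  then have "((\<lambda>t. F (line d x v (t + s))) has_real_derivative
     (\<Sum>i<d. partial i F (line d x v s) * v i)) (at 0)"
    by (simp add: line_line add.commute)
  then show ?thesis
    using DERIV_shift[of "\<lambda>s. F (line d x v s)" _ 0 s] by simp
qed

subsection \<open>Symmetry of mixed partial derivatives\<close>

text \<open>The second difference over a square is an increment of an increment: the mean value
  theorem in direction i, and then in direction j, turns it into one mixed derivative at an inner
  point.\<close>

lemma mixed_difference:
  assumes F: "pdiff_on d U F" "pdiff_on d U (partial i F)"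
    and ij: "i < d" "j < d" "i \<noteq> j" and h: "h > 0"
    and B: "\<And>s t. 0 \<le> s \<Longrightarrow> s \<le> h \<Longrightarrow> 0 \<le> t \<Longrightarrow> t \<le> h \<Longrightarrow> x(i := x i + s, j := x j + t) \<in> U"
  shows "\<exists>s t. 0 < s \<and> s < h \<and> 0 < t \<and> t < h \<and>
     F (x(i := x i + h, j := x j + h)) - F (x(i := x i + h)) - F (x(j := x j + h)) + F x
       = h * h * partial j (partial i F) (x(i := x i + s, j := x j + t))"
proof -
  define g where "g s = F (x(i := x i + s, j := x j + h)) - F (x(i := x i + s, j := x j + 0))" for s
  have D: "((\<lambda>s. G (x(i := x i + s, j := c))) has_real_derivative
       partial i G (x(i := x i + s, j := c))) (at s)"
    if G: "pdiff_on d U G" and "x(i := x i + s, j := c) \<in> U" for s c G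
  proof -
    have eq: "x(i := u, j := c) = (x(j := c))(i := u)" for u using ij by (simp add: fun_upd_twist)
    have "((\<lambda>t. G ((x(j := c))(i := t))) has_real_derivative partial i G ((x(j := c))(i := x i + s))) (at (s + x i))"
      using pdiff_on_DERIV[OF G ij(1), of "x(j := c)" "x i + s"] that by (simp add: eq add.commute)
    then show ?thesis
      using DERIV_shift[of "\<lambda>t. G ((x(j := c))(i := t))" _ s "x i"] by (simp add: eq add.commute)
  qed
  have "\<exists>s>0. s < h \<and> g h - g 0 = (h - 0) * (partial i F (x(i := x i + s, j := x j + h)) - partial i F (x(i := x i + s, j := x j + 0)))"
  proof (rule MVT2[OF h])
    fix s assume "0 \<le> s" "s \<le> h"
    then show "(g has_real_derivative (partial i F (x(i := x i + s, j := x j + h)) - partial i F (x(i := x i + s, j := x j + 0)))) (at s)"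
      unfolding g_def using B[of s h] B[of s 0] h by (intro DERIV_diff D F) auto
  qed
  then obtain s where s: "0 < s" "s < h"
    "g h - g 0 = h * (partial i F (x(i := x i + s, j := x j + h)) - partial i F (x(i := x i + s, j := x j + 0)))"
    by auto
  define g2 where "g2 t = partial i F (x(i := x i + s, j := x j + t))" for t
  have "\<exists>t>0. t < h \<and> g2 h - g2 0 = (h - 0) * partial j (partial i F) (x(i := x i + s, j := x j + t))"
  proof (rule MVT2[OF h])
    fix t assume t: "0 \<le> t" "t \<le> h"
    have "((\<lambda>t. partial i F ((x(i := x i + s))(j := t))) has_real_derivative
        partial j (partial i F) ((x(i := x i + s))(j := x j + t))) (at (t + x j))"
      using pdiff_on_DERIV[OF F(2) ij(2), of "x(i := x i + s)" "x j + t"] B[of s t] s t by (simp add: add.commute)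
    then show "(g2 has_real_derivative partial j (partial i F) (x(i := x i + s, j := x j + t))) (at t)"
      unfolding g2_def using DERIV_shift[of "\<lambda>t. partial i F ((x(i := x i + s))(j := t))" _ t "x j"]
      by (simp add: add.commute)
  qed
  then obtain t where "0 < t" "t < h" "g2 h - g2 0 = h * partial j (partial i F) (x(i := x i + s, j := x j + t))"
    by auto
  moreover have "g h - g 0 = F (x(i := x i + h, j := x j + h)) - F (x(i := x i + h)) - F (x(j := x j + h)) + F x"
    using ij(3) fun_upd_triv[of "x(i := x i + h)" j] by (simp add: g_def)
  ultimately show ?thesis using s by (intro exI[of _ s] exI[of _ t]) (simp add: g2_def)
qed

text \<open>Schwarz's theorem. The second difference is symmetric in i and j, so one mixed
  derivative at some point near x equals the other one at another such point; continuity carries the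
  equality to x.\<close>

lemma partial_commute:
  assumes U: "boxopen d U" and x: "x \<in> U" and ij: "i < d" "j < d"
    and F: "pdiff_on d U F" "pdiff_on d U (partial i F)" "pdiff_on d U (partial j F)"
    and C: "continuous_on U (partial i (partial j F))" "continuous_on U (partial j (partial i F))"
  shows "partial i (partial j F) x = partial j (partial i F) x"
proof (cases "i = j")
  case False
  have UR: "U \<subseteq> Rd d" and xR: "x \<in> Rd d" using U x by (auto simp: boxopen_def)
  obtain e0 where e0: "e0 > 0" "\<And>y. y \<in> Rd d \<Longrightarrow> (\<And>i. i < d \<Longrightarrow> \<bar>y i - x i\<bar> < e0) \<Longrightarrow> y \<in> U"
    using boxopenD[OF U x] by blast
  have "\<bar>partial i (partial j F) x - partial j (partial i F) x\<bar> \<le> e" if "e > 0" for e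
  proof -
    have e2: "e / 2 > 0" using that by simp
    obtain d1 where d1: "d1 > 0" "\<forall>y\<in>U. (\<forall>k<d. \<bar>y k - x k\<bar> < d1) \<longrightarrow> \<bar>partial i (partial j F) y - partial i (partial j F) x\<bar> < e / 2"
      using continuous_on_box[OF C(1) UR x e2] by blast
    obtain d2 where d2: "d2 > 0" "\<forall>y\<in>U. (\<forall>k<d. \<bar>y k - x k\<bar> < d2) \<longrightarrow> \<bar>partial j (partial i F) y - partial j (partial i F) x\<bar> < e / 2"
      using continuous_on_box[OF C(2) UR x e2] by blast
    define h where "h = min e0 (min d1 d2) / 2"
    have h: "h > 0" "h < e0" "h < d1" "h < d2" using e0(1) d1(1) d2(1) by (auto simp: h_def)
    have near: "\<bar>(x(a := x a + s, b := x b + t)) k - x k\<bar> \<le> h" if "0 \<le> s" "s \<le> h" "0 \<le> t" "t \<le> h" for a b s t k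
      using that by auto
    have BU: "x(a := x a + s, b := x b + t) \<in> U" if "0 \<le> s" "s \<le> h" "0 \<le> t" "t \<le> h" "a < d" "b < d" for a b s t
      using near[OF that(1-4), of a b] h(2) by (intro e0(2) upd_in_Rd xR that) (meson le_less_trans)
    obtain s t where st: "0 < s" "s < h" "0 < t" "t < h" "F (x(i := x i + h, j := x j + h)) - F (x(i := x i + h)) - F (x(j := x j + h)) + F x
       = h * h * partial j (partial i F) (x(i := x i + s, j := x j + t))"
      using mixed_difference[OF F(1,2) ij False h(1) BU] ij by blast
    obtain s' t' where st': "0 < s'" "s' < h" "0 < t'" "t' < h" "F (x(j := x j + h, i := x i + h)) - F (x(j := x j + h)) - F (x(i := x i + h)) + F x
       = h * h * partial i (partial j F) (x(j := x j + s', i := x i + t'))"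
      using mixed_difference[OF F(1,3) ij(2,1) _ h(1) BU] ij False by blast
    have tw: "x(j := x j + h, i := x i + h) = x(i := x i + h, j := x j + h)"
      using False by (simp add: fun_upd_twist)
    have arith: "A = B" if "a - b - c + e = A" "a - c - b + e = B" for a b c e A B :: real
      using that by simp
    have "h * h * partial j (partial i F) (x(i := x i + s, j := x j + t)) = h * h * partial i (partial j F) (x(j := x j + s', i := x i + t'))"
      by (rule arith[OF st(5) st'(5)[unfolded tw]])
    then have eq: "partial j (partial i F) (x(i := x i + s, j := x j + t)) = partial i (partial j F) (x(j := x j + s', i := x i + t'))"
      using h(1) by simp
    have "\<bar>partial j (partial i F) (x(i := x i + s, j := x j + t)) - partial j (partial i F) x\<bar> < e / 2"
      using d2(2) BU[of s t i j] near[of s t i j] st ij h(4) by (meson less_imp_le le_less_trans)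
    moreover have "\<bar>partial i (partial j F) (x(j := x j + s', i := x i + t')) - partial i (partial j F) x\<bar> < e / 2"
      using d1(2) BU[of s' t' j i] near[of s' t' j i] st' ij h(3) by (meson less_imp_le le_less_trans)
    ultimately show ?thesis using eq by linarith
  qed
  then have "\<bar>partial i (partial j F) x - partial j (partial i F) x\<bar> \<le> 0"
    by (rule field_le_epsilon[of _ 0, simplified]) 
  then show ?thesis by simp
qed simp

subsection \<open>Multi-indices\<close>

lemma mindices_0: "mindices d 0 = {\<lambda>_. 0}"
proof -
  have "\<beta> = (\<lambda>_. 0)" if "\<forall>i\<ge>d. \<beta> i = 0" "\<forall>i<d. \<beta> i = 0" for \<beta> :: "nat \<Rightarrow> nat"
    using that by (meson ext not_le)
  then show ?thesis by (auto simp: mindices_def)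
qed

lemma sum_inc:
  fixes i d :: nat
  assumes "i < d"
  shows "(\<Sum>j<d. (\<beta>(i := Suc (\<beta> i))) j) = Suc (\<Sum>j<d. \<beta> j :: nat)"
  using assms by (subst (1 2) sum.remove[of _ i]) auto

lemma mindices_inc: "\<beta> \<in> mindices d k \<Longrightarrow> i < d \<Longrightarrow> \<beta>(i := Suc (\<beta> i)) \<in> mindices d (Suc k)"
  using sum_inc[of i d \<beta>] by (auto simp: mindices_def)

lemma mindices_dec:
  assumes "\<gamma> \<in> mindices d (Suc k)" "i < d" "\<gamma> i > 0"
  shows "\<gamma>(i := \<gamma> i - 1) \<in> mindices d k"
proof -
  define \<beta> where "\<beta> = \<gamma>(i := \<gamma> i - 1)"
  have "\<gamma> = \<beta>(i := Suc (\<beta> i))" using assms by (auto simp: \<beta>_def fun_eq_iff)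
  then have "Suc (\<Sum>j<d. \<beta> j) = Suc k" using sum_inc[OF assms(2), of \<beta>] assms(1) by (auto simp: mindices_def)
  then show ?thesis using assms unfolding \<beta>_def[symmetric] by (auto simp: mindices_def \<beta>_def)
qed

lemma mindices_Suc: "mindices d (Suc k) = (\<Union>i<d. (\<lambda>\<beta>. \<beta>(i := Suc (\<beta> i))) ` mindices d k)"
proof (intro equalityI subsetI)
  fix \<gamma> assume \<gamma>: "\<gamma> \<in> mindices d (Suc k)"
  then have "(\<Sum>i<d. \<gamma> i) \<noteq> 0" by (auto simp: mindices_def)
  then obtain i where i: "i < d" "\<gamma> i > 0" by (auto dest: sum.not_neutral_contains_not_neutral)
  have "\<gamma> = (\<lambda>\<beta>. \<beta>(i := Suc (\<beta> i))) (\<gamma>(i := \<gamma> i - 1))" using i by auto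
  with mindices_dec[OF \<gamma> i] i(1) show "\<gamma> \<in> (\<Union>i<d. (\<lambda>\<beta>. \<beta>(i := Suc (\<beta> i))) ` mindices d k)"
    by blast
qed (auto intro: mindices_inc)

lemma finite_mindices [simp]: "finite (mindices d k)"
  by (induction k) (auto simp: mindices_0 mindices_Suc)

text \<open>Raising the order by one either changes nothing or increases one of d entries, hence a
  factor d + 1 per step. The bound is crude, but its logarithm k ln (d + 1) is small enough for all
  three rates.\<close>

lemma card_mindices_less: "card (\<Union>j\<le>k. mindices d j) \<le> (d + 1) ^ k"
proof (induction k)
  case 0
  then show ?case by (simp add: mindices_0)
next
  case (Suc k)
  let ?M = "\<Union>j\<le>k. mindices d j" and ?i = "\<lambda>i \<beta>. \<beta>(i := Suc (\<beta> i :: nat))"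
  have "(\<Union>j\<le>Suc k. mindices d j) \<subseteq> ?M \<union> (\<Union>i<d. ?i i ` ?M)"
    by (auto simp: atMost_Suc mindices_Suc)
  then have "card (\<Union>j\<le>Suc k. mindices d j) \<le> card (?M \<union> (\<Union>i<d. ?i i ` ?M))"
    by (intro card_mono) auto
  also have "\<dots> \<le> card ?M + card (\<Union>i<d. ?i i ` ?M)" by (rule card_Un_le)
  also have "card (\<Union>i<d. ?i i ` ?M) \<le> (\<Sum>i<d. card (?i i ` ?M))" by (rule card_UN_le) simp
  also have "\<dots> \<le> (\<Sum>i<d. card ?M)" by (intro sum_mono card_image_le) auto
  finally have "card (\<Union>j\<le>Suc k. mindices d j) \<le> (d + 1) * card ?M" by simp
  also have "\<dots> \<le> (d + 1) * (d + 1) ^ k" by (rule mult_left_mono[OF Suc]) simp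
  finally show ?case by simp
qed

definition mpow :: "nat \<Rightarrow> (nat \<Rightarrow> real) \<Rightarrow> (nat \<Rightarrow> nat) \<Rightarrow> real" where
  "mpow d v \<beta> = (\<Prod>i<d. v i ^ \<beta> i)"

lemma mpow_inc: "i < d \<Longrightarrow> mpow d v (\<beta>(i := Suc (\<beta> i))) = v i * mpow d v \<beta>"
  unfolding mpow_def by (subst (1 2) prod.remove[of _ i]) auto

lemma mpow_scale:
  assumes "\<beta> \<in> mindices d k" "\<And>i. i < d \<Longrightarrow> w i = c * v i"
  shows "mpow d w \<beta> = c ^ k * mpow d v \<beta>"
proof -
  have "mpow d w \<beta> = (\<Prod>i<d. c ^ \<beta> i * v i ^ \<beta> i)"
    unfolding mpow_def by (intro prod.cong) (auto simp: assms power_mult_distrib)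
  also have "\<dots> = c ^ (\<Sum>i<d. \<beta> i) * mpow d v \<beta>"
    by (simp add: prod.distrib mpow_def power_sum)
  finally show ?thesis using assms(1) by (simp add: mindices_def)
qed

lemma abs_mpow_le:
  assumes "\<beta> \<in> mindices d k" "\<And>i. i < d \<Longrightarrow> \<bar>v i\<bar> \<le> m"
  shows "\<bar>mpow d v \<beta>\<bar> \<le> m ^ k"
proof -
  have "\<bar>mpow d v \<beta>\<bar> = (\<Prod>i<d. \<bar>v i\<bar> ^ \<beta> i)"
    unfolding mpow_def by (simp add: abs_prod power_abs)
  also have "\<dots> \<le> (\<Prod>i<d. m ^ \<beta> i)"
    by (intro prod_mono) (auto intro!: power_mono assms)
  also have "\<dots> = m ^ k" using assms(1) by (simp add: mindices_def flip: power_sum)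
  finally show ?thesis .
qed

definition mfact :: "nat \<Rightarrow> (nat \<Rightarrow> nat) \<Rightarrow> real" where
  "mfact d \<beta> = (\<Prod>i<d. fact (\<beta> i))"

lemma mfact_pos [simp]: "mfact d \<beta> > 0"
  by (auto simp: mfact_def intro: prod_pos)

lemma mfact_inc: "i < d \<Longrightarrow> mfact d (\<beta>(i := Suc (\<beta> i))) = (1 + real (\<beta> i)) * mfact d \<beta>"
  unfolding mfact_def by (subst (1 2) prod.remove[of _ i]) auto

text \<open>Both sides count pairs of an index \<gamma> of order k + 1 and an entry i that is
  lowered to reach \<beta>: lowering divides \<open>mfact d \<gamma>\<close> by
  \<open>\<gamma> i\<close>, and the entries of \<gamma> add up to k + 1. This is the combinatorial
  content of differentiating a Taylor form along a line.\<close>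

lemma sum_mindices_Suc:
  fixes c :: "(nat \<Rightarrow> nat) \<Rightarrow> real"
  shows "(\<Sum>\<beta>\<in>mindices d k. \<Sum>i<d. c (\<beta>(i := Suc (\<beta> i))) / mfact d \<beta>)
    = real (Suc k) * (\<Sum>\<gamma>\<in>mindices d (Suc k). c \<gamma> / mfact d \<gamma>)"
proof -
  have "(\<Sum>\<beta>\<in>mindices d k. c (\<beta>(i := Suc (\<beta> i))) / mfact d \<beta>)
      = (\<Sum>\<gamma>\<in>mindices d (Suc k). c \<gamma> * real (\<gamma> i) / mfact d \<gamma>)" if i: "i < d" for i
  proof -
    have "(\<Sum>\<beta>\<in>mindices d k. c (\<beta>(i := Suc (\<beta> i))) / mfact d \<beta>)
      = (\<Sum>\<gamma>\<in>{\<gamma>\<in>mindices d (Suc k). \<gamma> i > 0}. c \<gamma> * real (\<gamma> i) / mfact d \<gamma>)"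
    proof (rule sum.reindex_bij_witness[where i = "\<lambda>\<gamma>. \<gamma>(i := \<gamma> i - 1)" and j = "\<lambda>\<beta>. \<beta>(i := Suc (\<beta> i))"])
      fix \<beta> assume "\<beta> \<in> mindices d k"
      show "c (\<beta>(i := Suc (\<beta> i))) * real ((\<beta>(i := Suc (\<beta> i))) i) / mfact d (\<beta>(i := Suc (\<beta> i))) = c (\<beta>(i := Suc (\<beta> i))) / mfact d \<beta>"
        by (simp add: mfact_inc i)
    qed (use i mindices_dec[of _ d k i] in \<open>auto intro: mindices_inc\<close>)
    \<comment> \<open>Indices with \<open>\<gamma> i = 0\<close> cannot be lowered, but their
      summand vanishes.\<close>
    also have "\<dots> = (\<Sum>\<gamma>\<in>mindices d (Suc k). c \<gamma> * real (\<gamma> i) / mfact d \<gamma>)"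
      by (rule sum.mono_neutral_left) auto
    finally show ?thesis .
  qed
  then have "(\<Sum>i<d. \<Sum>\<beta>\<in>mindices d k. c (\<beta>(i := Suc (\<beta> i))) / mfact d \<beta>)
     = (\<Sum>i<d. \<Sum>\<gamma>\<in>mindices d (Suc k). c \<gamma> * real (\<gamma> i) / mfact d \<gamma>)"
    by simp
  also have "\<dots> = (\<Sum>\<gamma>\<in>mindices d (Suc k). \<Sum>i<d. c \<gamma> * real (\<gamma> i) / mfact d \<gamma>)"
    by (rule sum.swap)
  also have "\<dots> = (\<Sum>\<gamma>\<in>mindices d (Suc k). real (Suc k) * (c \<gamma> / mfact d \<gamma>))"
  proof (rule sum.cong)
    fix \<gamma> assume "\<gamma> \<in> mindices d (Suc k)"
    then have "(\<Sum>i<d. real (\<gamma> i)) = real (Suc k)" unfolding mindices_def by (simp flip: of_nat_sum)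
    then show "(\<Sum>i<d. c \<gamma> * real (\<gamma> i) / mfact d \<gamma>) = real (Suc k) * (c \<gamma> / mfact d \<gamma>)"
      by (simp add: mult.commute flip: sum_distrib_left sum_divide_distrib)
  qed simp
  finally show ?thesis by (subst sum.swap) (simp add: sum_distrib_left)
qed

subsection \<open>Derivatives along lines\<close>

text \<open>The k-th derivative of f at x along v, that is (v . grad)^k f, expanded by the
  multinomial theorem.\<close>

definition tform :: "nat \<Rightarrow> ((nat \<Rightarrow> real) \<Rightarrow> real) \<Rightarrow> nat \<Rightarrow> (nat \<Rightarrow> real) \<Rightarrow> (nat \<Rightarrow> real) \<Rightarrow> real" where
  "tform d f k x v = fact k * (\<Sum>\<beta>\<in>mindices d k. Dmulti d \<beta> f x * mpow d v \<beta> / mfact d \<beta>)"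

lemma Dmulti_0: "Dmulti d (\<lambda>_. 0) f = f"
proof -
  have "concat (map (\<lambda>i. replicate 0 i) [0..<d]) = ([] :: nat list)" by auto
  then show ?thesis unfolding Dmulti_def by (simp only: pd_list.simps)
qed

lemma tform_0: "tform d f 0 x v = f x"
  by (simp add: tform_def mindices_0 Dmulti_0 mpow_def mfact_def)

lemma tform_scale:
  assumes "\<And>i. i < d \<Longrightarrow> w i = c * v i"
  shows "tform d f k x w = c ^ k * tform d f k x v"
  unfolding tform_def by (simp add: sum_distrib_left mpow_scale[OF _ assms] mult_ac)

lemma tform_cong: "(\<And>i. i < d \<Longrightarrow> w i = v i) \<Longrightarrow> tform d f k x w = tform d f k x v"
  using tform_scale[of d w 1 v f k x] by simp

lemma count_index_list:
  "count (mset (concat (map (\<lambda>i. replicate (\<beta> i) i) [0..<n]))) j = (if j < n then \<beta> j else 0)"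
  by (induction n) auto

locale smooth_fun =
  fixes d :: nat and U K :: "(nat \<Rightarrow> real) set" and f :: "(nat \<Rightarrow> real) \<Rightarrow> real"
  assumes U: "boxopen d U" and UK: "U \<subseteq> K" and smooth: "smooth_on d U K f"
begin

lemma URd: "U \<subseteq> Rd d" using U by (simp add: boxopen_def)

lemma pdiff: "set is \<subseteq> {..<d} \<Longrightarrow> pdiff_on d U (pd_list is f)"
  using smooth unfolding smooth_on_def pdiff_on_def by blast

lemma cont:
  assumes "set is \<subseteq> {..<d}" shows "continuous_on U (pd_list is f)"
proof -
  obtain g where "continuous_on K g" "\<And>x. x \<in> U \<Longrightarrow> g x = pd_list is f x"
    using smooth assms unfolding smooth_on_def by blast
  then show ?thesis using continuous_on_subset[OF _ UK, of g] continuous_on_cong[of U U g] by metis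
qed

lemma pd_swap:
  assumes "set is \<subseteq> {..<d}" "i < d" "j < d" "x \<in> U"
  shows "pd_list (i # j # is) f x = pd_list (j # i # is) f x"
  using partial_commute[OF U assms(4,2,3), of "pd_list is f"]
    pdiff[of "is"] pdiff[of "i # is"] pdiff[of "j # is"] cont[of "i # j # is"] cont[of "j # i # is"] assms
  by simp

text \<open>The entry i passes one predecessor after another by \<open>pd_swap\<close>. The equality
  under an outer derivative holds only on U, so the step goes through \<open>partial_cong\<close>,
  which uses that U is open.\<close>

lemma pd_front:
  "set is \<subseteq> {..<d} \<Longrightarrow> i \<in> set is \<Longrightarrow> x \<in> U \<Longrightarrow> pd_list is f x = pd_list (i # remove1 i is) f x"
proof (induction "is" arbitrary: x)
  case (Cons j js)
  show ?case
  proof (cases "i = j")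
    case False
    then have i: "i \<in> set js" "i < d" "j < d" "set js \<subseteq> {..<d}" using Cons.prems by auto
    have "pd_list (j # js) f x = partial j (pd_list (i # remove1 i js) f) x"
      using Cons.IH i Cons.prems by (auto intro!: partial_cong[OF U])
    also have "\<dots> = pd_list (j # i # remove1 i js) f x" by simp
    also have "\<dots> = pd_list (i # j # remove1 i js) f x"
      using i Cons.prems set_remove1_subset[of i js] by (intro pd_swap) auto
    finally show ?thesis using False by simp
  qed auto
qed simp

text \<open>\<open>Dmulti\<close> lists its variables in increasing order; one further derivative
  spoils this order, and permutation invariance restores it.\<close>

lemma pd_perm:
  "mset is = mset js \<Longrightarrow> set is \<subseteq> {..<d} \<Longrightarrow> x \<in> U \<Longrightarrow> pd_list is f x = pd_list js f x"
proof (induction "is" arbitrary: js x)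
  case (Cons i "is")
  have i: "i \<in> set js" using Cons.prems(1) by (metis list.set_intros(1) set_mset_mset)
  have eq: "mset is = mset (remove1 i js)" using Cons.prems(1) by (metis mset_remove1 add_mset_remove_trivial mset.simps(2))
  have js: "set js \<subseteq> {..<d}" using Cons.prems(1,2) by (metis set_mset_mset)
  have "pd_list (i # is) f x = partial i (pd_list (remove1 i js) f) x"
    using Cons.IH[OF eq] Cons.prems by (auto intro!: partial_cong[OF U])
  then show ?case using pd_front[OF js i Cons.prems(3)] by simp
qed simp

lemma set_index_list: "set (concat (map (\<lambda>i. replicate (\<beta> i) i) [0..<d])) \<subseteq> {..<d}"
  by auto

lemma partial_Dmulti:
  assumes "i < d" "x \<in> U"
  shows "partial i (Dmulti d \<beta> f) x = Dmulti d (\<beta>(i := Suc (\<beta> i))) f x"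
proof -
  have "pd_list (i # concat (map (\<lambda>i. replicate (\<beta> i) i) [0..<d])) f x
      = pd_list (concat (map (\<lambda>j. replicate ((\<beta>(i := Suc (\<beta> i))) j) j) [0..<d])) f x"
  proof (rule pd_perm)
    show "mset (i # concat (map (\<lambda>i. replicate (\<beta> i) i) [0..<d]))
        = mset (concat (map (\<lambda>j. replicate ((\<beta>(i := Suc (\<beta> i))) j) j) [0..<d]))"
      using assms by (intro multiset_eqI) (simp only: mset.simps count_add_mset count_index_list, simp)
  qed (use assms set_index_list in auto)
  then show ?thesis by (simp add: Dmulti_def)
qed

lemma pdiff_Dmulti: "pdiff_on d U (Dmulti d \<beta> f)"
  unfolding Dmulti_def by (rule pdiff[OF set_index_list])

lemma cont_Dmulti: "continuous_on U (Dmulti d \<beta> f)"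
  unfolding Dmulti_def by (rule cont[OF set_index_list])

lemma cont_partial_Dmulti: "i < d \<Longrightarrow> continuous_on U (partial i (Dmulti d \<beta> f))"
  using cont_Dmulti[of "\<beta>(i := Suc (\<beta> i))"]
  by (subst continuous_on_cong[OF refl partial_Dmulti[of i]]) auto

text \<open>By the chain rule each term D^\<beta> f v^\<beta> yields the terms with \<beta> raised
  in one entry, and \<open>sum_mindices_Suc\<close> collects these into the form of order k +
  1.\<close>

lemma DERIV_tform:
  assumes L: "line d x v s \<in> U"
  shows "((\<lambda>s. tform d f k (line d x v s) v) has_real_derivative tform d f (Suc k) (line d x v s) v) (at s)"
proof -
  let ?y = "line d x v s"
  have "((\<lambda>s. tform d f k (line d x v s) v) has_real_derivative
     fact k * (\<Sum>\<beta>\<in>mindices d k. (\<Sum>i<d. partial i (Dmulti d \<beta> f) ?y * v i) * mpow d v \<beta> / mfact d \<beta>)) (at s)"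
    unfolding tform_def
    by (intro DERIV_cmult DERIV_sum DERIV_cdivide DERIV_cmult_right chain_rule_line[OF U pdiff_Dmulti L] cont_partial_Dmulti)
  also have "(\<Sum>\<beta>\<in>mindices d k. (\<Sum>i<d. partial i (Dmulti d \<beta> f) ?y * v i) * mpow d v \<beta> / mfact d \<beta>)
     = (\<Sum>\<beta>\<in>mindices d k. \<Sum>i<d. (\<lambda>\<gamma>. Dmulti d \<gamma> f ?y * mpow d v \<gamma>) (\<beta>(i := Suc (\<beta> i))) / mfact d \<beta>)"
    using L by (intro sum.cong refl) (simp add: partial_Dmulti mpow_inc sum_distrib_right sum_divide_distrib, intro sum.cong refl, simp add: mult_ac)
  also have "\<dots> = real (Suc k) * (\<Sum>\<gamma>\<in>mindices d (Suc k). Dmulti d \<gamma> f ?y * mpow d v \<gamma> / mfact d \<gamma>)"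
    by (rule sum_mindices_Suc)
  finally show ?thesis by (simp add: tform_def algebra_simps)
qed

lemma line_nhds:
  assumes L: "line d x v s \<in> U"
  shows "\<forall>\<^sub>F t in nhds s. line d x v t \<in> U"
proof -
  obtain e where e: "e > 0" "\<And>y. y \<in> Rd d \<Longrightarrow> (\<And>i. i < d \<Longrightarrow> \<bar>y i - line d x v s i\<bar> < e) \<Longrightarrow> y \<in> U"
    using boxopenD[OF U L] by blast
  define V where "V = 1 + (\<Sum>i<d. \<bar>v i\<bar>)"
  have V: "V > 0" "\<And>i. i < d \<Longrightarrow> \<bar>v i\<bar> \<le> V"
  proof -
    have "(\<Sum>i<d. \<bar>v i\<bar>) \<ge> 0" by (rule sum_nonneg) auto
    then show "V > 0" unfolding V_def by linarith
    fix i assume "i < d"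
    then have "\<bar>v i\<bar> \<le> (\<Sum>i<d. \<bar>v i\<bar>)" by (intro member_le_sum) auto
    then show "\<bar>v i\<bar> \<le> V" by (simp add: V_def)
  qed
  have "line d x v t \<in> U" if t: "\<bar>t - s\<bar> < e / V" for t
  proof (rule e(2))
    fix i assume i: "i < d"
    have "\<bar>line d x v t i - line d x v s i\<bar> = \<bar>t - s\<bar> * \<bar>v i\<bar>"
      using i by (simp add: flip: abs_mult) (simp add: algebra_simps)
    also have "\<dots> \<le> \<bar>t - s\<bar> * V" using V(2)[OF i] by (simp add: mult_left_mono)
    also have "\<dots> < e" using t V(1) by (simp add: field_simps)
    finally show "\<bar>line d x v t i - line d x v s i\<bar> < e" .
  qed simp
  then show ?thesis
    unfolding eventually_nhds_metric using e(1) V(1)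
    by (intro exI[of _ "e / V"]) (auto simp: dist_real_def)
qed

text \<open>\<open>deriv\<close> depends only on the values near s, so the induction hypothesis is
  used at all parameters near s, where the line stays in U.\<close>

lemma iterated_deriv_line:
  "line d x v s \<in> U \<Longrightarrow> (deriv ^^ k) (\<lambda>s. f (line d x v s)) s = tform d f k (line d x v s) v"
proof (induction k arbitrary: s)
  case 0
  then show ?case by (simp add: tform_0)
next
  case (Suc k)
  have "\<forall>\<^sub>F t in nhds s. (deriv ^^ k) (\<lambda>s. f (line d x v s)) t = tform d f k (line d x v t) v"
    using line_nhds[OF Suc.prems] by eventually_elim (rule Suc.IH)
  then have "deriv ((deriv ^^ k) (\<lambda>s. f (line d x v s))) s = deriv (\<lambda>t. tform d f k (line d x v t) v) s"
    by (rule deriv_cong_ev) simp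
  then show ?case using DERIV_imp_deriv[OF DERIV_tform[OF Suc.prems]] by simp
qed

lemma ndiff_eq:
  assumes "x \<in> U"
  shows "ndiff d k f x = tform d f k x (\<lambda>i. x i / norm2 d x)"
proof -
  have x: "x \<in> Rd d" using assms URd by auto
  have "ndiff d k f x = (deriv ^^ k) (\<lambda>s. f (line d x (\<lambda>i. x i / norm2 d x) s)) 0"
    unfolding ndiff_def line_def by simp
  also have "\<dots> = tform d f k (line d x (\<lambda>i. x i / norm2 d x) 0) (\<lambda>i. x i / norm2 d x)"
    by (rule iterated_deriv_line) (simp add: line_0 x assms)
  finally show ?thesis by (simp add: line_0 x)
qed

lemma taylor_lagrange:
  assumes "h > 0" "k > 0" and L: "\<And>t. 0 \<le> t \<Longrightarrow> t \<le> h \<Longrightarrow> line d x v t \<in> U"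
  obtains t where "0 < t" "t < h"
    "f (line d x v h) = (\<Sum>m<k. tform d f m (line d x v 0) v / fact m * h ^ m) + tform d f k (line d x v t) v / fact k * h ^ k"
proof -
  have "\<exists>t>0. t < h \<and> f (line d x v h) = (\<Sum>m<k. tform d f m (line d x v 0) v / fact m * h ^ m) + tform d f k (line d x v t) v / fact k * h ^ k"
    using assms by (intro Maclaurin[where f = "\<lambda>s. f (line d x v s)" and diff = "\<lambda>m s. tform d f m (line d x v s) v"])
      (auto simp: tform_0 intro!: DERIV_tform)
  then show ?thesis using that by blast
qed

end

subsection \<open>The Euclidean norm\<close>

lemma norm2_L2: "norm2 d x = L2_set x {..<d}"
  by (simp add: norm2_def L2_set_def)

lemma norm2_nonneg [simp]: "norm2 d x \<ge> 0"
  by (simp add: norm2_L2)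

lemma abs_le_norm2: "i < d \<Longrightarrow> \<bar>x i\<bar> \<le> norm2 d x"
  unfolding norm2_def by (rule real_le_rsqrt) (auto intro: member_le_sum)

lemma norm2_triangle: "norm2 d (\<lambda>i. x i + y i) \<le> norm2 d x + norm2 d y"
  unfolding norm2_L2 by (rule L2_set_triangle_ineq)

lemma norm2_scale:
  assumes "\<And>i. i < d \<Longrightarrow> y i = c * x i"
  shows "norm2 d y = \<bar>c\<bar> * norm2 d x"
proof -
  have "(\<Sum>i<d. (y i)\<^sup>2) = c\<^sup>2 * (\<Sum>i<d. (x i)\<^sup>2)"
    by (simp add: sum_distrib_left assms power_mult_distrib)
  then show ?thesis by (simp add: norm2_def real_sqrt_mult)
qed

lemma norm2_cong: "(\<And>i. i < d \<Longrightarrow> x i = y i) \<Longrightarrow> norm2 d x = norm2 d y"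
  using norm2_scale[of d x 1 y] by simp

abbreviation ray :: "nat \<Rightarrow> (nat \<Rightarrow> real) \<Rightarrow> real \<Rightarrow> nat \<Rightarrow> real" where
  "ray d \<equiv> line d (zerod d)"

lemma zerod_nth [simp]: "i < d \<Longrightarrow> zerod d i = 0"
  by (simp add: zerod_def)

lemma norm2_ray: "norm2 d (ray d x s) = \<bar>s\<bar> * norm2 d x"
  by (rule norm2_scale) simp

subsection \<open>Interpolation points\<close>

text \<open>Newton interpolation in an abstract function space: functions are added one by one, and
  each is either already reproduced on X or provides a new node. Linear dependence just makes P
  smaller. The weights are only known to lie in the linear space S, which will express polynomial
  growth.\<close>

lemma interpolation_points:
  fixes \<phi> :: "'b \<Rightarrow> 'p \<Rightarrow> real" and S :: "('p \<Rightarrow> real) set"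
  assumes S0: "(\<lambda>_. 0) \<in> S" and S_add: "\<And>u v. u \<in> S \<Longrightarrow> v \<in> S \<Longrightarrow> (\<lambda>y. u y + v y) \<in> S"
    and S_scale: "\<And>u c. u \<in> S \<Longrightarrow> (\<lambda>y. c * u y) \<in> S"
    and "finite B" and "\<And>b. b \<in> B \<Longrightarrow> \<phi> b \<in> S"
  shows "\<exists>P w. finite P \<and> P \<subseteq> X \<and> card P \<le> card B \<and> (\<forall>p\<in>P. w p \<in> S) \<and>
    (\<forall>b\<in>B. \<forall>y\<in>X. \<phi> b y = (\<Sum>p\<in>P. w p y * \<phi> b p))"
proof -
  have S_sum: "(\<lambda>y. \<Sum>p\<in>P. u p y) \<in> S" if "finite P" "\<And>p. p \<in> P \<Longrightarrow> u p \<in> S" for P :: "'p set" and u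
    using that by (induction P) (auto simp: S0 intro!: S_add)
  \<comment> \<open>The induction needs the weights to be a Lagrange basis at the nodes, so the
    claim is strengthened by the Kronecker property.\<close>
  have "\<exists>P w. finite P \<and> P \<subseteq> X \<and> card P \<le> card B \<and> (\<forall>p\<in>P. w p \<in> S) \<and>
    (\<forall>p\<in>P. \<forall>q\<in>P. w p q = (if p = q then 1 else 0)) \<and>
    (\<forall>b\<in>B. \<forall>y\<in>X. \<phi> b y = (\<Sum>p\<in>P. w p y * \<phi> b p))"
    using assms(4,5)
  proof (induction B)
    case empty
    then show ?case by (intro exI[of _ "{}"]) auto
  next
    case (insert a B)
    then obtain P w where P: "finite P" "P \<subseteq> X" "card P \<le> card B" "\<forall>p\<in>P. w p \<in> S"
      "\<forall>p\<in>P. \<forall>q\<in>P. w p q = (if p = q then 1 else 0)"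
      "\<forall>b\<in>B. \<forall>y\<in>X. \<phi> b y = (\<Sum>p\<in>P. w p y * \<phi> b p)" by auto
    \<comment> \<open>The residual of the new function. It vanishes at the old nodes, so a point
      where it does not vanish is a new node, and \<psi> normalised there is the weight of this
      node.\<close>
    define \<psi> where "\<psi> y = \<phi> a y - (\<Sum>p\<in>P. w p y * \<phi> a p)" for y
    show ?case
    proof (cases "\<forall>y\<in>X. \<psi> y = 0")
      case True
      then have "\<forall>b\<in>insert a B. \<forall>y\<in>X. \<phi> b y = (\<Sum>p\<in>P. w p y * \<phi> b p)"
        using P(6) by (auto simp: \<psi>_def)
      then show ?thesis using P(1-5) insert.hyps by (intro exI[of _ P] exI[of _ w]) auto
    next
      case False
      then obtain q where q: "q \<in> X" "\<psi> q \<noteq> 0" by auto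
      have \<psi>P: "\<psi> p = 0" if "p \<in> P" for p
      proof -
        have "(\<Sum>p'\<in>P. w p' p * \<phi> a p') = (\<Sum>p'\<in>P. if p' = p then \<phi> a p' else 0)"
          using P(5) that by (intro sum.cong) auto
        then show ?thesis using that P(1) by (simp add: \<psi>_def)
      qed
      have qP: "q \<notin> P" using \<psi>P q by auto
      have "(\<lambda>y. \<phi> a y + (-1) * (\<Sum>p\<in>P. \<phi> a p * w p y)) \<in> S"
        using P(4) insert.prems by (intro S_add S_scale S_sum P(1)) auto
      then have \<psi>S: "\<psi> \<in> S" by (simp add: \<psi>_def[abs_def] mult.commute)
      \<comment> \<open>Multiples of \<psi> can be added to the old weights without disturbing the
        old nodes; this choice makes them vanish at q.\<close>
      define w' where "w' p = (if p = q then (\<lambda>y. (1 / \<psi> q) * \<psi> y) else (\<lambda>y. w p y + (- w p q / \<psi> q) * \<psi> y))" for p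
      have wS: "\<forall>p\<in>insert q P. w' p \<in> S"
      proof
        fix p assume p: "p \<in> insert q P"
        show "w' p \<in> S"
        proof (cases "p = q")
          case True
          then show ?thesis unfolding w'_def using S_scale[OF \<psi>S, of "1 / \<psi> q"] by simp
        next
          case False
          then have "w p \<in> S" using p P(4) by auto
          from S_add[OF this S_scale[OF \<psi>S, of "- w p q / \<psi> q"]] show ?thesis
            unfolding w'_def using False by simp
        qed
      qed
      have dl: "\<forall>p\<in>insert q P. \<forall>p'\<in>insert q P. w' p p' = (if p = p' then 1 else 0)"
        using P(5) \<psi>P q qP by (auto simp: w'_def)
      have rep: "\<phi> b y = (\<Sum>p\<in>insert q P. w' p y * \<phi> b p)" if b: "b \<in> insert a B" and y: "y \<in> X" for b y
      proof -
        have "(\<Sum>p\<in>insert q P. w' p y * \<phi> b p) = \<psi> y / \<psi> q * \<phi> b q + (\<Sum>p\<in>P. (w p y + (- w p q / \<psi> q) * \<psi> y) * \<phi> b p)"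
          using P(1) qP by (simp add: w'_def) (intro sum.cong, auto)
        also have "(\<Sum>p\<in>P. (w p y + (- w p q / \<psi> q) * \<psi> y) * \<phi> b p)
            = (\<Sum>p\<in>P. w p y * \<phi> b p) - \<psi> y / \<psi> q * (\<Sum>p\<in>P. w p q * \<phi> b p)"
          by (simp add: sum_distrib_left algebra_simps sum.distrib sum_subtractf sum_negf)
        finally have eq: "(\<Sum>p\<in>insert q P. w' p y * \<phi> b p) =
          (\<Sum>p\<in>P. w p y * \<phi> b p) + \<psi> y / \<psi> q * (\<phi> b q - (\<Sum>p\<in>P. w p q * \<phi> b p))"
          by (simp add: algebra_simps)
        show ?thesis
        proof (cases "b = a")
          case True
          then show ?thesis unfolding eq using q by (simp add: \<psi>_def)
        next
          case False
          then have "b \<in> B" using b by simp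
          then have "\<phi> b q = (\<Sum>p\<in>P. w p q * \<phi> b p)" "\<phi> b y = (\<Sum>p\<in>P. w p y * \<phi> b p)"
            using P(6) q(1) y by auto
          then show ?thesis unfolding eq by simp
        qed
      qed
      show ?thesis
      proof (intro exI[of _ "insert q P"] exI[of _ w'] conjI)
        show "card (insert q P) \<le> card (insert a B)" using P(1,3) qP insert.hyps by simp
      qed (use P(1,2) q(1) wS dl rep in blast)+
    qed
  qed
  then show ?thesis by blast
qed

definition mpoly :: "nat \<Rightarrow> nat \<Rightarrow> ((nat \<Rightarrow> nat) \<Rightarrow> real) \<Rightarrow> (nat \<Rightarrow> real) \<Rightarrow> real" where
  "mpoly d k c x = (\<Sum>j<k. \<Sum>\<beta>\<in>mindices d j. c \<beta> * mpow d x \<beta>)"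

lemma mpoly_diff: "mpoly d k (\<lambda>\<beta>. c1 \<beta> - c2 \<beta>) x = mpoly d k c1 x - mpoly d k c2 x"
  by (simp add: mpoly_def left_diff_distrib sum_subtractf)

text \<open>The nodes p are shrunk to h p. Reproducing the value at x then uses the weights at y = x
  / h, which grow like the power k - 1 of the norm and are thus of order h^(1 - k), against data of
  order h^k. The product is of order h, uniformly in the coefficients c.\<close>

lemma sampling_stability:
  assumes k: "k > 0" and \<delta>: "\<delta> > 0" and \<eta>: "\<eta> > 0" and \<rho>: "\<rho> \<ge> 0" and C: "C \<ge> 0"
  obtains Q where "finite Q" "Q \<subseteq> cballd d \<delta>" "card Q \<le> (d + 1) ^ (k - 1)"
    "\<And>c x. (\<And>q. q \<in> Q \<Longrightarrow> \<bar>mpoly d k c q\<bar> \<le> C * norm2 d q ^ k) \<Longrightarrow> x \<in> cballd d \<rho> \<Longrightarrow> \<bar>mpoly d k c x\<bar> \<le> \<eta>"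
proof -
  define M where "M = (\<Union>j\<le>k - 1. mindices d j)"
  define S where "S = {u :: (nat \<Rightarrow> real) \<Rightarrow> real. \<exists>A. \<forall>y. \<bar>u y\<bar> \<le> A * (1 + norm2 d y) ^ (k - 1)}"
  have "\<exists>P w. finite P \<and> P \<subseteq> Rd d \<and> card P \<le> card M \<and> (\<forall>p\<in>P. w p \<in> S) \<and>
    (\<forall>b\<in>M. \<forall>y\<in>Rd d. (\<lambda>b y. mpow d y b) b y = (\<Sum>p\<in>P. w p y * (\<lambda>b y. mpow d y b) b p))"
  proof (rule interpolation_points)
    show "(\<lambda>_. 0) \<in> S" unfolding S_def by (auto intro: exI[of _ 0])
    fix u v assume "u \<in> S" "v \<in> S"
    then obtain A B where "\<forall>y. \<bar>u y\<bar> \<le> A * (1 + norm2 d y) ^ (k - 1)" "\<forall>y. \<bar>v y\<bar> \<le> B * (1 + norm2 d y) ^ (k - 1)"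
      by (auto simp: S_def)
    then have "\<bar>u y + v y\<bar> \<le> (A + B) * (1 + norm2 d y) ^ (k - 1)" for y
      unfolding distrib_right by (meson abs_triangle_ineq add_mono order_trans)
    then show "(\<lambda>y. u y + v y) \<in> S" by (auto simp: S_def)
  next
    fix u c assume "u \<in> S"
    then obtain A where A: "\<forall>y. \<bar>u y\<bar> \<le> A * (1 + norm2 d y) ^ (k - 1)"
      by (auto simp: S_def)
    have "\<bar>c * u y\<bar> \<le> (\<bar>c\<bar> * A) * (1 + norm2 d y) ^ (k - 1)" for y
      using mult_left_mono[OF A[rule_format, of y] abs_ge_zero[of c]] by (simp add: abs_mult mult.assoc)
    then show "(\<lambda>y. c * u y) \<in> S" unfolding S_def by blast
  next
    show "finite M" by (simp add: M_def)
    fix b assume "b \<in> M"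
    then obtain j where j: "j \<le> k - 1" "b \<in> mindices d j" by (auto simp: M_def)
    have "\<bar>mpow d y b\<bar> \<le> 1 * (1 + norm2 d y) ^ (k - 1)" for y
    proof -
      have "\<bar>mpow d y b\<bar> \<le> (1 + norm2 d y) ^ j"
      proof (rule abs_mpow_le[OF j(2)])
        fix i assume "i < d"
        then show "\<bar>y i\<bar> \<le> 1 + norm2 d y" using abs_le_norm2[of i d y] by linarith
      qed
      also have "\<dots> \<le> (1 + norm2 d y) ^ (k - 1)" by (rule power_increasing[OF j(1)]) simp
      finally show ?thesis by simp
    qed
    then show "(\<lambda>y. mpow d y b) \<in> S" unfolding S_def by blast
  qed
  then obtain P w where P: "finite P" "P \<subseteq> Rd d" "card P \<le> card M" "\<forall>p\<in>P. w p \<in> S"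
    "\<forall>b\<in>M. \<forall>y\<in>Rd d. mpow d y b = (\<Sum>p\<in>P. w p y * mpow d p b)" by auto
  have "\<forall>p\<in>P. \<exists>A. \<forall>y. \<bar>w p y\<bar> \<le> A * (1 + norm2 d y) ^ (k - 1)" using P(4) by (auto simp: S_def)
  then obtain A where A: "\<And>p y. p \<in> P \<Longrightarrow> \<bar>w p y\<bar> \<le> A p * (1 + norm2 d y) ^ (k - 1)" by metis
  define L where "L = 1 + (\<Sum>p\<in>P. norm2 d p)"
  have L: "L \<ge> 1" "\<And>p. p \<in> P \<Longrightarrow> norm2 d p \<le> L"
  proof -
    show "L \<ge> 1" by (simp add: L_def sum_nonneg)
    fix p assume "p \<in> P"
    then have "norm2 d p \<le> (\<Sum>p\<in>P. norm2 d p)" using P(1) by (intro member_le_sum) auto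
    then show "norm2 d p \<le> L" by (simp add: L_def)
  qed
  \<comment> \<open>The final error will be at most \<open>h * W\<close>; the factors come from the
    growth of the weights, the radius \<rho>, and the data bound at the shrunk nodes.\<close>
  define W where "W = (\<Sum>p\<in>P. \<bar>A p\<bar>) * ((1 + \<rho>) ^ (k - 1) * (C * L ^ k))"
  have W: "W \<ge> 0" unfolding W_def using \<rho> C L(1) by (intro mult_nonneg_nonneg sum_nonneg) auto
  \<comment> \<open>At most 1 for the growth estimate, at most \<delta> / L to keep the nodes in the
    small ball, and the last entry for the error; the summand 1 avoids a division by zero.\<close>
  define h where "h = min (min 1 (\<delta> / L)) (\<eta> / (W + 1))"
  have h: "h > 0" "h \<le> 1" "h * L \<le> \<delta>" "h * W \<le> \<eta>"
  proof -
    show "h > 0" "h \<le> 1" using \<delta> \<eta> L(1) W by (auto simp: h_def)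
    have "h \<le> \<delta> / L" by (simp add: h_def)
    then show "h * L \<le> \<delta>" using L(1) by (simp add: pos_le_divide_eq)
    have "h \<le> \<eta> / (W + 1)" by (simp add: h_def)
    then have "h * (W + 1) \<le> \<eta>" using W by (simp add: pos_le_divide_eq)
    moreover have "h * W \<le> h * (W + 1)" using \<open>h > 0\<close> by simp
    ultimately show "h * W \<le> \<eta>" by linarith
  qed
  define Q where "Q = (\<lambda>p. ray d p h) ` P"
  show ?thesis
  proof
    show "finite Q" by (simp add: Q_def P)
    show "Q \<subseteq> cballd d \<delta>"
    proof -
      have "h * norm2 d p \<le> \<delta>" if "p \<in> P" for p
      proof -
        have "h * norm2 d p \<le> h * L" using L(2)[OF that] h(1) by simp
        then show ?thesis using h(3) by simp
      qed
      then show ?thesis using h(1) by (auto simp: Q_def cballd_def norm2_ray)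
    qed
    have "card Q \<le> card P" unfolding Q_def by (rule card_image_le[OF P(1)])
    also have "\<dots> \<le> (d + 1) ^ (k - 1)" using P(3) card_mindices_less[of d "k - 1"] by (simp add: M_def)
    finally show "card Q \<le> (d + 1) ^ (k - 1)" .
    fix c x assume q: "\<And>q. q \<in> Q \<Longrightarrow> \<bar>mpoly d k c q\<bar> \<le> C * norm2 d q ^ k" and x: "x \<in> cballd d \<rho>"
    have xR: "x \<in> Rd d" and xn: "norm2 d x \<le> \<rho>" using x by (auto simp: cballd_def)
    \<comment> \<open>The part of degree j scales by h^j, both from y to x and from p to h p, so the
      interpolation identity at y becomes one at x with the nodes h p.\<close>
    define y where "y = ray d x (1 / h)"
    have "mpoly d k c x = (\<Sum>j<k. \<Sum>\<beta>\<in>mindices d j. c \<beta> * (h ^ j * (\<Sum>p\<in>P. w p y * mpow d p \<beta>)))"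
    proof -
      have "mpow d x \<beta> = h ^ j * (\<Sum>p\<in>P. w p y * mpow d p \<beta>)" if "j < k" "\<beta> \<in> mindices d j" for j \<beta>
      proof -
        have "mpow d x \<beta> = h ^ j * mpow d y \<beta>"
          by (rule mpow_scale[OF that(2)]) (use h(1) in \<open>simp add: y_def\<close>)
        moreover have "\<beta> \<in> M" using that by (auto simp: M_def)
        ultimately show ?thesis using P(5) by (simp add: y_def)
      qed
      then show ?thesis unfolding mpoly_def by simp
    qed
    also have "\<dots> = (\<Sum>p\<in>P. w p y * (\<Sum>j<k. \<Sum>\<beta>\<in>mindices d j. c \<beta> * (h ^ j * mpow d p \<beta>)))"
    proof -
      have "(\<Sum>j<k. \<Sum>\<beta>\<in>mindices d j. c \<beta> * (h ^ j * (\<Sum>p\<in>P. w p y * mpow d p \<beta>)))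
        = (\<Sum>j<k. \<Sum>\<beta>\<in>mindices d j. \<Sum>p\<in>P. w p y * (c \<beta> * (h ^ j * mpow d p \<beta>)))"
        by (simp add: sum_distrib_left mult_ac)
      also have "\<dots> = (\<Sum>j<k. \<Sum>p\<in>P. \<Sum>\<beta>\<in>mindices d j. w p y * (c \<beta> * (h ^ j * mpow d p \<beta>)))"
        by (intro sum.cong refl sum.swap)
      also have "\<dots> = (\<Sum>p\<in>P. \<Sum>j<k. \<Sum>\<beta>\<in>mindices d j. w p y * (c \<beta> * (h ^ j * mpow d p \<beta>)))"
        by (rule sum.swap)
      finally show ?thesis by (simp add: sum_distrib_left)
    qed
    also have "\<dots> = (\<Sum>p\<in>P. w p y * mpoly d k c (ray d p h))"
      unfolding mpoly_def
      by (intro sum.cong refl arg_cong2[where f = "(*)"]) (rule mpow_scale[symmetric], auto)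
    finally have rep: "mpoly d k c x = (\<Sum>p\<in>P. w p y * mpoly d k c (ray d p h))" .
    have "\<bar>w p y * mpoly d k c (ray d p h)\<bar> \<le> \<bar>A p\<bar> * (h * ((1 + \<rho>) ^ (k - 1) * (C * L ^ k)))" if p: "p \<in> P" for p
    proof -
      have ny: "norm2 d y = norm2 d x / h" unfolding y_def norm2_ray using h(1) by simp
      have "\<bar>w p y\<bar> \<le> \<bar>A p\<bar> * (1 + norm2 d y) ^ (k - 1)"
        using A[OF p, of y] mult_right_mono[OF abs_ge_self[of "A p"], of "(1 + norm2 d y) ^ (k - 1)"] by simp
      also have "\<dots> \<le> \<bar>A p\<bar> * ((1 + \<rho>) / h) ^ (k - 1)"
      proof (intro mult_left_mono power_mono)
        have "1 + norm2 d y = (h + norm2 d x) / h" unfolding ny using h(1) by (simp add: field_simps)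
        also have "\<dots> \<le> (1 + \<rho>) / h" using h xn by (intro divide_right_mono) auto
        finally show "1 + norm2 d y \<le> (1 + \<rho>) / h" .
      qed auto
      finally have 1: "\<bar>w p y\<bar> \<le> \<bar>A p\<bar> * ((1 + \<rho>) / h) ^ (k - 1)" .
      have "\<bar>mpoly d k c (ray d p h)\<bar> \<le> C * norm2 d (ray d p h) ^ k"
        by (rule q) (use p in \<open>auto simp: Q_def\<close>)
      also have "\<dots> \<le> C * (h * L) ^ k"
        using L(2)[OF p] h(1) C by (intro mult_left_mono power_mono) (auto simp: norm2_ray)
      finally have 2: "\<bar>mpoly d k c (ray d p h)\<bar> \<le> C * (h * L) ^ k" .
      have "\<bar>w p y * mpoly d k c (ray d p h)\<bar> \<le> (\<bar>A p\<bar> * ((1 + \<rho>) / h) ^ (k - 1)) * (C * (h * L) ^ k)"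
        unfolding abs_mult by (rule mult_mono[OF 1 2]) (use \<rho> h(1) in auto)
      also have "\<dots> = \<bar>A p\<bar> * (h * ((1 + \<rho>) ^ (k - 1) * (C * L ^ k)))"
      proof -
        have "h ^ k = h ^ (k - 1) * h" using k by (metis power_minus_mult)
        then show ?thesis using h(1) by (simp add: power_divide power_mult_distrib field_simps)
      qed
      finally show ?thesis .
    qed
    then have "\<bar>mpoly d k c x\<bar> \<le> (\<Sum>p\<in>P. \<bar>A p\<bar> * (h * ((1 + \<rho>) ^ (k - 1) * (C * L ^ k))))"
      unfolding rep by (intro order_trans[OF sum_abs] sum_mono)
    also have "\<dots> = h * W" by (simp add: W_def sum_distrib_right mult_ac sum_distrib_left)
    also have "\<dots> \<le> \<eta>" by (rule h(4))
    finally show "\<bar>mpoly d k c x\<bar> \<le> \<eta>" .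
  qed
qed

subsection \<open>Algorithms from sampling sets\<close>

lemma info_nonadaptive:
  assumes "n \<le> N" "\<And>ys. length ys < N \<Longrightarrow> \<psi> ys = q (length ys)"
  shows "info \<psi> f n = map (\<lambda>i. f (q i)) [0..<n]"
  using assms(1) by (induction n) (auto simp: Let_def assms(2))

text \<open>The data are answered by G of an arbitrary member of the class that produces them; there
  is one, since f itself does. The error then only compares two members that agree on Q.\<close>

lemma achieves_sampling:
  assumes Q: "finite Q" "Q \<subseteq> \<Omega>" and z: "z \<in> \<Omega>"
    and err: "\<And>f g. f \<in> F \<Longrightarrow> g \<in> F \<Longrightarrow> (\<And>q. q \<in> Q \<Longrightarrow> f q = g q) \<Longrightarrow> err f (G g) \<le> ennreal \<epsilon>"
  shows "achieves \<Omega> F err \<epsilon> (card Q)"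
proof -
  define N where "N = card Q"
  obtain q where q: "bij_betw q {0..<N} Q"
    unfolding N_def using ex_bij_betw_nat_finite[OF Q(1)] by auto
  \<comment> \<open>An algorithm must name a point of \<Omega> for every list of data, also for one
    that is too long; z is the default.\<close>
  define \<psi> where "\<psi> ys = (if length ys < N then q (length ys) else z)" for ys :: "real list"
  define \<phi> where "\<phi> ys = G (SOME g. g \<in> F \<and> info \<psi> g N = ys)" for ys
  have I: "info \<psi> f N = map (\<lambda>i. f (q i)) [0..<N]" for f
    by (rule info_nonadaptive[of N N]) (auto simp: \<psi>_def)
  have "err f (\<phi> (info \<psi> f N)) \<le> ennreal \<epsilon>" if f: "f \<in> F" for f
  proof -
    define g where "g = (SOME g. g \<in> F \<and> info \<psi> g N = info \<psi> f N)"
    have g: "g \<in> F \<and> info \<psi> g N = info \<psi> f N"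
      unfolding g_def by (rule someI[of _ f]) (simp add: f)
    have "f p = g p" if p: "p \<in> Q" for p
    proof -
      obtain i where "i < N" "p = q i" using q p by (auto simp: bij_betw_def)
      then show ?thesis using g by (auto simp: I)
    qed
    then have "err f (G g) \<le> ennreal \<epsilon>" using f g by (intro err) auto
    then show ?thesis by (simp add: \<phi>_def g_def)
  qed
  moreover have "\<psi> ys \<in> \<Omega>" for ys
    using q Q(2) z by (auto simp: \<psi>_def bij_betw_def)
  ultimately show ?thesis unfolding achieves_def N_def by blast
qed

lemma infc_le:
  assumes "achieves \<Omega> F err \<epsilon> n" "n \<le> N"
  shows "\<exists>m\<le>N. infc \<Omega> F err \<epsilon> = enat m"
proof -
  have "infc \<Omega> F err \<epsilon> \<le> enat n" unfolding infc_def using assms(1) by (intro INF_lower) auto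
  then obtain m where "infc \<Omega> F err \<epsilon> = enat m" "m \<le> n"
    using enat_ile by (metis enat_ord_simps(1))
  then show ?thesis using assms(2) by auto
qed

text \<open>Two members with the same samples have Taylor polynomials that differ by at most 2 C
  |q|^k at each sample q, and \<open>sampling_stability\<close> applies to the difference. G leaves
  room for a final adjustment: it is the identity for the uniform norm and a cut-off ensuring
  measurability for the L1 norm.\<close>

lemma infc_taylor:
  assumes k: "k > 0" and \<delta>: "\<delta> > 0" and \<Omega>: "cballd d \<delta> \<subseteq> \<Omega>" and \<rho>: "\<rho> \<ge> 0" and \<eta>: "\<eta> > 0" and C: "C \<ge> 0"
    and near: "\<And>f x. f \<in> F \<Longrightarrow> x \<in> cballd d \<delta> \<Longrightarrow> \<bar>f x - mpoly d k (c f) x\<bar> \<le> C * norm2 d x ^ k"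
    and err: "\<And>f g. f \<in> F \<Longrightarrow> g \<in> F \<Longrightarrow>
      (\<And>x. x \<in> cballd d \<rho> \<Longrightarrow> \<bar>mpoly d k (c f) x - mpoly d k (c g) x\<bar> \<le> \<eta>) \<Longrightarrow> err f (G g) \<le> ennreal \<epsilon>"
  shows "\<exists>m \<le> (d + 1) ^ (k - 1). infc \<Omega> F err \<epsilon> = enat m"
proof -
  have C2: "2 * C \<ge> 0" using C by simp
  obtain Q where Q: "finite Q" "Q \<subseteq> cballd d \<delta>" "card Q \<le> (d + 1) ^ (k - 1)"
    "\<And>c x. (\<And>q. q \<in> Q \<Longrightarrow> \<bar>mpoly d k c q\<bar> \<le> 2 * C * norm2 d q ^ k) \<Longrightarrow> x \<in> cballd d \<rho> \<Longrightarrow> \<bar>mpoly d k c x\<bar> \<le> \<eta>"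
    using sampling_stability[OF k \<delta> \<eta> \<rho> C2, of d thesis] by blast
  have "zerod d \<in> cballd d \<delta>" using \<delta> by (simp add: cballd_def norm2_def)
  then have z: "zerod d \<in> \<Omega>" using \<Omega> by auto
  have "achieves \<Omega> F err \<epsilon> (card Q)"
  proof (rule achieves_sampling[OF Q(1) _ z])
    show "Q \<subseteq> \<Omega>" using Q(2) \<Omega> by auto
    fix f g assume fg: "f \<in> F" "g \<in> F" "\<And>q. q \<in> Q \<Longrightarrow> f q = g q"
    show "err f (G g) \<le> ennreal \<epsilon>"
    proof (rule err[OF fg(1,2)])
      fix x assume x: "x \<in> cballd d \<rho>"
      have "\<bar>mpoly d k (\<lambda>\<beta>. c f \<beta> - c g \<beta>) q\<bar> \<le> 2 * C * norm2 d q ^ k" if q: "q \<in> Q" for q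
      proof -
        have "q \<in> cballd d \<delta>" using q Q(2) by auto
        from near[OF fg(1) this] near[OF fg(2) this] fg(3)[OF q] show ?thesis
          unfolding mpoly_diff by linarith
      qed
      from Q(4)[OF this x] show "\<bar>mpoly d k (c f) x - mpoly d k (c g) x\<bar> \<le> \<eta>" by (simp add: mpoly_diff)
    qed
  qed
  then show ?thesis using Q(3) by (rule infc_le)
qed

subsection \<open>Hausdorff outer measures\<close>

text \<open>The case distinction matters in dimension s = 0, where the power is 1 even for the empty
  set.\<close>

definition hterm :: "nat \<Rightarrow> nat \<Rightarrow> (nat \<Rightarrow> real) set \<Rightarrow> ennreal" where
  "hterm d s C = (if C = {} then 0 else ennreal (hconst s) * (ediam d C / 2) ^ s)"

lemma haus_delta_hterm: "haus_delta d s \<delta> A =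
     (INF C \<in> {C :: nat \<Rightarrow> (nat \<Rightarrow> real) set. A \<subseteq> (\<Union>n. C n) \<and> (\<forall>n. ediam d (C n) \<le> ennreal \<delta>)}.
        (\<Sum>n. hterm d s (C n)))"
  by (simp add: haus_delta_def hterm_def)

lemma ediam_empty [simp]: "ediam d {} = 0"
  by (simp add: ediam_def bot_ennreal)

lemma ediam_le_iff: "ediam d C \<le> b \<longleftrightarrow> (\<forall>x\<in>C. \<forall>y\<in>C. ennreal (norm2 d (\<lambda>i. x i - y i)) \<le> b)"
  by (auto simp: ediam_def SUP_le_iff)

lemma hterm_empty [simp]: "hterm d s {} = 0"
  by (simp add: hterm_def)

lemma haus_delta_le:
  assumes "A \<subseteq> (\<Union>n. C n)" "\<And>n. ediam d (C n) \<le> ennreal \<delta>"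
  shows "haus_delta d s \<delta> A \<le> (\<Sum>n. hterm d s (C n))"
  unfolding haus_delta_hterm using assms by (intro INF_lower) auto

lemma haus_delta_ge:
  assumes "\<And>C. A \<subseteq> (\<Union>n. C n) \<Longrightarrow> (\<And>n. ediam d (C n) \<le> ennreal \<delta>) \<Longrightarrow> x \<le> (\<Sum>n. hterm d s (C n))"
  shows "x \<le> haus_delta d s \<delta> A"
  unfolding haus_delta_hterm using assms by (intro INF_greatest) auto

lemma haus_delta_mono: "A \<subseteq> B \<Longrightarrow> haus_delta d s \<delta> A \<le> haus_delta d s \<delta> B"
  by (rule haus_delta_ge) (auto intro: haus_delta_le)

lemma haus_delta_antimono:
  assumes "\<delta> \<le> \<delta>'" shows "haus_delta d s \<delta>' A \<le> haus_delta d s \<delta> A"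
  by (rule haus_delta_ge, rule haus_delta_le) (auto intro: order_trans[OF _ ennreal_leI[OF assms]])

lemma haus_delta_empty [simp]: "haus_delta d s \<delta> {} = 0"
  using haus_delta_le[of "{}" "\<lambda>_. {}" d \<delta> s] by simp

text \<open>Nearly optimal covers of the single sets, with errors that sum to e, are merged into one
  sequence by the pairing function.\<close>

lemma haus_delta_subadditive:
  "haus_delta d s \<delta> (\<Union>i. A i) \<le> (\<Sum>i. haus_delta d s \<delta> (A i))"
proof (cases "(\<Sum>i. haus_delta d s \<delta> (A i)) = \<infinity>")
  case False
  have fin: "haus_delta d s \<delta> (A i) \<noteq> \<infinity>" for i
    using False ennreal_suminf_lessD[of "\<lambda>i. haus_delta d s \<delta> (A i)" \<infinity> i] by (simp add: less_top)
  show ?thesis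
  proof (rule ennreal_le_epsilon)
    fix e :: real assume e: "e > 0"
    have "\<forall>i. \<exists>C. A i \<subseteq> (\<Union>n. C n) \<and> (\<forall>n. ediam d (C n) \<le> ennreal \<delta>) \<and>
       (\<Sum>n. hterm d s (C n)) < haus_delta d s \<delta> (A i) + ennreal (e * (1/2) ^ Suc i)"
    proof
      fix i
      have "\<exists>C\<in>{C :: nat \<Rightarrow> (nat \<Rightarrow> real) set. A i \<subseteq> (\<Union>n. C n) \<and> (\<forall>n. ediam d (C n) \<le> ennreal \<delta>)}.
         (\<Sum>n. hterm d s (C n)) < haus_delta d s \<delta> (A i) + ennreal (e * (1/2) ^ Suc i)"
        by (rule INF_approx_ennreal[OF _ haus_delta_hterm fin]) (use e in simp)
      then show "\<exists>C. A i \<subseteq> (\<Union>n. C n) \<and> (\<forall>n. ediam d (C n) \<le> ennreal \<delta>) \<and>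
       (\<Sum>n. hterm d s (C n)) < haus_delta d s \<delta> (A i) + ennreal (e * (1/2) ^ Suc i)" by auto
    qed
    then obtain C where C: "\<And>i. A i \<subseteq> (\<Union>n. C i n)" "\<And>i n. ediam d (C i n) \<le> ennreal \<delta>"
       "\<And>i. (\<Sum>n. hterm d s (C i n)) < haus_delta d s \<delta> (A i) + ennreal (e * (1/2) ^ Suc i)"
      by metis
    have "haus_delta d s \<delta> (\<Union>i. A i) \<le> (\<Sum>m. hterm d s ((\<lambda>(i, n). C i n) (prod_decode m)))"
    proof (rule haus_delta_le)
      show "(\<Union>i. A i) \<subseteq> (\<Union>m. (\<lambda>(i, n). C i n) (prod_decode m))"
      proof
        fix x assume "x \<in> (\<Union>i. A i)"
        then obtain i where "x \<in> A i" by blast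
        then obtain n where "x \<in> C i n" using C(1)[of i] by blast
        then have "x \<in> (\<lambda>(i, n). C i n) (prod_decode (prod_encode (i, n)))" by simp
        then show "x \<in> (\<Union>m. (\<lambda>(i, n). C i n) (prod_decode m))" by (rule UN_I[OF UNIV_I])
      qed
      show "ediam d ((\<lambda>(i, n). C i n) (prod_decode m)) \<le> ennreal \<delta>" for m
        using C(2) by (simp add: split_def)
    qed
    also have "\<dots> = (\<Sum>m. (\<lambda>p. hterm d s (C (fst p) (snd p))) (prod_decode m))"
      by (simp add: split_def)
    also have "\<dots> = (\<Sum>i. \<Sum>n. hterm d s (C i n))"
      by (rule suminf_ennreal_2dimen) simp
    also have "\<dots> \<le> (\<Sum>i. haus_delta d s \<delta> (A i) + ennreal (e * (1/2) ^ Suc i))"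
      using C(3) by (intro suminf_le) (auto intro: less_imp_le)
    also have "\<dots> = (\<Sum>i. haus_delta d s \<delta> (A i)) + (\<Sum>i. ennreal (e * (1/2) ^ Suc i))"
      by (intro suminf_add[symmetric]) auto
    also have "(\<Sum>i. ennreal (e * (1/2) ^ Suc i)) = ennreal e"
      using sums_mult[OF power_half_series, of e] e
      by (intro suminf_ennreal_eq) auto
    finally show "haus_delta d s \<delta> (\<Union>i. A i) \<le> (\<Sum>i. haus_delta d s \<delta> (A i)) + ennreal e" .
  qed
qed simp

lemma haus_delta_le_outer: "\<delta> > 0 \<Longrightarrow> haus_delta d s \<delta> A \<le> haus_outer d s A"
  unfolding haus_outer_def by (rule SUP_upper) simp

lemma haus_outer_leI: "(\<And>\<delta>. \<delta> > 0 \<Longrightarrow> haus_delta d s \<delta> A \<le> x) \<Longrightarrow> haus_outer d s A \<le> x"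
  unfolding haus_outer_def by (rule SUP_least) simp

lemma haus_outer_mono: "A \<subseteq> B \<Longrightarrow> haus_outer d s A \<le> haus_outer d s B"
  by (rule haus_outer_leI) (meson haus_delta_mono haus_delta_le_outer order_trans)

lemma haus_outer_empty [simp]: "haus_outer d s {} = 0"
  by (simp add: haus_outer_def)

lemma haus_outer_subadditive: "haus_outer d s (\<Union>i. A i) \<le> (\<Sum>i. haus_outer d s (A i))"
  by (rule haus_outer_leI, rule order_trans[OF haus_delta_subadditive])
     (intro suminf_le haus_delta_le_outer, auto)

lemma haus_outer_Un: "haus_outer d s (A \<union> B) \<le> haus_outer d s A + haus_outer d s B"
proof -
  have "(\<Union>i. (if i = (0::nat) then A else if i = 1 then B else {})) = A \<union> B"
    by (auto split: if_splits)
  then have "haus_outer d s (A \<union> B) \<le> (\<Sum>i. haus_outer d s (if i = (0::nat) then A else if i = 1 then B else {}))"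
    using haus_outer_subadditive[of d s "\<lambda>i. if i = (0::nat) then A else if i = 1 then B else {}"] by simp
  also have "\<dots> = (\<Sum>i\<in>{0, 1}. haus_outer d s (if i = (0::nat) then A else if i = 1 then B else {}))"
    by (rule suminf_finite) auto
  finally show ?thesis by simp
qed

text \<open>A set of diameter below the gap g cannot meet both A and B, so a fine cover of the union
  splits into a cover of A and one of B.\<close>

lemma haus_outer_separated:
  assumes g: "g > 0" and sep: "\<And>x y. x \<in> A \<Longrightarrow> y \<in> B \<Longrightarrow> g \<le> norm2 d (\<lambda>i. x i - y i)"
  shows "haus_outer d s A + haus_outer d s B \<le> haus_outer d s (A \<union> B)"
proof -
  have split: "haus_delta d s \<delta> A + haus_delta d s \<delta> B \<le> haus_delta d s \<delta> (A \<union> B)" if \<delta>: "\<delta> > 0" "\<delta> < g" for \<delta>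
  proof (rule haus_delta_ge)
    fix C :: "nat \<Rightarrow> (nat \<Rightarrow> real) set" assume C: "A \<union> B \<subseteq> (\<Union>n. C n)" "\<And>n. ediam d (C n) \<le> ennreal \<delta>"
    define CA where "CA n = (if C n \<inter> A = {} then {} else C n)" for n
    define CB where "CB n = (if C n \<inter> B = {} then {} else C n)" for n
    have "hterm d s (CA n) + hterm d s (CB n) \<le> hterm d s (C n)" for n
    proof -
      have "C n \<inter> A = {} \<or> C n \<inter> B = {}"
      proof (rule ccontr)
        assume "\<not> ?thesis"
        then obtain x y where xy: "x \<in> C n" "x \<in> A" "y \<in> C n" "y \<in> B" by auto
        then have "ennreal (norm2 d (\<lambda>i. x i - y i)) \<le> ennreal \<delta>"
          using C(2)[of n] by (auto simp: ediam_le_iff)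
        then have "norm2 d (\<lambda>i. x i - y i) \<le> \<delta>" using \<delta> by (simp add: ennreal_le_iff)
        then show False using sep[OF xy(2,4)] \<delta>(2) by linarith
      qed
      then show ?thesis by (auto simp: CA_def CB_def)
    qed
    then have "(\<Sum>n. hterm d s (CA n) + hterm d s (CB n)) \<le> (\<Sum>n. hterm d s (C n))"
      by (intro suminf_le) auto
    moreover have "(\<Sum>n. hterm d s (CA n) + hterm d s (CB n)) = (\<Sum>n. hterm d s (CA n)) + (\<Sum>n. hterm d s (CB n))"
      by (intro suminf_add[symmetric]) auto
    moreover have "haus_delta d s \<delta> A \<le> (\<Sum>n. hterm d s (CA n))"
      using C by (intro haus_delta_le) (fastforce simp: CA_def)+
    moreover have "haus_delta d s \<delta> B \<le> (\<Sum>n. hterm d s (CB n))"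
      using C by (intro haus_delta_le) (fastforce simp: CB_def)+
    ultimately show "haus_delta d s \<delta> A + haus_delta d s \<delta> B \<le> (\<Sum>n. hterm d s (C n))"
      using add_mono[of "haus_delta d s \<delta> A" "\<Sum>n. hterm d s (CA n)" "haus_delta d s \<delta> B" "\<Sum>n. hterm d s (CB n)"]
      by (simp add: order_trans)
  qed
  have "haus_outer d s A + haus_outer d s B = (SUP \<delta>\<in>{0<..}. haus_delta d s \<delta> A + haus_delta d s \<delta> B)"
    unfolding haus_outer_def
  proof (rule SUP_add_directed_ennreal[symmetric])
    fix a b :: real assume "a \<in> {0<..}" "b \<in> {0<..}"
    then show "\<exists>k\<in>{0<..}. haus_delta d s a A + haus_delta d s b B \<le> haus_delta d s k A + haus_delta d s k B"
      by (intro bexI[of _ "min a b"] add_mono haus_delta_antimono) auto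
  qed
  also have "\<dots> \<le> haus_outer d s (A \<union> B)"
  proof (rule SUP_least)
    fix \<delta> :: real assume \<delta>: "\<delta> \<in> {0<..}"
    let ?m = "min \<delta> (g / 2)"
    have m: "?m > 0" "?m < g" "?m \<le> \<delta>" using \<delta> g by auto
    have "haus_delta d s \<delta> A + haus_delta d s \<delta> B \<le> haus_delta d s ?m A + haus_delta d s ?m B"
      by (intro add_mono haus_delta_antimono m)
    also have "\<dots> \<le> haus_delta d s ?m (A \<union> B)" by (rule split[OF m(1,2)])
    also have "\<dots> \<le> haus_outer d s (A \<union> B)" by (rule haus_delta_le_outer[OF m(1)])
    finally show "haus_delta d s \<delta> A + haus_delta d s \<delta> B \<le> haus_outer d s (A \<union> B)" .
  qed
  finally show ?thesis .
qed

lemma coord_diff_le_norm2: "i < d \<Longrightarrow> x i - y i \<le> norm2 d (\<lambda>i. x i - y i)" "i < d \<Longrightarrow> y i - x i \<le> norm2 d (\<lambda>i. x i - y i)"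
  using abs_le_norm2[of i d "\<lambda>i. x i - y i"] by auto

text \<open>Caratheodory's argument for metric outer measures. The part of E beyond the hyperplane
  is cut into thin layers that accumulate at it. Without the layers close to the hyperplane the two
  parts are separated, and the omitted layers have small total measure because the sum over all
  layers converges.\<close>

lemma haus_outer_halfspace:
  assumes i: "i < d"
  shows "haus_outer d s {x \<in> E. x i \<le> c} + haus_outer d s {x \<in> E. \<not> x i \<le> c} \<le> haus_outer d s E"
proof (cases "haus_outer d s E = \<infinity>")
  case False
  let ?H = "haus_outer d s"
  define L where "L n = {x \<in> E. c + 1 / real (n + 2) \<le> x i \<and> x i < c + 1 / real (n + 1)}" for n
  define B where "B n = {x \<in> E. c + 1 / real (n + 1) \<le> x i}" for n
  define A where "A = {x \<in> E. x i \<le> c}"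
  \<comment> \<open>Adjacent layers may touch, but layers whose indices have the same parity are
    separated, so their measures add up to at most that of E.\<close>
  have layers: "(\<Sum>j<m. ?H (L (2 * j + p))) \<le> ?H E" for m p
  proof -
    have "(\<Sum>j<m. ?H (L (2 * j + p))) \<le> ?H (\<Union>j<m. L (2 * j + p))"
    proof (induction m)
      case (Suc m)
      have "(\<Sum>j<Suc m. ?H (L (2 * j + p))) \<le> ?H (\<Union>j<m. L (2 * j + p)) + ?H (L (2 * m + p))"
        using Suc by (simp add: add_right_mono)
      also have "\<dots> \<le> ?H ((\<Union>j<m. L (2 * j + p)) \<union> L (2 * m + p))"
      proof (cases "m = 0")
        case False
        \<comment> \<open>Layer 2m + p lies below c + 1/(2m + p + 1), and the earlier layers of its
          parity start at c + 1/(2m + p) or higher.\<close>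
        define g where "g = 1 / real (2 * m + p) - 1 / real (2 * m + p + 1)"
        have "real (2 * m + p) > 0" using False by simp
        then have g: "g > 0" unfolding g_def using divide_strict_left_mono[of "real (2 * m + p)" "real (2 * m + p + 1)" 1] by simp
        show ?thesis
        proof (rule haus_outer_separated[OF g])
          fix x y assume x: "x \<in> (\<Union>j<m. L (2 * j + p))" and y: "y \<in> L (2 * m + p)"
          then obtain j where j: "j < m" "c + 1 / real (2 * j + p + 2) \<le> x i" by (auto simp: L_def)
          have "1 / real (2 * m + p) \<le> 1 / real (2 * j + p + 2)"
            by (rule divide_left_mono) (use j(1) in auto)
          then have "g \<le> x i - y i" using j(2) y by (auto simp: L_def g_def algebra_simps)
          also have "\<dots> \<le> norm2 d (\<lambda>i. x i - y i)" using i by (rule coord_diff_le_norm2)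
          finally show "g \<le> norm2 d (\<lambda>i. x i - y i)" .
        qed
      qed simp
      finally show ?case by (simp add: lessThan_Suc Un_commute)
    qed simp
    also have "\<dots> \<le> ?H E" by (rule haus_outer_mono) (auto simp: L_def)
    finally show ?thesis .
  qed
  have "(\<Sum>n<N. ?H (L n)) \<le> 2 * ?H E" for N
  proof -
    have "(\<Sum>n<N. ?H (L n)) \<le> (\<Sum>n<2 * N. ?H (L n))" by (rule sum_mono2) auto
    also have "\<dots> = (\<Sum>j<N. ?H (L (2 * j + 0))) + (\<Sum>j<N. ?H (L (2 * j + 1)))"
      by (induction N) (auto simp: algebra_simps)
    also have "\<dots> \<le> ?H E + ?H E" by (intro add_mono layers)
    finally show ?thesis by (simp add: mult_2)
  qed
  then have sumL: "(\<Sum>n. ?H (L n)) \<le> 2 * ?H E"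
    by (simp add: suminf_eq_SUP SUP_le_iff)
  then have fin: "(\<Sum>n. ?H (L n)) \<noteq> \<infinity>"
    using False by (metis ennreal_mult_eq_top_iff ennreal_numeral infinity_ennreal_def neq_top_trans ennreal_neq_top)
  \<comment> \<open>That the tail of the series vanishes is expressed without subtraction in
    \<open>ennreal\<close>: the first N layers are added on the left, N is sent to infinity, and the
    finite sum is cancelled at the end.\<close>
  have step: "?H A + ?H {x \<in> E. \<not> x i \<le> c} + (\<Sum>n<N. ?H (L n)) \<le> ?H E + (\<Sum>n. ?H (L n))" for N
  proof -
    have sub: "{x \<in> E. \<not> x i \<le> c} \<subseteq> B N \<union> (\<Union>n. L (n + N))"
    proof
      fix x assume x: "x \<in> {x \<in> E. \<not> x i \<le> c}"
      then have u: "x i - c > 0" by simp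
      show "x \<in> B N \<union> (\<Union>n. L (n + N))"
      proof (cases "c + 1 / real (N + 1) \<le> x i")
        case False
        \<comment> \<open>The first threshold that \<open>x i - c\<close> reaches gives the layer
          containing x; since x is not in \<open>B N\<close>, its index is at least N.\<close>
        define n where "n = (LEAST n. 1 / real (n + 2) \<le> x i - c)"
        obtain m where "inverse (real (Suc m)) < x i - c" using reals_Archimedean[OF u] by auto
        then have "1 / real (m + 2) \<le> x i - c"
          using frac_le[of 1 1 "real (Suc m)" "real (m + 2)"] by (simp add: inverse_eq_divide)
        then have n1: "1 / real (n + 2) \<le> x i - c" unfolding n_def by (rule LeastI)
        have n2: "x i - c < 1 / real (n + 1) \<and> N \<le> n"
        proof (cases "n < N")
          case True
          then have "1 / real (N + 1) \<le> 1 / real (n + 2)" by (intro divide_left_mono) auto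
          then show ?thesis using False n1 by linarith
        next
          case F2: False
          have "x i - c < 1 / real (n + 1)"
          proof (cases n)
            case 0
            then have "N = 0" using F2 by simp
            then show ?thesis using False 0 by simp
          next
            case (Suc n')
            then have "\<not> 1 / real (n' + 2) \<le> x i - c" unfolding n_def using not_less_Least[of n'] n_def by (metis lessI)
            then show ?thesis using Suc by simp
          qed
          then show ?thesis using F2 by simp
        qed
        then have "x \<in> L ((n - N) + N)" using x n1 by (auto simp: L_def algebra_simps)
        then show ?thesis by blast
      qed (use x in \<open>auto simp: B_def\<close>)
    qed
    have AB: "?H A + ?H (B N) \<le> ?H E"
    proof -
      have "?H A + ?H (B N) \<le> ?H (A \<union> B N)"
      proof (rule haus_outer_separated[of "1 / real (N + 1)"])
        fix x y assume "x \<in> A" "y \<in> B N"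
        then have "1 / real (N + 1) \<le> y i - x i" by (auto simp: A_def B_def)
        also have "\<dots> \<le> norm2 d (\<lambda>i. x i - y i)" using i by (rule coord_diff_le_norm2)
        finally show "1 / real (N + 1) \<le> norm2 d (\<lambda>i. x i - y i)" .
      qed simp
      also have "\<dots> \<le> ?H E" by (rule haus_outer_mono) (auto simp: A_def B_def)
      finally show ?thesis .
    qed
    have "?H {x \<in> E. \<not> x i \<le> c} \<le> ?H (B N) + (\<Sum>n. ?H (L (n + N)))"
      using haus_outer_mono[OF sub] haus_outer_Un haus_outer_subadditive
      by (meson add_left_mono order_trans)
    then have "?H A + ?H {x \<in> E. \<not> x i \<le> c} + (\<Sum>n<N. ?H (L n)) \<le>
       ?H A + (?H (B N) + (\<Sum>n. ?H (L (n + N)))) + (\<Sum>n<N. ?H (L n))"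
      by (intro add_mono) auto
    also have "\<dots> = (?H A + ?H (B N)) + (\<Sum>n. ?H (L n))"
      by (subst suminf_offset[of "\<lambda>n. ?H (L n)" N]) (auto simp: algebra_simps)
    also have "\<dots> \<le> ?H E + (\<Sum>n. ?H (L n))" using AB by (rule add_right_mono)
    finally show ?thesis .
  qed
  have "?H A + ?H {x \<in> E. \<not> x i \<le> c} + (\<Sum>n. ?H (L n)) \<le> ?H E + (\<Sum>n. ?H (L n))"
  proof -
    have "?H A + ?H {x \<in> E. \<not> x i \<le> c} + (SUP N. \<Sum>n<N. ?H (L n)) = (SUP N. ?H A + ?H {x \<in> E. \<not> x i \<le> c} + (\<Sum>n<N. ?H (L n)))"
      by (rule ennreal_SUP_add_right) simp
    also have "\<dots> \<le> ?H E + (\<Sum>n. ?H (L n))" by (rule SUP_least) (rule step)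
    finally show ?thesis by (simp add: suminf_eq_SUP)
  qed
  then show ?thesis using fin by (simp add: A_def add.commute[of _ "\<Sum>n. ?H (L n)"])
qed simp

subsection \<open>Hausdorff measures\<close>

lemma space_lebd [simp]: "space (lebd d) = Rd d"
  by (simp add: lebd_def space_PiM Rd_def)

text \<open>The sets measurable in the sense of Caratheodory form a sigma-algebra that contains the
  coordinate half-spaces, and these generate the product sigma-algebra.\<close>

lemma hausdorff_measure_space:
  "\<exists>L. measure_space (Rd d) L (haus_outer d s) \<and> sets (lebd d) \<subseteq> L"
proof -
  let ?H = "haus_outer d s"
  define L where "L = lambda_system (Rd d) (Pow (Rd d)) ?H"
  have "outer_measure_space (Pow (Rd d)) ?H"
    unfolding outer_measure_space_def positive_def increasing_def countably_subadditive_def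
    by (auto intro: haus_outer_mono haus_outer_subadditive)
  then have ms: "measure_space (Rd d) L ?H"
    unfolding L_def by (rule sigma_algebra.caratheodory_lemma[OF sigma_algebra_Pow])
  then have sa: "sigma_algebra (Rd d) L" by (simp add: measure_space_def)
  have half: "{x \<in> Rd d. x i \<le> c} \<in> L" if i: "i < d" for i c
    unfolding L_def algebra.lambda_system_eq[OF algebra_Pow]
  proof (intro CollectI conjI ballI)
    fix E assume "E \<in> Pow (Rd d)"
    then have eq: "E \<inter> {x \<in> Rd d. x i \<le> c} = {x \<in> E. x i \<le> c}" "E - {x \<in> Rd d. x i \<le> c} = {x \<in> E. \<not> x i \<le> c}"
      by auto
    have "{x \<in> E. x i \<le> c} \<union> {x \<in> E. \<not> x i \<le> c} = E" by auto
    then have "?H E \<le> ?H {x \<in> E. x i \<le> c} + ?H {x \<in> E. \<not> x i \<le> c}"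
      using haus_outer_Un[of d s "{x \<in> E. x i \<le> c}" "{x \<in> E. \<not> x i \<le> c}"] by simp
    then show "?H (E \<inter> {x \<in> Rd d. x i \<le> c}) + ?H (E - {x \<in> Rd d. x i \<le> c}) = ?H E"
      unfolding eq using haus_outer_halfspace[OF i] by (intro antisym)
  qed auto
  \<comment> \<open>An auxiliary measure that carries the sigma-algebra L, so that coordinatewise
    measurability of the identity shows that L contains the sets of \<open>lebd d\<close>.\<close>
  define N where "N = measure_of (Rd d) L (\<lambda>_. 0)"
  have LP: "L \<subseteq> Pow (Rd d)" using sa by (simp add: sigma_algebra_iff2)
  have sN: "sets N = L" "space N = Rd d"
    unfolding N_def using LP sa by (auto simp: sigma_algebra.sigma_sets_eq)
  have "(\<lambda>x i. x i) \<in> measurable N (lebd d)"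
    unfolding lebd_def
  proof (rule measurable_PiM_single')
    fix i assume "i \<in> {..<d}"
    then show "(\<lambda>x. x i) \<in> measurable N lborel"
      using half by (auto simp: borel_measurable_iff_le sN)
  qed (auto simp: sN Rd_def)
  then have "sets (lebd d) \<subseteq> L"
  proof (intro subsetI)
    fix X assume m: "(\<lambda>x i. x i) \<in> measurable N (lebd d)" and X: "X \<in> sets (lebd d)"
    have "(\<lambda>x i. x i) -` X \<inter> space N \<in> sets N" by (rule measurable_sets[OF m X])
    moreover have "(\<lambda>x i. x i) -` X \<inter> space N = X" using sets.sets_into_space[OF X] by (auto simp: sN)
    ultimately show "X \<in> L" by (simp add: sN)
  qed
  then show ?thesis using ms by blast
qed

lemma space_hausdorff [simp]: "space (hausdorff d s) = Rd d"
  unfolding hausdorff_def by (rule space_measure_of) (use sets.space_closed[of "lebd d"] in simp)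

lemma sets_hausdorff [measurable_cong, simp]: "sets (hausdorff d s) = sets (lebd d)"
  unfolding hausdorff_def using sets.space_closed[of "lebd d"] sets.sigma_sets_eq[of "lebd d"] by simp

lemma emeasure_hausdorff:
  assumes "X \<in> sets (lebd d)"
  shows "emeasure (hausdorff d s) X = haus_outer d s X"
proof -
  obtain L where L: "measure_space (Rd d) L (haus_outer d s)" "sets (lebd d) \<subseteq> L"
    using hausdorff_measure_space by blast
  show ?thesis
  proof (rule emeasure_measure_of[OF hausdorff_def])
    show "sets (lebd d) \<subseteq> Pow (Rd d)" using sets.space_closed[of "lebd d"] by simp
    show "positive (sets (hausdorff d s)) (haus_outer d s)" by (simp add: positive_def)
    have "countably_additive L (haus_outer d s)" using L(1) by (simp add: measure_space_def)
    then show "countably_additive (sets (hausdorff d s)) (haus_outer d s)"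
      unfolding countably_additive_def sets_hausdorff using L(2) by (meson subset_trans subsetD)
  qed (use assms in simp)
qed

subsection \<open>The Hausdorff measure of spheres\<close>

lemma hconst_pos [simp]: "hconst s > 0"
  by (simp add: hconst_def Gamma_real_pos)

lemma emeasure_lebd_PiE:
  assumes "\<And>i. i < d \<Longrightarrow> A i \<in> sets borel"
  shows "emeasure (lebd d) (PiE {..<d} A) = (\<Prod>i<d. emeasure lborel (A i))"
proof -
  interpret product_sigma_finite "\<lambda>_::nat. lborel :: real measure" by standard
  show ?thesis unfolding lebd_def by (rule emeasure_PiM) (use assms in auto)
qed

lemma emeasure_lebd_box:
  assumes "\<And>i. i < d \<Longrightarrow> l i \<le> u i"
  shows "emeasure (lebd d) (PiE {..<d} (\<lambda>i. {l i..u i})) = ennreal (\<Prod>i<d. u i - l i)"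
proof -
  have "emeasure (lebd d) (PiE {..<d} (\<lambda>i. {l i..u i})) = (\<Prod>i<d. ennreal (u i - l i))"
    using assms by (subst emeasure_lebd_PiE) auto
  also have "\<dots> = ennreal (\<Prod>i<d. u i - l i)" by (rule prod_ennreal) (use assms in auto)
  finally show ?thesis .
qed

lemma box_in_sets [simp]: "PiE {..<d} (\<lambda>i. {l i..u i :: real}) \<in> sets (lebd d)"
  unfolding lebd_def by (rule sets_PiM_I_finite) auto

text \<open>Dropping the last coordinate does not increase distances, and the image of the sphere
  contains a cube of side 2 a. A cover by sets of diameter \<open>D n\<close> thus gives a cover of
  this cube by cubes of side \<open>2 * D n\<close>, whose volume is 4^m times the power of
  \<open>D n / 2\<close> in the Hausdorff sum.\<close>

lemma haus_outer_sphere_pos: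
  assumes d: "d \<ge> 1" and R: "R > 0"
  shows "haus_outer d (d - 1) (sphered d R) > 0"
proof -
  define m where "m = d - 1"
  have dm: "d = Suc m" using d by (simp add: m_def)
  \<comment> \<open>Small enough for the cube in dimension m to lie in the ball of radius R, since m
    a^2 is at most R^2.\<close>
  define a where "a = R / d"
  have a: "a > 0" using R d by (simp add: a_def)
  let ?x = "ennreal (hconst m / 4 ^ m) * ennreal ((2 * a) ^ m)"
  have "?x \<le> haus_delta d m 1 (sphered d R)"
  proof (rule haus_delta_ge)
    fix C :: "nat \<Rightarrow> (nat \<Rightarrow> real) set"
    assume C: "sphered d R \<subseteq> (\<Union>n. C n)" "\<And>n. ediam d (C n) \<le> ennreal 1"
    define x where "x n = (SOME x. x \<in> C n)" for n
    define D where "D n = enn2real (ediam d (C n))" for n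
    have xC: "x n \<in> C n" if "C n \<noteq> {}" for n using that by (simp add: x_def some_in_eq)
    have D: "ediam d (C n) = ennreal (D n)" "D n \<ge> 0" for n
      using le_less_trans[OF C(2)[of n] ennreal_less_top] by (auto simp: D_def)
    define b where "b n = (if C n = {} then {} else PiE {..<m} (\<lambda>i. {x n i - D n..x n i + D n}))" for n
    have bs: "b n \<in> sets (lebd m)" for n by (simp add: b_def)
    have hb: "ennreal (hconst m / 4 ^ m) * emeasure (lebd m) (b n) = hterm d m (C n)" for n
    proof (cases "C n = {}")
      case False
      have em: "emeasure (lebd m) (b n) = ennreal ((2 * D n) ^ m)"
        using False D(2)[of n] by (simp add: b_def emeasure_lebd_box)
      have "ennreal (hconst m / 4 ^ m) * emeasure (lebd m) (b n) = ennreal (hconst m / 4 ^ m * (2 * D n) ^ m)"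
        unfolding em by (rule ennreal_mult[symmetric]) (use D(2)[of n] in \<open>auto simp: less_imp_le\<close>)
      also have "hconst m / 4 ^ m * (2 * D n) ^ m = hconst m * (D n / 2) ^ m"
      proof -
        have "(4::real) ^ m = 2 ^ m * 2 ^ m" by (simp flip: power_mult_distrib)
        then show ?thesis by (simp add: power_mult_distrib power_divide)
      qed
      also have "ennreal \<dots> = hterm d m (C n)"
        using False D(2)[of n] by (simp add: hterm_def D(1) ennreal_mult less_imp_le ennreal_power divide_ennreal[of _ 2, simplified])
      finally show ?thesis .
    qed (simp add: b_def)
    define Q where "Q = PiE {..<m} (\<lambda>i. {- a..a})"
    have "Q \<subseteq> (\<Union>n. b n)"
    proof
      fix q assume q: "q \<in> Q"
      have qa: "\<bar>q i\<bar> \<le> a" if "i < m" for i using q that by (auto simp: Q_def PiE_def Pi_def)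
      have "(\<Sum>i<m. (q i)\<^sup>2) \<le> (\<Sum>i<m. a\<^sup>2)"
        by (intro sum_mono) (use qa a in \<open>simp add: abs_le_square_iff[symmetric]\<close>)
      also have "\<dots> \<le> R\<^sup>2"
      proof -
        have "real m \<le> (real d)\<^sup>2" by (simp add: dm power2_eq_square algebra_simps)
        then have "real m * R\<^sup>2 \<le> (real d)\<^sup>2 * R\<^sup>2" by (rule mult_right_mono) simp
        then show ?thesis using d by (simp add: a_def power_divide pos_divide_le_eq mult.commute)
      qed
      finally have le: "(\<Sum>i<m. (q i)\<^sup>2) \<le> R\<^sup>2" .
      \<comment> \<open>The point of the upper half of the sphere above q.\<close>
      define z where "z = restrict (\<lambda>i. if i < m then q i else sqrt (R\<^sup>2 - (\<Sum>i<m. (q i)\<^sup>2))) {..<d}"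
      have "(\<Sum>i<d. (z i)\<^sup>2) = (\<Sum>i<m. (q i)\<^sup>2) + (R\<^sup>2 - (\<Sum>i<m. (q i)\<^sup>2))"
        using le by (simp add: z_def dm)
      then have "z \<in> sphered d R" using R by (simp add: sphered_def norm2_def z_def)
      then obtain n where n: "z \<in> C n" using C(1) by auto
      then have ne: "C n \<noteq> {}" by auto
      have "ennreal (norm2 d (\<lambda>i. z i - x n i)) \<le> ennreal (D n)"
        using n xC[OF ne] D(1)[of n] ediam_le_iff[of d "C n" "ennreal (D n)"] by auto
      then have nz: "norm2 d (\<lambda>i. z i - x n i) \<le> D n" using D(2)[of n] by (simp add: ennreal_le_iff)
      have "q i \<in> {x n i - D n..x n i + D n}" if i: "i < m" for i
        using abs_le_norm2[of i d "\<lambda>i. z i - x n i"] nz i by (auto simp: z_def dm)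
      then have "q \<in> b n" using q ne by (auto simp: b_def Q_def PiE_def)
      then show "q \<in> (\<Union>n. b n)" by blast
    qed
    then have "emeasure (lebd m) Q \<le> emeasure (lebd m) (\<Union>n. b n)"
      using bs by (intro emeasure_mono) auto
    also have "\<dots> \<le> (\<Sum>n. emeasure (lebd m) (b n))"
      by (rule emeasure_subadditive_countably) (use bs in auto)
    finally have "emeasure (lebd m) Q \<le> (\<Sum>n. emeasure (lebd m) (b n))" .
    moreover have "emeasure (lebd m) Q = ennreal ((2 * a) ^ m)"
      using a by (simp add: Q_def emeasure_lebd_box)
    ultimately have "?x \<le> ennreal (hconst m / 4 ^ m) * (\<Sum>n. emeasure (lebd m) (b n))"
      by (simp add: mult_left_mono)
    also have "\<dots> = (\<Sum>n. hterm d m (C n))"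
      by (simp add: hb flip: ennreal_suminf_cmult)
    finally show "?x \<le> (\<Sum>n. hterm d m (C n))" .
  qed
  moreover have "?x > 0" using a by (simp add: ennreal_zero_less_mult_iff)
  ultimately have "haus_delta d m 1 (sphered d R) > 0" by (rule less_le_trans[rotated])
  then show ?thesis using haus_delta_le_outer[of 1 d m "sphered d R"] unfolding m_def by (meson less_le_trans zero_less_one)
qed

section \<open>Covers of spheres and finiteness of their measure\<close>

lemma grid_cell:
  fixes t :: real
  assumes "0 \<le> t" "t \<le> 1" "N > 0"
  shows "\<exists>q<N. real q / N \<le> t \<and> t \<le> (real q + 1) / N"
proof (cases "t = 1")
  case True
  then show ?thesis using assms by (intro exI[of _ "N - 1"]) (auto simp: of_nat_diff field_simps)
next
  case False
  define q where "q = nat \<lfloor>t * N\<rfloor>"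
  have q: "real q \<le> t * N" "t * N < real q + 1" using assms by (auto simp: q_def)
  have "t * real N < 1 * real N" using False assms by (intro mult_strict_right_mono) auto
  then have "q < N" using q by linarith
  then show ?thesis using q assms(3) by (intro exI[of _ q]) (auto simp: field_simps)
qed

text \<open>Some coordinate i satisfies |x i| >= R / d; its index and sign are recorded, and the
  other d - 1 coordinates are put on a grid of N steps. Within a cell these others control x i,
  because its square is R^2 minus their squares and x i + y i stays away from 0. The exponent d - 1
  matches the dimension of the measure.\<close>

lemma sphere_cover:
  assumes d: "d \<ge> 1" and R: "R > 0" and N: "N > 0"
  shows "\<exists>(P :: (nat \<times> bool \<times> (nat \<Rightarrow> nat)) set) C. finite P \<and> card P = 2 * d * N ^ (d - 1) \<and>
    sphered d R \<subseteq> (\<Union>p\<in>P. C p) \<and>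
    (\<forall>p\<in>P. \<forall>x\<in>C p. \<forall>y\<in>C p. norm2 d (\<lambda>i. x i - y i) \<le> 2 * real d ^ 3 * R / N)"
proof -
  define P where "P = (SIGMA i:{..<d}. (UNIV :: bool set) \<times> PiE ({..<d} - {i}) (\<lambda>_. {..<N}))"
  define C where "C = (\<lambda>(i, b, q). {x \<in> sphered d R. (if b then x i \<ge> R / d else x i \<le> - R / d) \<and>
     (\<forall>j<d. j \<noteq> i \<longrightarrow> real (q j :: nat) / N \<le> (x j + R) / (2 * R) \<and> (x j + R) / (2 * R) \<le> (real (q j) + 1) / N)})"
  have fin: "finite P" unfolding P_def by (intro finite_SigmaI finite_cartesian_product finite_PiE) auto
  have "card P = (\<Sum>i<d. 2 * N ^ (d - 1))"
    unfolding P_def by (subst card_SigmaI) (auto intro!: sum.cong finite_cartesian_product finite_PiE simp: card_cartesian_product card_PiE)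
  then have card: "card P = 2 * d * N ^ (d - 1)" by simp
  have Rx: "\<bar>x j\<bar> \<le> R" if "x \<in> sphered d R" "j < d" for x j
    using abs_le_norm2[of j d x] that by (auto simp: sphered_def)
  have sq: "(\<Sum>j<d. (x j)\<^sup>2) = R\<^sup>2" if "x \<in> sphered d R" for x
  proof -
    have "sqrt (\<Sum>j<d. (x j)\<^sup>2) = R" using that by (simp add: sphered_def norm2_def)
    then show ?thesis by (metis real_sqrt_pow2 sum_nonneg zero_le_power2)
  qed
  have cover: "sphered d R \<subseteq> (\<Union>p\<in>P. C p)"
  proof
    fix x assume x: "x \<in> sphered d R"
    have "\<exists>i<d. \<bar>x i\<bar> \<ge> R / d"
    proof (rule ccontr)
      assume "\<not> ?thesis"
      then have lt: "\<bar>x i\<bar> < R / d" if "i < d" for i using that by auto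
      have "(\<Sum>j<d. (x j)\<^sup>2) < (\<Sum>j<d. (R / d)\<^sup>2)"
      proof (rule sum_strict_mono)
        show "{..<d} \<noteq> {}" using d by (auto simp: lessThan_empty_iff)
        fix j assume "j \<in> {..<d}"
        then show "(x j)\<^sup>2 < (R / d)\<^sup>2" using lt[of j] by (metis abs_ge_zero lessThan_iff power2_abs power_strict_mono zero_less_numeral)
      qed simp
      also have "\<dots> = R\<^sup>2 / d" using d by (simp add: power_divide power2_eq_square)
      also have "\<dots> \<le> R\<^sup>2" using d by (simp add: divide_le_eq mult_le_cancel_left1)
      finally show False using sq[OF x] by simp
    qed
    then obtain i where i: "i < d" "\<bar>x i\<bar> \<ge> R / d" by blast
    have "\<forall>j<d. \<exists>q<N. real q / N \<le> (x j + R) / (2 * R) \<and> (x j + R) / (2 * R) \<le> (real q + 1) / N"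
    proof (intro allI impI)
      fix j assume "j < d"
      then have "0 \<le> (x j + R) / (2 * R)" "(x j + R) / (2 * R) \<le> 1" using Rx[OF x, of j] R by auto
      then show "\<exists>q<N. real q / N \<le> (x j + R) / (2 * R) \<and> (x j + R) / (2 * R) \<le> (real q + 1) / N"
        using N by (rule grid_cell)
    qed
    then obtain q where q: "\<And>j. j < d \<Longrightarrow> q j < N \<and> real (q j) / N \<le> (x j + R) / (2 * R) \<and> (x j + R) / (2 * R) \<le> (real (q j) + 1) / N"
      by metis
    let ?p = "(i, x i \<ge> 0, restrict q ({..<d} - {i}))"
    have "?p \<in> P" using i q by (auto simp: P_def)
    moreover have "x \<in> C ?p" using x i q by (auto simp: C_def)
    ultimately show "x \<in> (\<Union>p\<in>P. C p)" by blast
  qed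
  have diam: "norm2 d (\<lambda>i. x i - y i) \<le> 2 * real d ^ 3 * R / N" if p: "p \<in> P" and x: "x \<in> C p" and y: "y \<in> C p" for p x y
  proof -
    obtain i b q where ibq: "p = (i, b, q)" by (cases p)
    have i: "i < d" using p by (auto simp: P_def ibq)
    have xs: "x \<in> sphered d R" and ys: "y \<in> sphered d R" using x y by (auto simp: C_def ibq)
    have close: "\<bar>x j - y j\<bar> \<le> 2 * R / N" if "j < d" "j \<noteq> i" for j
    proof -
      have "real (q j) / N \<le> (x j + R) / (2 * R)" "(x j + R) / (2 * R) \<le> real (q j) / N + 1 / N"
        "real (q j) / N \<le> (y j + R) / (2 * R)" "(y j + R) / (2 * R) \<le> real (q j) / N + 1 / N"
        using x y that by (auto simp: C_def ibq add_divide_distrib)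
      then have "\<bar>(x j + R) / (2 * R) - (y j + R) / (2 * R)\<bar> \<le> 1 / N" by linarith
      moreover have "(x j + R) / (2 * R) - (y j + R) / (2 * R) = (x j - y j) / (2 * R)" by (simp add: diff_divide_distrib add_divide_distrib)
      ultimately show ?thesis using R by (simp add: abs_divide pos_divide_le_eq mult.commute)
    qed
    have sum_split: "(\<Sum>j<d. g j) = g i + (\<Sum>j\<in>{..<d} - {i}. g j)" for g :: "nat \<Rightarrow> real"
      by (rule sum.remove) (use i in auto)
    have "(x i)\<^sup>2 - (y i)\<^sup>2 = (\<Sum>j\<in>{..<d} - {i}. (y j - x j) * (y j + x j))"
      using sq[OF xs] sq[OF ys] unfolding sum_split by (simp add: power2_eq_square algebra_simps sum_subtractf)
    also have "\<bar>\<dots>\<bar> \<le> (\<Sum>j\<in>{..<d} - {i}. (2 * R / N) * (2 * R))"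
    proof (rule order_trans[OF sum_abs sum_mono])
      fix j assume j: "j \<in> {..<d} - {i}"
      have "\<bar>y j + x j\<bar> \<le> 2 * R" using Rx[OF xs, of j] Rx[OF ys, of j] j by auto
      then show "\<bar>(y j - x j) * (y j + x j)\<bar> \<le> (2 * R / N) * (2 * R)"
        unfolding abs_mult using close[of j] j R by (intro mult_mono) (auto simp: abs_minus_commute)
    qed
    also have "\<dots> \<le> d * ((2 * R / N) * (2 * R))"
      using R i by (simp add: card_Diff_singleton) (intro divide_right_mono mult_right_mono, auto)
    finally have 1: "\<bar>(x i)\<^sup>2 - (y i)\<^sup>2\<bar> \<le> d * ((2 * R / N) * (2 * R))" .
    \<comment> \<open>The common sign recorded by b keeps the two entries from cancelling; this
      allows dividing the difference of squares by the sum.\<close>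
    have 2: "\<bar>x i + y i\<bar> \<ge> 2 * R / d"
      using x y by (cases b) (auto simp: C_def ibq)
    have "\<bar>x i - y i\<bar> * (2 * R / d) \<le> \<bar>x i - y i\<bar> * \<bar>x i + y i\<bar>"
      by (rule mult_left_mono[OF 2]) simp
    also have "\<dots> = \<bar>(x i)\<^sup>2 - (y i)\<^sup>2\<bar>" by (simp add: power2_eq_square square_diff_square_factored abs_mult mult.commute)
    also have "\<dots> \<le> (d * d * (2 * R / N)) * (2 * R / d)" using 1 d by (simp add: field_simps)
    finally have ci: "\<bar>x i - y i\<bar> \<le> d * d * (2 * R / N)"
      by (rule mult_right_le_imp_le) (use R d in simp)
    have all: "\<bar>x j - y j\<bar> \<le> d * d * (2 * R / N)" if "j < d" for j
    proof (cases "j = i")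
      case False
      have "1 * (2 * R / N) \<le> real (d * d) * (2 * R / N)"
        using d R mult_mono[of 1 "real d" 1 "real d"] by (intro mult_right_mono) auto
      then show ?thesis using close[OF that False] by simp
    qed (use ci in simp)
    have "norm2 d (\<lambda>i. x i - y i) \<le> (\<Sum>j<d. \<bar>x j - y j\<bar>)"
      unfolding norm2_L2 by (rule L2_set_le_sum_abs)
    also have "\<dots> \<le> (\<Sum>j<d. d * d * (2 * R / N))" by (rule sum_mono) (use all in auto)
    also have "\<dots> = 2 * real d ^ 3 * R / N" by (simp add: power3_eq_cube)
    finally show ?thesis .
  qed
  show ?thesis using fin card cover diam by blast
qed

text \<open>An enumeration of P followed by empty sets, which cost nothing, is an admissible
  countable cover.\<close>

lemma haus_delta_finite:
  assumes P: "finite P" "A \<subseteq> (\<Union>p\<in>P. C p)" and D: "D \<ge> 0" "D \<le> \<delta>"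
    and diam: "\<And>p x y. p \<in> P \<Longrightarrow> x \<in> C p \<Longrightarrow> y \<in> C p \<Longrightarrow> norm2 d (\<lambda>i. x i - y i) \<le> D"
  shows "haus_delta d s \<delta> A \<le> ennreal (card P * (hconst s * (D / 2) ^ s))"
proof -
  obtain e where e: "bij_betw e {0..<card P} P" using ex_bij_betw_nat_finite[OF P(1)] by auto
  define B where "B n = (if n < card P then C (e n) else {})" for n
  have ed: "ediam d (B n) \<le> ennreal D" for n
  proof (cases "n < card P")
    case True
    then have "e n \<in> P" using e by (auto simp: bij_betw_def)
    then show ?thesis using True diam by (auto simp: B_def ediam_le_iff intro!: ennreal_leI)
  qed (simp add: B_def)
  have "haus_delta d s \<delta> A \<le> (\<Sum>n. hterm d s (B n))"
  proof (rule haus_delta_le)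
    show "A \<subseteq> (\<Union>n. B n)"
    proof
      fix x assume "x \<in> A"
      then obtain p where p: "p \<in> P" "x \<in> C p" using P(2) by auto
      then obtain n where "n \<in> {0..<card P}" "p = e n" using e unfolding bij_betw_def by blast
      then have "x \<in> B n" using p by (simp add: B_def)
      then show "x \<in> (\<Union>n. B n)" by blast
    qed
    show "ediam d (B n) \<le> ennreal \<delta>" for n using ed[of n] ennreal_leI[OF D(2)] by (rule order_trans)
  qed
  also have "\<dots> = (\<Sum>n<card P. hterm d s (B n))"
    by (rule suminf_finite) (auto simp: B_def)
  also have "\<dots> \<le> (\<Sum>n<card P. ennreal (hconst s * (D / 2) ^ s))"
  proof (rule sum_mono)
    fix n
    have "hterm d s (B n) \<le> ennreal (hconst s) * (ediam d (B n) / 2) ^ s" by (simp add: hterm_def)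
    also have "\<dots> \<le> ennreal (hconst s) * (ennreal D / 2) ^ s"
      by (intro mult_left_mono power_mono divide_right_mono_ennreal ed) auto
    also have "\<dots> = ennreal (hconst s * (D / 2) ^ s)"
      using D(1) by (simp add: ennreal_mult less_imp_le ennreal_power divide_ennreal[of _ 2, simplified])
    finally show "hterm d s (B n) \<le> ennreal (hconst s * (D / 2) ^ s)" .
  qed
  also have "\<dots> = ennreal (card P * (hconst s * (D / 2) ^ s))"
    using D(1) by (simp add: ennreal_mult less_imp_le ennreal_of_nat_eq_real_of_nat)
  finally show ?thesis .
qed

text \<open>With a multiple of N^(d - 1) cells of diameter c / N the powers of N cancel, so the
  Hausdorff sums stay bounded as N grows.\<close>

lemma haus_outer_sphere_finite:
  assumes d: "d \<ge> 1" and R: "R > 0"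
  shows "haus_outer d (d - 1) (sphered d R) < \<infinity>"
proof -
  define c where "c = 2 * real d ^ 3 * R"
  have c: "c > 0" using d R by (simp add: c_def)
  have "haus_outer d (d - 1) (sphered d R) \<le> ennreal (2 * d * (hconst (d - 1) * (c / 2) ^ (d - 1)))"
  proof (rule haus_outer_leI)
    fix \<delta> :: real assume \<delta>: "\<delta> > 0"
    obtain N :: nat where "real N > c / \<delta>" using reals_Archimedean2 by blast
    then have N\<delta>: "c < \<delta> * real N" using \<delta> by (simp add: pos_divide_less_eq mult.commute)
    then have N: "N > 0" using c by (auto intro!: gr0I)
    then have N2: "c / N \<le> \<delta>" using N\<delta> by (simp add: pos_divide_le_eq)
    obtain P :: "(nat \<times> bool \<times> (nat \<Rightarrow> nat)) set" and C where P: "finite P" "card P = 2 * d * N ^ (d - 1)"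
      "sphered d R \<subseteq> (\<Union>p\<in>P. C p)" "\<And>p x y. p \<in> P \<Longrightarrow> x \<in> C p \<Longrightarrow> y \<in> C p \<Longrightarrow> norm2 d (\<lambda>i. x i - y i) \<le> c / N"
      using sphere_cover[OF d R N] unfolding c_def by blast
    have "haus_delta d (d - 1) \<delta> (sphered d R) \<le> ennreal (card P * (hconst (d - 1) * (c / N / 2) ^ (d - 1)))"
      by (rule haus_delta_finite[OF P(1,3) _ N2 P(4)]) (use c in auto)
    also have "real (card P) * (hconst (d - 1) * (c / N / 2) ^ (d - 1)) = 2 * d * (hconst (d - 1) * (c / 2) ^ (d - 1))"
      using N by (simp add: P(2) power_divide power_mult_distrib)
    finally show "haus_delta d (d - 1) \<delta> (sphered d R) \<le> ennreal (2 * d * (hconst (d - 1) * (c / 2) ^ (d - 1)))" .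
  qed
  then show ?thesis by (rule le_less_trans) simp
qed

text \<open>The covering sets are intersected with A before T is applied, because T is assumed not
  to increase distances only on A.\<close>

lemma haus_outer_image_le:
  assumes T: "\<And>x y. x \<in> A \<Longrightarrow> y \<in> A \<Longrightarrow> norm2 d (\<lambda>i. T x i - T y i) \<le> norm2 d (\<lambda>i. x i - y i)"
  shows "haus_outer d s (T ` A) \<le> haus_outer d s A"
proof (rule haus_outer_leI)
  fix \<delta> :: real assume \<delta>: "\<delta> > 0"
  have "haus_delta d s \<delta> (T ` A) \<le> haus_delta d s \<delta> A"
  proof (rule haus_delta_ge)
    fix C :: "nat \<Rightarrow> (nat \<Rightarrow> real) set"
    assume C: "A \<subseteq> (\<Union>n. C n)" "\<And>n. ediam d (C n) \<le> ennreal \<delta>"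
    have ed: "ediam d (T ` (C n \<inter> A)) \<le> ediam d (C n)" for n
      unfolding ediam_le_iff
    proof (intro ballI)
      fix x y assume "x \<in> T ` (C n \<inter> A)" "y \<in> T ` (C n \<inter> A)"
      then obtain u v where uv: "x = T u" "y = T v" "u \<in> C n" "u \<in> A" "v \<in> C n" "v \<in> A" by auto
      have "ennreal (norm2 d (\<lambda>i. x i - y i)) \<le> ennreal (norm2 d (\<lambda>i. u i - v i))"
        using uv T by (auto intro: ennreal_leI)
      also have "\<dots> \<le> ediam d (C n)" using uv ediam_le_iff[of d "C n" "ediam d (C n)"] by auto
      finally show "ennreal (norm2 d (\<lambda>i. x i - y i)) \<le> ediam d (C n)" .
    qed
    have "haus_delta d s \<delta> (T ` A) \<le> (\<Sum>n. hterm d s (T ` (C n \<inter> A)))"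
    proof (rule haus_delta_le)
      show "T ` A \<subseteq> (\<Union>n. T ` (C n \<inter> A))" using C(1) by blast
      show "ediam d (T ` (C n \<inter> A)) \<le> ennreal \<delta>" for n using ed C(2) by (rule order_trans)
    qed
    also have "\<dots> \<le> (\<Sum>n. hterm d s (C n))"
    proof (intro suminf_le)
      fix n
      show "hterm d s (T ` (C n \<inter> A)) \<le> hterm d s (C n)"
        using ed[of n] by (auto simp: hterm_def intro!: mult_left_mono power_mono divide_right_mono_ennreal)
    qed auto
    finally show "haus_delta d s \<delta> (T ` A) \<le> (\<Sum>n. hterm d s (C n))" .
  qed
  then show "haus_delta d s \<delta> (T ` A) \<le> haus_outer d s A"
    using haus_delta_le_outer[OF \<delta>] by (rule order_trans)
qed

subsection \<open>Lebesgue measure in coordinates\<close>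

lemma coord_measurable [measurable]: "i < d \<Longrightarrow> (\<lambda>x. x i) \<in> borel_measurable (lebd d)"
  unfolding lebd_def using measurable_component_singleton[of i "{..<d}" "\<lambda>_. lborel"] by simp

lemma norm2_measurable [measurable]: "norm2 d \<in> borel_measurable (lebd d)"
proof -
  have "(\<lambda>x. \<Sum>i<d. (x i)\<^sup>2) \<in> borel_measurable (lebd d)"
    by (intro borel_measurable_sum borel_measurable_power) auto
  then show ?thesis unfolding norm2_def[abs_def] by measurable
qed

lemma measurable_lebdI:
  assumes "\<And>i. i < d \<Longrightarrow> (\<lambda>x. f x i) \<in> borel_measurable N" "\<And>x. x \<in> space N \<Longrightarrow> f x \<in> Rd d"
  shows "f \<in> measurable N (lebd d)"
proof -
  have "(\<lambda>x i. f x i) \<in> measurable N (lebd d)"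
    unfolding lebd_def by (rule measurable_PiM_single') (use assms in \<open>auto simp: Rd_def\<close>)
  then show ?thesis by simp
qed

text \<open>Relates the finite product sigma-algebra to the Borel sets of the whole function space,
  to which continuity refers; the coordinates from d on are constant on \<open>Rd d\<close>.\<close>

lemma id_measurable_lebd: "(\<lambda>x. x) \<in> measurable (lebd d) borel"
proof (rule measurable_coordinatewise_then_product)
  fix i
  show "(\<lambda>x. x i) \<in> borel_measurable (lebd d)"
  proof (cases "i < d")
    case False
    have "(\<lambda>x. x i) \<in> borel_measurable (lebd d) \<longleftrightarrow> (\<lambda>x. undefined :: real) \<in> borel_measurable (lebd d)"
      using False by (intro measurable_cong) (simp add: Rd_undefined)
    then show ?thesis by simp
  qed simp
qed

lemma borel_measurable_cont_lebd:
  fixes F :: "(nat \<Rightarrow> real) \<Rightarrow> real"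
  assumes U: "U \<in> sets (lebd d)" and F: "continuous_on U F"
  shows "(\<lambda>x. indicator U x * F x) \<in> borel_measurable (lebd d)"
proof -
  have "F \<in> borel_measurable (restrict_space borel U)" by (rule borel_measurable_continuous_on_restrict[OF F])
  moreover have "(\<lambda>x. x) \<in> measurable (restrict_space (lebd d) U) (restrict_space borel U)"
    by (rule measurable_restrict_space3[OF id_measurable_lebd]) auto
  ultimately have "F \<in> borel_measurable (restrict_space (lebd d) U)"
    using measurable_compose by blast
  then show ?thesis
    using borel_measurable_restrict_space_iff[of U "lebd d" F] U by (simp add: sets.Int_space_eq2[of _ "lebd d", simplified])
qed

lemma cballd_sets [measurable]: "cballd d R \<in> sets (lebd d)"
proof -
  have "{x \<in> space (lebd d). norm2 d x \<le> R} \<in> sets (lebd d)" by measurable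
  then show ?thesis by (simp add: cballd_def)
qed

lemma oballd_sets [measurable]: "oballd d R \<in> sets (lebd d)"
proof -
  have "{x \<in> space (lebd d). norm2 d x < R} \<in> sets (lebd d)" by measurable
  then show ?thesis by (simp add: oballd_def)
qed

lemma sphered_sets [measurable]: "sphered d R \<in> sets (lebd d)"
proof -
  have "{x \<in> space (lebd d). norm2 d x = R} \<in> sets (lebd d)" by measurable
  then show ?thesis by (simp add: sphered_def)
qed

lemma sigma_finite_lebd: "sigma_finite_measure (lebd d)"
proof -
  interpret product_sigma_finite "\<lambda>_::nat. lborel :: real measure" by standard
  show ?thesis unfolding lebd_def by (rule sigma_finite) simp
qed

text \<open>Integrating over coordinate i first reduces this to the affine substitution on the real
  line. The shift may depend on the other coordinates, which covers shears.\<close>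

lemma nn_integral_lebd_coord:
  assumes i: "i < d" and g: "g \<in> borel_measurable (lebd d)" and a: "a \<in> borel_measurable (lebd d)"
    and indep: "\<And>x t. x \<in> Rd d \<Longrightarrow> a (x(i := t)) = a x" and c: "c \<noteq> (0::real)"
  shows "ennreal \<bar>c\<bar> * (\<integral>\<^sup>+x. g (x(i := a x + c * x i)) \<partial>lebd d) = (\<integral>\<^sup>+x. g x \<partial>lebd d)"
proof -
  interpret product_sigma_finite "\<lambda>_::nat. lborel :: real measure" by standard
  define I where "I = {..<d} - {i}"
  have I: "finite I" "i \<notin> I" "insert i I = {..<d}" using i by (auto simp: I_def)
  have T: "(\<lambda>x. x(i := a x + c * x i)) \<in> measurable (lebd d) (lebd d)"
  proof (rule measurable_lebdI)
    fix j assume j: "j < d"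
    show "(\<lambda>x. (x(i := a x + c * x i)) j) \<in> borel_measurable (lebd d)"
      using a i j by (cases "j = i") auto
  qed (use i in \<open>auto intro: upd_in_Rd\<close>)
  have gT: "(\<lambda>x. g (x(i := a x + c * x i))) \<in> borel_measurable (lebd d)"
    using measurable_compose[OF T g] .
  have inner: "ennreal \<bar>c\<bar> * (\<integral>\<^sup>+y. g ((x(i := y))(i := a (x(i := y)) + c * (x(i := y)) i)) \<partial>lborel)
      = (\<integral>\<^sup>+y. g (x(i := y)) \<partial>lborel)" if x: "x \<in> space (PiM I (\<lambda>_. lborel))" for x
  proof -
    have xi: "x(i := y) \<in> Rd d" for y
      using x I by (auto simp: space_PiM Rd_def PiE_def extensional_def I_def)
    have "a (x(i := y)) = a (x(i := 0))" for y
      using indep[OF xi[of 0], of y] by simp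
    then have eq: "(x(i := y))(i := a (x(i := y)) + c * (x(i := y)) i) = x(i := a (x(i := 0)) + c * y)" for y
      by (metis fun_upd_same fun_upd_upd)
    have "(\<lambda>y. x(i := y)) \<in> measurable lborel (lebd d)"
      using measurable_component_update[OF x I(2)] by (simp add: lebd_def I(3))
    from measurable_compose[OF this g] have "(\<lambda>y. g (x(i := y))) \<in> borel_measurable borel" by simp
    from nn_integral_real_affine[OF this c, of "a (x(i := 0))"] show ?thesis
      unfolding eq by simp
  qed
  have "(\<integral>\<^sup>+x. g x \<partial>lebd d) = (\<integral>\<^sup>+x. \<integral>\<^sup>+y. g (x(i := y)) \<partial>lborel \<partial>PiM I (\<lambda>_. lborel))"
    using product_nn_integral_insert[OF I(1,2), of g] g by (simp add: I(3) lebd_def)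
  also have "\<dots> = (\<integral>\<^sup>+x. ennreal \<bar>c\<bar> * (\<integral>\<^sup>+y. g ((x(i := y))(i := a (x(i := y)) + c * (x(i := y)) i)) \<partial>lborel) \<partial>PiM I (\<lambda>_. lborel))"
    by (intro nn_integral_cong) (simp add: inner[symmetric])
  also have "\<dots> = ennreal \<bar>c\<bar> * (\<integral>\<^sup>+x. \<integral>\<^sup>+y. g ((x(i := y))(i := a (x(i := y)) + c * (x(i := y)) i)) \<partial>lborel \<partial>PiM I (\<lambda>_. lborel))"
  proof (rule nn_integral_cmult)
    have "(\<lambda>(x, y). x(i := y)) \<in> measurable (PiM I (\<lambda>_. lborel) \<Otimes>\<^sub>M lborel) (lebd d)"
      using measurable_add_dim[of i I "\<lambda>_. lborel"] by (simp add: lebd_def I(3))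
    from measurable_compose[OF this gT]
    have "(\<lambda>(x, y). g ((x(i := y))(i := a (x(i := y)) + c * (x(i := y)) i))) \<in> borel_measurable (PiM I (\<lambda>_. lborel) \<Otimes>\<^sub>M lborel)"
      by (simp add: split_def)
    then show "(\<lambda>x. \<integral>\<^sup>+y. g ((x(i := y))(i := a (x(i := y)) + c * (x(i := y)) i)) \<partial>lborel) \<in> borel_measurable (PiM I (\<lambda>_. lborel))"
      by (rule lborel.borel_measurable_nn_integral)
  qed
  also have "(\<integral>\<^sup>+x. \<integral>\<^sup>+y. g ((x(i := y))(i := a (x(i := y)) + c * (x(i := y)) i)) \<partial>lborel \<partial>PiM I (\<lambda>_. lborel))
     = (\<integral>\<^sup>+x. g (x(i := a x + c * x i)) \<partial>lebd d)"
    using product_nn_integral_insert[OF I(1,2), of "\<lambda>x. g (x(i := a x + c * x i))"] gT by (simp add: I(3) lebd_def)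
  finally show ?thesis by simp
qed

text \<open>As no shift depends on a coordinate in J, changing the coordinates one after another is
  the same as changing them simultaneously.\<close>

lemma nn_integral_lebd_coords:
  assumes "finite J" "J \<subseteq> {..<d}" and g: "g \<in> borel_measurable (lebd d)"
    and "\<And>i. i \<in> J \<Longrightarrow> a i \<in> borel_measurable (lebd d)"
    and "\<And>i l x t. i \<in> J \<Longrightarrow> l \<in> J \<Longrightarrow> x \<in> Rd d \<Longrightarrow> a i (x(l := t)) = a i x" and c: "c \<noteq> (0::real)"
  shows "ennreal (\<bar>c\<bar> ^ card J) * (\<integral>\<^sup>+x. g (\<lambda>i. if i \<in> J then a i x + c * x i else x i) \<partial>lebd d) = (\<integral>\<^sup>+x. g x \<partial>lebd d)"
  using assms(1,2,4,5)
proof (induction J)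
  case (insert l J)
  define g' where "g' x = g (\<lambda>i. if i \<in> J then a i x + c * x i else x i)" for x
  have "(\<lambda>x i. if i \<in> J then a i x + c * x i else x i) \<in> measurable (lebd d) (lebd d)"
  proof (rule measurable_lebdI)
    fix i assume "i < d"
    then show "(\<lambda>x. if i \<in> J then a i x + c * x i else x i) \<in> borel_measurable (lebd d)"
      using insert.prems(2)[of i] by (cases "i \<in> J") auto
  next
    fix x assume "x \<in> space (lebd d)"
    then show "(\<lambda>i. if i \<in> J then a i x + c * x i else x i) \<in> Rd d"
      using insert.prems(1) by (auto simp: Rd_def PiE_def extensional_def)
  qed
  from measurable_compose[OF this g] have g': "g' \<in> borel_measurable (lebd d)" unfolding g'_def .
  have "(\<integral>\<^sup>+x. g (\<lambda>i. if i \<in> insert l J then a i x + c * x i else x i) \<partial>lebd d)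
     = (\<integral>\<^sup>+x. g' (x(l := a l x + c * x l)) \<partial>lebd d)"
  proof (rule nn_integral_cong)
    fix x assume x: "x \<in> space (lebd d)"
    define y where "y = x(l := a l x + c * x l)"
    have "a i y = a i x" if "i \<in> J" for i
      unfolding y_def by (rule insert.prems(3)) (use that x in auto)
    moreover have "y l = a l x + c * x l" "\<And>i. i \<noteq> l \<Longrightarrow> y i = x i" by (auto simp: y_def)
    ultimately have "(\<lambda>i. if i \<in> insert l J then a i x + c * x i else x i)
      = (\<lambda>i. if i \<in> J then a i y + c * y i else y i)"
      using insert.hyps(2) by (intro ext) auto
    then show "g (\<lambda>i. if i \<in> insert l J then a i x + c * x i else x i) = g' (x(l := a l x + c * x l))"
      unfolding g'_def y_def by simp
  qed
  then have "ennreal (\<bar>c\<bar> ^ card (insert l J)) * (\<integral>\<^sup>+x. g (\<lambda>i. if i \<in> insert l J then a i x + c * x i else x i) \<partial>lebd d)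
     = ennreal (\<bar>c\<bar> ^ card J) * (ennreal \<bar>c\<bar> * (\<integral>\<^sup>+x. g' (x(l := a l x + c * x l)) \<partial>lebd d))"
    using insert.hyps by (simp add: ennreal_mult mult_ac)
  also have "ennreal \<bar>c\<bar> * (\<integral>\<^sup>+x. g' (x(l := a l x + c * x l)) \<partial>lebd d) = (\<integral>\<^sup>+x. g' x \<partial>lebd d)"
  proof (rule nn_integral_lebd_coord[OF _ g' _ _ c])
    show "l < d" using insert.prems(1) by simp
    show "a l \<in> borel_measurable (lebd d)" by (rule insert.prems(2)) simp
    show "a l (x(l := t)) = a l x" if "x \<in> Rd d" for x t by (rule insert.prems(3)) (use that in auto)
  qed
  also have "ennreal (\<bar>c\<bar> ^ card J) * (\<integral>\<^sup>+x. g' x \<partial>lebd d) = (\<integral>\<^sup>+x. g x \<partial>lebd d)"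
    unfolding g'_def using insert.IH insert.prems by auto
  finally show ?case .
qed simp

text \<open>Here the variable of integration x is the direction of the line and its parameter c is
  fixed: the substitution is x to b + c x.\<close>

lemma nn_integral_lebd_affine:
  assumes g: "g \<in> borel_measurable (lebd d)" and c: "c \<noteq> (0::real)"
  shows "ennreal (\<bar>c\<bar> ^ d) * (\<integral>\<^sup>+x. g (line d b x c) \<partial>lebd d) = (\<integral>\<^sup>+x. g x \<partial>lebd d)"
proof -
  have "(\<integral>\<^sup>+x. g (line d b x c) \<partial>lebd d) = (\<integral>\<^sup>+x. g (\<lambda>i. if i \<in> {..<d} then b i + c * x i else x i) \<partial>lebd d)"
  proof (intro nn_integral_cong arg_cong[where f = g])
    fix x assume "x \<in> space (lebd d)"
    then show "line d b x c = (\<lambda>i. if i \<in> {..<d} then b i + c * x i else x i)"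
      by (auto simp: line_def fun_eq_iff Rd_undefined)
  qed
  then show ?thesis using nn_integral_lebd_coords[of "{..<d}" d g "\<lambda>i _. b i" c] g c by simp
qed

subsection \<open>Reflections\<close>

definition dotd :: "nat \<Rightarrow> (nat \<Rightarrow> real) \<Rightarrow> (nat \<Rightarrow> real) \<Rightarrow> real" where
  "dotd d x y = (\<Sum>i<d. x i * y i)"

lemma norm2_dotd: "norm2 d x = sqrt (dotd d x x)"
  by (simp add: norm2_def dotd_def power2_eq_square)

definition refl_at :: "nat \<Rightarrow> (nat \<Rightarrow> real) \<Rightarrow> (nat \<Rightarrow> real) \<Rightarrow> nat \<Rightarrow> real" where
  "refl_at d v x = restrict (\<lambda>i. x i - 2 * dotd d x v / dotd d v v * v i) {..<d}"

lemma refl_in_Rd [simp]: "refl_at d v x \<in> Rd d"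
  by (simp add: refl_at_def)

lemma refl_nth: "i < d \<Longrightarrow> refl_at d v x i = x i - 2 * dotd d x v / dotd d v v * v i"
  by (simp add: refl_at_def)

lemma dotd_lin: 
  "(\<And>i. i < d \<Longrightarrow> z i = x i - c * y i) \<Longrightarrow> dotd d z w = dotd d x w - c * dotd d y w"
  by (simp add: dotd_def left_diff_distrib sum_subtractf sum_distrib_left mult.assoc)

lemma dotd_commute: "dotd d x y = dotd d y x"
  by (simp add: dotd_def mult.commute)

lemma refl_isometry:
  assumes v: "dotd d v v \<noteq> 0"
  shows "norm2 d (\<lambda>i. refl_at d v x i - refl_at d v y i) = norm2 d (\<lambda>i. x i - y i)"
proof -
  define u where "u i = x i - y i" for i
  define w where "w i = refl_at d v x i - refl_at d v y i" for i
  define n where "n = dotd d v v"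
  have "dotd d u v = dotd d x v - dotd d y v" using dotd_lin[of d u x 1 y v] by (simp add: u_def)
  then have w: "w i = u i - (2 * dotd d u v / n) * v i" if "i < d" for i
    using that unfolding w_def n_def by (simp add: refl_nth u_def[of i] diff_divide_distrib left_diff_distrib right_diff_distrib)
  have L: "dotd d w z = dotd d u z - (2 * dotd d u v / n) * dotd d v z" for z by (rule dotd_lin[OF w])
  have "dotd d w w = dotd d u w - (2 * dotd d u v / n) * dotd d v w" by (rule L)
  moreover have "dotd d u w = dotd d u u - (2 * dotd d u v / n) * dotd d u v"
    using L[of u] by (simp add: dotd_commute[of d w u] dotd_commute[of d v u])
  moreover have "dotd d v w = dotd d u v - (2 * dotd d u v / n) * n"
    using L[of v] by (simp add: dotd_commute[of d w v] n_def)
  ultimately have "dotd d w w = dotd d u u" using v by (simp add: n_def field_simps)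
  then show ?thesis unfolding norm2_dotd u_def w_def by simp
qed

lemma refl_norm:
  assumes v: "dotd d v v \<noteq> 0"
  shows "norm2 d (refl_at d v x) = norm2 d x"
proof -
  have "dotd d (zerod d) v = 0" by (simp add: dotd_def)
  then have z: "refl_at d v (zerod d) i = 0" if "i < d" for i using that by (simp add: refl_nth)
  have "norm2 d (\<lambda>i. refl_at d v x i - refl_at d v (zerod d) i) = norm2 d (\<lambda>i. x i - zerod d i)"
    by (rule refl_isometry[OF v])
  moreover have "norm2 d (\<lambda>i. refl_at d v x i - refl_at d v (zerod d) i) = norm2 d (refl_at d v x)"
    by (rule norm2_cong) (simp add: z)
  moreover have "norm2 d (\<lambda>i. x i - zerod d i) = norm2 d x" by (rule norm2_cong) simp
  ultimately show ?thesis by simp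
qed

lemma refl_refl:
  assumes v: "dotd d v v \<noteq> 0" and x: "x \<in> Rd d"
  shows "refl_at d v (refl_at d v x) = x"
proof (rule Rd_eqI[OF _ x])
  fix i assume i: "i < d"
  have "dotd d (refl_at d v x) v = dotd d x v - (2 * dotd d x v / dotd d v v) * dotd d v v"
    by (rule dotd_lin) (simp add: refl_nth)
  also have "\<dots> = - dotd d x v" using v by simp
  finally show "refl_at d v (refl_at d v x) i = x i" using i by (simp add: refl_nth)
qed simp

lemma refl_ray:
  "refl_at d v (ray d x s) = ray d (refl_at d v x) s"
proof (rule Rd_eqI[of _ d])
  fix i assume i: "i < d"
  have "dotd d (ray d x s) v = s * dotd d x v" by (simp add: dotd_def sum_distrib_left mult.assoc)
  then show "refl_at d v (ray d x s) i = ray d (refl_at d v x) s i"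
    using i by (simp add: refl_nth algebra_simps)
qed auto

text \<open>The reflection in the bisecting hyperplane. Such reflections move any point of a sphere
  to any other, and this is the form in which rotation invariance is used.\<close>

lemma refl_swap:
  assumes y: "y \<in> Rd d" and z: "z \<in> Rd d" and eq: "norm2 d y = norm2 d z" and ne: "y \<noteq> z"
  defines "v \<equiv> (\<lambda>i. y i - z i)"
  shows "dotd d v v \<noteq> 0" "refl_at d v y = z"
proof -
  obtain j where j: "j < d" "y j \<noteq> z j" using ne Rd_eqI[OF y z] by blast
  have "0 < v j * v j" using j by (auto simp: v_def zero_less_mult_iff)
  also have "\<dots> \<le> dotd d v v" unfolding dotd_def by (rule member_le_sum) (use j in auto)
  finally show n: "dotd d v v \<noteq> 0" by simp
  have yz: "dotd d y y = dotd d z z" using eq by (simp add: norm2_dotd)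
  have e1: "dotd d v w = dotd d y w - dotd d z w" for w
    using dotd_lin[of d v y 1 z w] by (simp add: v_def)
  have "dotd d v v = 2 * dotd d y v"
    using e1[of v] e1[of y] e1[of z] yz dotd_commute[of d y v] dotd_commute[of d z v] dotd_commute[of d y z] by linarith
  then have "2 * dotd d y v / dotd d v v = 1" using n by simp
  then show "refl_at d v y = z"
    by (intro Rd_eqI[OF _ z]) (auto simp: refl_nth v_def)
qed

text \<open>A reflection is conjugate, by a shear, to an affine change of a single coordinate.\<close>

lemma nn_integral_lebd_refl:
  assumes v: "dotd d v v \<noteq> 0" and g: "g \<in> borel_measurable (lebd d)"
  shows "(\<integral>\<^sup>+x. g (refl_at d v x) \<partial>lebd d) = (\<integral>\<^sup>+x. g x \<partial>lebd d)"
proof -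
  obtain j where j: "j < d" "v j \<noteq> 0"
    using v unfolding dotd_def by (force intro: ccontr)
  define n where "n = dotd d v v"
  define J where "J = {..<d} - {j}"
  have n_split: "n = v j * v j + (\<Sum>i\<in>J. v i * v i)"
    unfolding n_def dotd_def J_def by (rule sum.remove) (use j in auto)
  \<comment> \<open>\<open>Q (-1)\<close> maps v to a multiple of the j-th unit vector and
    \<open>Q 1\<close> undoes this; both are shears and preserve volume.\<close>
  define Q where "Q e x = (\<lambda>i. if i \<in> J then (e * v i / v j) * x j + 1 * x i else x i)" for e :: real and x :: "nat \<Rightarrow> real"
  \<comment> \<open>The reflection changes coordinate j to x j - 2 <x, v> v j / n. In the sheared
    coordinates this equals - x j plus the following combination of the other coordinates.\<close>
  define A where "A x = - (2 * v j / n) * (\<Sum>i\<in>J. x i * v i)" for x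
  define D where "D x = x(j := A x + (-1) * x j)" for x
  have jJ: "j \<notin> J" by (simp add: J_def)
  have QR: "Q e x \<in> Rd d" if "x \<in> Rd d" for e x
    using that unfolding Q_def J_def Rd_def PiE_def extensional_def by auto
  have Qm: "Q e \<in> measurable (lebd d) (lebd d)" for e
  proof (rule measurable_lebdI)
    fix i assume "i < d"
    then show "(\<lambda>x. Q e x i) \<in> borel_measurable (lebd d)" using j unfolding Q_def by (cases "i \<in> J") auto
  qed (use QR in auto)
  have Am: "A \<in> borel_measurable (lebd d)"
    unfolding A_def[abs_def] J_def by (intro borel_measurable_times borel_measurable_const borel_measurable_sum) auto
  have Dm: "D \<in> measurable (lebd d) (lebd d)"
  proof (rule measurable_lebdI)
    fix i assume "i < d"
    then show "(\<lambda>x. D x i) \<in> borel_measurable (lebd d)" using j Am unfolding D_def by (cases "i = j") auto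
  qed (use j in \<open>auto simp: D_def intro: upd_in_Rd\<close>)
  have shear: "(\<integral>\<^sup>+x. h (Q e x) \<partial>lebd d) = (\<integral>\<^sup>+x. h x \<partial>lebd d)" if "h \<in> borel_measurable (lebd d)" for h e
    using nn_integral_lebd_coords[of J d h "\<lambda>i x. (e * v i / v j) * x j" 1] that jJ j
    by (auto simp: Q_def J_def)
  have single: "(\<integral>\<^sup>+x. h (D x) \<partial>lebd d) = (\<integral>\<^sup>+x. h x \<partial>lebd d)" if "h \<in> borel_measurable (lebd d)" for h
  proof -
    have "A (x(j := t)) = A x" for x t unfolding A_def using jJ by (auto intro!: arg_cong2[where f = "(*)"] sum.cong)
    then show ?thesis
      using nn_integral_lebd_coord[OF j(1) that Am, of "-1"] unfolding D_def by simp
  qed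
  have eq: "refl_at d v x = Q 1 (D (Q (-1) x))" if x: "x \<in> Rd d" for x
  proof (rule Rd_eqI[of _ d])
    show "Q 1 (D (Q (-1) x)) \<in> Rd d" unfolding D_def using x j by (intro QR upd_in_Rd) auto
    define S where "S = (\<Sum>i\<in>J. x i * v i)"
    have dx: "dotd d x v = x j * v j + S" unfolding dotd_def J_def S_def by (rule sum.remove) (use j in auto)
    have y: "Q (-1) x i = x i - v i / v j * x j" if "i \<in> J" for i using that by (simp add: Q_def)
    have yj: "Q (-1) x j = x j" using jJ by (simp add: Q_def)
    have "(\<Sum>i\<in>J. Q (-1) x i * v i) = S - x j / v j * (n - v j * v j)"
      by (simp add: y n_split S_def sum_subtractf sum_distrib_left algebra_simps)
    then have "A (Q (-1) x) = - (2 * v j / n) * (S - x j / v j * (n - v j * v j))" by (simp add: A_def)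
    also have "\<dots> = 2 * x j - 2 * (x j * v j + S) / n * v j"
      using j v unfolding n_def[symmetric] by (simp add: field_simps)
    finally have Dj: "D (Q (-1) x) j = x j - 2 * dotd d x v / n * v j"
      by (simp add: D_def yj dx)
    fix i assume i: "i < d"
    show "refl_at d v x i = Q 1 (D (Q (-1) x)) i"
    proof (cases "i = j")
      case True
      then show ?thesis using Dj jJ i by (simp add: Q_def[of 1] refl_nth n_def)
    next
      case False
      then have iJ: "i \<in> J" using i by (simp add: J_def)
      have "Q 1 (D (Q (-1) x)) i = v i / v j * (x j - 2 * dotd d x v / n * v j) + (x i - v i / v j * x j)"
        using iJ False Dj y[OF iJ] by (simp add: Q_def[of 1]) (simp add: D_def)
      also have "\<dots> = x i - 2 * dotd d x v / n * v i" using j by (simp add: field_simps)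
      finally show ?thesis using i by (simp add: refl_nth n_def)
    qed
  qed simp
  have "(\<integral>\<^sup>+x. g (refl_at d v x) \<partial>lebd d) = (\<integral>\<^sup>+x. g (Q 1 (D (Q (-1) x))) \<partial>lebd d)"
    by (intro nn_integral_cong) (simp add: eq)
  also have "\<dots> = (\<integral>\<^sup>+x. g (Q 1 (D x)) \<partial>lebd d)"
    by (rule shear[of "\<lambda>x. g (Q 1 (D x))"]) (intro measurable_compose[OF Dm] measurable_compose[OF Qm] g)
  also have "\<dots> = (\<integral>\<^sup>+x. g (Q 1 x) \<partial>lebd d)"
    by (rule single[of "\<lambda>x. g (Q 1 x)"]) (intro measurable_compose[OF Qm] g)
  also have "\<dots> = (\<integral>\<^sup>+x. g x \<partial>lebd d)" by (rule shear[OF g])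
  finally show ?thesis .
qed

subsection \<open>Balls of unit volume\<close>

lemma emeasure_cballd_scale:
  assumes t: "t > 0"
  shows "emeasure (lebd d) (cballd d (t * R)) = ennreal (t ^ d) * emeasure (lebd d) (cballd d R)"
proof -
  have "emeasure (lebd d) (cballd d (t * R)) = (\<integral>\<^sup>+x. indicator (cballd d (t * R)) x \<partial>lebd d)"
    by simp
  also have "\<dots> = ennreal (\<bar>t\<bar> ^ d) * (\<integral>\<^sup>+x. indicator (cballd d (t * R)) (ray d x t) \<partial>lebd d)"
    by (rule nn_integral_lebd_affine[symmetric]) (use t in auto)
  also have "(\<integral>\<^sup>+x. indicator (cballd d (t * R)) (ray d x t) \<partial>lebd d) = (\<integral>\<^sup>+x. indicator (cballd d R) x \<partial>lebd d)"
    using t by (intro nn_integral_cong) (auto simp: indicator_def cballd_def norm2_ray)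
  finally show ?thesis using t by simp
qed

text \<open>For t < 1 the open ball contains the closed ball of radius t R, which has volume t^d; so
  the open ball already has volume one.\<close>

lemma emeasure_sphere_0:
  assumes d: "d \<ge> 1" and R: "R > 0" and one: "emeasure (lebd d) (cballd d R) = 1"
  shows "emeasure (lebd d) (sphered d R) = 0"
proof -
  have sub: "oballd d R \<subseteq> cballd d R" by (auto simp: oballd_def cballd_def)
  have fin: "emeasure (lebd d) (oballd d R) \<le> 1"
    using emeasure_mono[OF sub, of "lebd d"] one by simp
  have t1: "ennreal (t ^ d) \<le> emeasure (lebd d) (oballd d R)" if t: "0 < t" "t < 1" for t
  proof -
    have "t * R < 1 * R" using t R by (intro mult_strict_right_mono) auto
    then have "cballd d (t * R) \<subseteq> oballd d R"
      by (auto simp: cballd_def oballd_def)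
    then have "emeasure (lebd d) (cballd d (t * R)) \<le> emeasure (lebd d) (oballd d R)" by (rule emeasure_mono) simp
    then show ?thesis using emeasure_cballd_scale[OF t(1), of d R] one by simp
  qed
  have "((\<lambda>t. ennreal (t ^ d)) \<longlongrightarrow> ennreal (1 ^ d)) (at_left (1::real))"
    by (intro tendsto_intros tendsto_ennrealI)
  then have "ennreal (1 ^ d) \<le> emeasure (lebd d) (oballd d R)"
  proof (rule tendsto_upperbound)
    show "\<forall>\<^sub>F t in at_left 1. ennreal (t ^ d) \<le> emeasure (lebd d) (oballd d R)"
      using eventually_at_left_real[of 0 "1::real"] by (auto elim!: eventually_mono intro: t1)
  qed simp
  then have o1: "emeasure (lebd d) (oballd d R) = 1" using fin by (intro antisym) simp_all
  have "sphered d R = cballd d R - oballd d R" by (auto simp: sphered_def cballd_def oballd_def)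
  then show ?thesis using emeasure_Diff[of "lebd d" "oballd d R" "cballd d R"] sub one o1 by simp
qed

text \<open>The ball contains the cube of half-side R / sqrt d, whose volume is therefore at most
  one. Growth like sqrt d keeps k ln (d + 1) of smaller order than d.\<close>

lemma unit_ball_radius_le:
  assumes d: "d \<ge> 1" and R: "R > 0" and one: "emeasure (lebd d) (cballd d R) = 1"
  shows "R \<le> sqrt d / 2"
proof -
  define a where "a = R / sqrt d"
  have a: "a > 0" using R d by (simp add: a_def)
  have "PiE {..<d} (\<lambda>i. {- a..a}) \<subseteq> cballd d R"
  proof
    fix x assume x: "x \<in> PiE {..<d} (\<lambda>i. {- a..a})"
    have "(\<Sum>i<d. (x i)\<^sup>2) \<le> (\<Sum>i<d. a\<^sup>2)"
    proof (rule sum_mono)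
      fix i assume "i \<in> {..<d}"
      then have "\<bar>x i\<bar> \<le> \<bar>a\<bar>" using x a by (auto simp: PiE_def Pi_def)
      then show "(x i)\<^sup>2 \<le> a\<^sup>2" by (simp add: abs_le_square_iff)
    qed
    also have "\<dots> = R\<^sup>2" using d by (simp add: a_def power_divide)
    finally have "norm2 d x \<le> R" unfolding norm2_def using R by (intro real_le_lsqrt) auto
    moreover have "x \<in> Rd d" using x by (auto simp: Rd_def PiE_def)
    ultimately show "x \<in> cballd d R" by (simp add: cballd_def)
  qed
  then have "emeasure (lebd d) (PiE {..<d} (\<lambda>i. {- a..a})) \<le> 1"
    using one emeasure_mono[of _ "cballd d R" "lebd d"] by fastforce
  then have "(2 * a) ^ d \<le> 1"
    using a emeasure_lebd_box[of d "\<lambda>_. - a" "\<lambda>_. a"] by (simp flip: ennreal_1)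
  then have "2 * a \<le> 1" using d a power_le_one_iff[of "2 * a" d] by simp
  then show ?thesis using d by (simp add: a_def field_simps)
qed

subsection \<open>Averages over spheres and over directions\<close>

lemma norm2_zero_iff: "x \<in> Rd d \<Longrightarrow> norm2 d x = 0 \<longleftrightarrow> x = zerod d"
proof
  assume x: "x \<in> Rd d" and "norm2 d x = 0"
  then have "\<forall>i\<in>{..<d}. x i = 0" by (simp add: norm2_L2 L2_set_eq_0_iff)
  then show "x = zerod d" using x by (intro Rd_eqI) auto
qed (simp add: norm2_def)

text \<open>The origin is removed because it has no normal direction.\<close>

definition pball :: "nat \<Rightarrow> real \<Rightarrow> (nat \<Rightarrow> real) set" where
  "pball d R = oballd d R - {zerod d}"

lemma pball_iff: "x \<in> pball d R \<longleftrightarrow> x \<in> Rd d \<and> 0 < norm2 d x \<and> norm2 d x < R"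
  unfolding pball_def oballd_def using norm2_zero_iff[of x d] norm2_nonneg[of d x]
  by (cases "norm2 d x = 0") (auto simp del: norm2_nonneg)

lemma pball_sets [measurable]: "pball d R \<in> sets (lebd d)"
proof -
  have "{x \<in> space (lebd d). 0 < norm2 d x \<and> norm2 d x < R} \<in> sets (lebd d)" by measurable
  moreover have "{x \<in> space (lebd d). 0 < norm2 d x \<and> norm2 d x < R} = pball d R" by (auto simp: pball_iff)
  ultimately show ?thesis by simp
qed

section \<open>Radial projection and spherical caps\<close>

definition sproj :: "nat \<Rightarrow> real \<Rightarrow> (nat \<Rightarrow> real) \<Rightarrow> nat \<Rightarrow> real" where
  "sproj d s x = ray d x (s / norm2 d x)"

lemma sproj_in_sphere: "x \<in> pball d R \<Longrightarrow> s \<ge> 0 \<Longrightarrow> sproj d s x \<in> sphered d s"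
  by (auto simp: sproj_def sphered_def norm2_ray pball_iff)

lemma sproj_measurable: "(\<lambda>(s, x). sproj d s x) \<in> measurable (borel \<Otimes>\<^sub>M lebd d) (lebd d)"
proof (rule measurable_lebdI)
  fix i assume i: "i < d"
  have "(\<lambda>p. fst p / norm2 d (snd p) * snd p i) \<in> borel_measurable (borel \<Otimes>\<^sub>M lebd d)"
    using measurable_compose[OF measurable_snd coord_measurable[OF i]] by measurable
  then show "(\<lambda>p. (case p of (s, x) \<Rightarrow> sproj d s x) i) \<in> borel_measurable (borel \<Otimes>\<^sub>M lebd d)"
    using i by (simp add: sproj_def split_def)
qed (auto simp: sproj_def split: prod.split)

lemma sproj_measurable1 [measurable]: "sproj d s \<in> measurable (lebd d) (lebd d)"
proof -
  have "(\<lambda>x. (s, x)) \<in> measurable (lebd d) (borel \<Otimes>\<^sub>M lebd d)" by measurable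
  from measurable_compose[OF this sproj_measurable] show ?thesis by simp
qed

definition scap :: "nat \<Rightarrow> real \<Rightarrow> real \<Rightarrow> (nat \<Rightarrow> real) \<Rightarrow> (nat \<Rightarrow> real) set" where
  "scap d s \<tau> y = {w \<in> sphered d s. norm2 d (\<lambda>i. w i - y i) < \<tau>}"

lemma norm2_minus_commute: "norm2 d (\<lambda>i. x i - y i) = norm2 d (\<lambda>i. y i - x i)"
  using norm2_scale[of d "\<lambda>i. x i - y i" "-1" "\<lambda>i. y i - x i"] by simp

lemma norm2_diff_measurable:
  assumes "f \<in> measurable N (lebd d)" "g \<in> measurable N (lebd d)"
  shows "(\<lambda>p. norm2 d (\<lambda>i. f p i - g p i)) \<in> borel_measurable N"
proof -
  have "(\<lambda>p. \<Sum>i<d. (f p i - g p i)\<^sup>2) \<in> borel_measurable N"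
    using measurable_compose[OF assms(1) coord_measurable] measurable_compose[OF assms(2) coord_measurable]
    by (intro borel_measurable_sum borel_measurable_power borel_measurable_diff) auto
  then show ?thesis unfolding norm2_def by measurable
qed

lemma scap_sets [measurable]: "y \<in> Rd d \<Longrightarrow> scap d s \<tau> y \<in> sets (lebd d)"
proof -
  assume y: "y \<in> Rd d"
  have [measurable]: "(\<lambda>w. norm2 d (\<lambda>i. w i - y i)) \<in> borel_measurable (lebd d)"
    by (rule norm2_diff_measurable) (use y in auto)
  have "{w \<in> space (lebd d). norm2 d w = s \<and> norm2 d (\<lambda>i. w i - y i) < \<tau>} \<in> sets (lebd d)"
    by measurable
  moreover have "{w \<in> space (lebd d). norm2 d w = s \<and> norm2 d (\<lambda>i. w i - y i) < \<tau>} = scap d s \<tau> y"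
    by (auto simp: scap_def sphered_def)
  ultimately show ?thesis by simp
qed

text \<open>The reflection that exchanges the centres maps one cap to the other, and isometries do
  not increase the outer measure. Exchanging y and z gives equality.\<close>

lemma haus_outer_scap_le:
  assumes y: "y \<in> sphered d s" and z: "z \<in> sphered d s"
  shows "haus_outer d m (scap d s \<tau> z) \<le> haus_outer d m (scap d s \<tau> y)"
proof (cases "y = z")
  case False
  have R: "y \<in> Rd d" "z \<in> Rd d" "norm2 d y = norm2 d z" using y z by (auto simp: sphered_def)
  define v where "v = (\<lambda>i. y i - z i)"
  have v: "dotd d v v \<noteq> 0" and yz: "refl_at d v y = z"
    using refl_swap[OF R False] unfolding v_def by auto
  have zy: "refl_at d v z = y" using refl_refl[OF v R(1)] yz by simp
  have "scap d s \<tau> z \<subseteq> refl_at d v ` scap d s \<tau> y"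
  proof
    fix w assume w: "w \<in> scap d s \<tau> z"
    then have wR: "w \<in> Rd d" by (auto simp: scap_def sphered_def)
    have "norm2 d (\<lambda>i. refl_at d v w i - y i) = norm2 d (\<lambda>i. w i - z i)"
      using refl_isometry[OF v, of w z] by (simp add: zy)
    then have "refl_at d v w \<in> scap d s \<tau> y"
      using w by (auto simp: scap_def sphered_def refl_norm[OF v])
    then show "w \<in> refl_at d v ` scap d s \<tau> y" using refl_refl[OF v wR] by (metis imageI)
  qed
  then have "haus_outer d m (scap d s \<tau> z) \<le> haus_outer d m (refl_at d v ` scap d s \<tau> y)" by (rule haus_outer_mono)
  also have "\<dots> \<le> haus_outer d m (scap d s \<tau> y)"
    by (rule haus_outer_image_le) (simp add: refl_isometry[OF v])
  finally show ?thesis .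
qed simp

lemma haus_outer_finite_UN:
  "finite P \<Longrightarrow> haus_outer d s (\<Union>p\<in>P. A p) \<le> (\<Sum>p\<in>P. haus_outer d s (A p))"
proof (induction P rule: finite_induct)
  case (insert p P)
  have "haus_outer d s (\<Union>q\<in>insert p P. A q) \<le> haus_outer d s (A p) + haus_outer d s (\<Union>q\<in>P. A q)"
    using haus_outer_Un[of d s "A p" "\<Union>q\<in>P. A q"] by simp
  also have "\<dots> \<le> haus_outer d s (A p) + (\<Sum>q\<in>P. haus_outer d s (A q))"
    by (rule add_left_mono[OF insert.IH])
  finally show ?case using insert.hyps by simp
qed simp

text \<open>The sphere is covered by finitely many cells so small that the part of the sphere in a
  cell lies in a cap around any of its points. If one cap were null, all caps of this radius would
  be, and hence the sphere.\<close>

lemma haus_outer_scap_pos: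
  assumes d: "d \<ge> 1" and s: "s > 0" and \<tau>: "\<tau> > 0" and y: "y \<in> sphered d s"
  shows "haus_outer d (d - 1) (scap d s \<tau> y) > 0"
proof (rule ccontr)
  assume "\<not> ?thesis"
  then have "haus_outer d (d - 1) (scap d s \<tau> y) = 0" by (simp add: not_gr_zero)
  then have zero: "haus_outer d (d - 1) (scap d s \<tau> z) = 0" if "z \<in> sphered d s" for z
    using haus_outer_scap_le[OF y that, of "d - 1" \<tau>] by simp
  define c where "c = 2 * real d ^ 3 * s"
  obtain N :: nat where N: "real N > c / \<tau>" using reals_Archimedean2 by blast
  have "c / \<tau> > 0" using d s \<tau> by (simp add: c_def)
  then have N0: "N > 0" using N by (auto intro!: gr0I)
  have cN: "c / N < \<tau>" using N N0 \<tau> by (simp add: pos_divide_less_eq mult.commute)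
  obtain P :: "(nat \<times> bool \<times> (nat \<Rightarrow> nat)) set" and C where P: "finite P"
    "sphered d s \<subseteq> (\<Union>p\<in>P. C p)" "\<And>p x y. p \<in> P \<Longrightarrow> x \<in> C p \<Longrightarrow> y \<in> C p \<Longrightarrow> norm2 d (\<lambda>i. x i - y i) \<le> c / N"
    using sphere_cover[OF d s N0] unfolding c_def by blast
  have "haus_outer d (d - 1) (C p \<inter> sphered d s) = 0" if p: "p \<in> P" for p
  proof (cases "C p \<inter> sphered d s = {}")
    case False
    then obtain z where z: "z \<in> C p" "z \<in> sphered d s" by auto
    have "C p \<inter> sphered d s \<subseteq> scap d s \<tau> z"
      using P(3)[OF p _ z(1)] cN by (auto simp: scap_def intro: le_less_trans)
    then show ?thesis using haus_outer_mono[of "C p \<inter> sphered d s" "scap d s \<tau> z" d "d - 1"] zero[OF z(2)] by simp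
  qed simp
  then have "haus_outer d (d - 1) (\<Union>p\<in>P. C p \<inter> sphered d s) \<le> 0"
    using haus_outer_finite_UN[OF P(1), of d "d - 1" "\<lambda>p. C p \<inter> sphered d s"] by simp
  moreover have "sphered d s \<subseteq> (\<Union>p\<in>P. C p \<inter> sphered d s)" using P(2) by blast
  ultimately have "haus_outer d (d - 1) (sphered d s) \<le> 0" using haus_outer_mono order_trans by blast
  then show False using haus_outer_sphere_pos[OF d s] by simp
qed

lemma refl_sproj: "dotd d v v \<noteq> 0 \<Longrightarrow> refl_at d v (sproj d s x) = sproj d s (refl_at d v x)"
  by (simp add: sproj_def refl_ray refl_norm)

text \<open>Lebesgue measure on the ball is invariant under the reflection that exchanges y and z,
  and radial projection commutes with it.\<close>

lemma nn_integral_direction_cap: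
  assumes y: "y \<in> sphered d s" and z: "z \<in> sphered d s"
  shows "(\<integral>\<^sup>+x. indicator {x \<in> pball d R. norm2 d (\<lambda>i. sproj d s x i - y i) < \<tau>} x \<partial>lebd d)
       = (\<integral>\<^sup>+x. indicator {x \<in> pball d R. norm2 d (\<lambda>i. sproj d s x i - z i) < \<tau>} x \<partial>lebd d)"
proof (cases "y = z")
  case False
  have R: "y \<in> Rd d" "z \<in> Rd d" "norm2 d y = norm2 d z" using y z by (auto simp: sphered_def)
  define v where "v = (\<lambda>i. y i - z i)"
  have v: "dotd d v v \<noteq> 0" and yz: "refl_at d v y = z"
    using refl_swap[OF R False] unfolding v_def by auto
  let ?A = "\<lambda>y. {x \<in> pball d R. norm2 d (\<lambda>i. sproj d s x i - y i) < \<tau>}"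
  have [measurable]: "(\<lambda>x. norm2 d (\<lambda>i. sproj d s x i - z i)) \<in> borel_measurable (lebd d)"
    by (rule norm2_diff_measurable) (use R in auto)
  have "{x \<in> space (lebd d). x \<in> pball d R \<and> norm2 d (\<lambda>i. sproj d s x i - z i) < \<tau>} \<in> sets (lebd d)" by measurable
  moreover have "{x \<in> space (lebd d). x \<in> pball d R \<and> norm2 d (\<lambda>i. sproj d s x i - z i) < \<tau>} = ?A z"
    by (auto simp: pball_iff)
  ultimately have "?A z \<in> sets (lebd d)" by simp
  then have "(\<integral>\<^sup>+x. indicator (?A z) x \<partial>lebd d) = (\<integral>\<^sup>+x. indicator (?A z) (refl_at d v x) \<partial>lebd d)"
    by (intro nn_integral_lebd_refl[symmetric] v) simp
  also have "\<dots> = (\<integral>\<^sup>+x. indicator (?A y) x \<partial>lebd d)"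
  proof (intro nn_integral_cong)
    fix x assume x: "x \<in> space (lebd d)"
    have "norm2 d (\<lambda>i. sproj d s (refl_at d v x) i - z i) = norm2 d (\<lambda>i. sproj d s x i - y i)"
      using refl_isometry[OF v, of "sproj d s x" y] by (simp add: yz refl_sproj[OF v])
    then show "indicator (?A z) (refl_at d v x) = (indicator (?A y) x :: ennreal)"
      using x by (auto simp: indicator_def pball_iff refl_norm[OF v])
  qed
  finally show ?thesis by simp
qed simp

text \<open>Two measures on the sphere that give equal mass to all caps of equal radius are proportional:
  average \<open>G\<close> over caps of radius tending to 0, exchange the two integrations, and apply Fatou's lemma.\<close>

lemma nn_integral_direction_le_sphere_avg:
  fixes G :: "(nat \<Rightarrow> real) \<Rightarrow> real"
  assumes d: "d \<ge> 1" and s: "s > 0"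
    and G: "continuous_on (sphered d s) G" "\<And>y. y \<in> sphered d s \<Longrightarrow> G y \<ge> 0"
  shows "(\<integral>\<^sup>+x\<in>pball d R. ennreal (G (sproj d s x)) \<partial>lebd d)
     \<le> emeasure (lebd d) (pball d R) * ((\<integral>\<^sup>+y\<in>sphered d s. ennreal (G y) \<partial>hausdorff d (d - 1))
          / emeasure (hausdorff d (d - 1)) (sphered d s))"
proof -
  let ?S = "sphered d s" and ?W = "pball d R" and ?H = "hausdorff d (d - 1)"
  \<comment> \<open>The Hausdorff measure on the whole space is not sigma-finite; restricted to the
    sphere it is finite, so that Fubini's theorem applies.\<close>
  define M where "M = density ?H (indicator ?S)"
  have sM [measurable_cong]: "sets M = sets (lebd d)" by (simp add: M_def)
  have spM: "space M = Rd d" by (simp add: M_def)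
  have HS: "emeasure ?H ?S = haus_outer d (d - 1) ?S" by (simp add: emeasure_hausdorff)
  have HS0: "emeasure ?H ?S > 0" and HSf: "emeasure ?H ?S < \<infinity>"
    unfolding HS using haus_outer_sphere_pos[OF d s] haus_outer_sphere_finite[OF d s] by auto
  have eM: "emeasure M A = emeasure ?H (?S \<inter> A)" if "A \<in> sets (lebd d)" for A
    using that unfolding M_def by (subst emeasure_density) (auto simp: indicator_inter_arith[symmetric])
  have intM: "(\<integral>\<^sup>+y. f y \<partial>M) = (\<integral>\<^sup>+y\<in>?S. f y \<partial>?H)" if "f \<in> borel_measurable (lebd d)" for f
  proof -
    have "(\<integral>\<^sup>+y. f y \<partial>M) = (\<integral>\<^sup>+y. indicator ?S y * f y \<partial>?H)"
      unfolding M_def by (rule nn_integral_density) (use that in auto)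
    then show ?thesis by (simp add: mult.commute)
  qed
  have MS: "emeasure M (space M) = emeasure ?H ?S"
    using eM[of "Rd d"] sets.top[of "lebd d"] by (simp add: spM Int_absorb2 sphered_def)
  interpret M: finite_measure M
    by (rule finite_measureI) (use HSf MS in auto)
  interpret L: sigma_finite_measure "lebd d" by (rule sigma_finite_lebd)
  interpret P: pair_sigma_finite "lebd d" M ..
  obtain y0 where y0: "y0 \<in> ?S"
    using HS0 by (metis emeasure_empty equals0I less_irrefl)
  have SR: "y \<in> Rd d" if "y \<in> ?S" for y using that by (simp add: sphered_def)
  \<comment> \<open>The kernel of the cap of radius \<tau>. Its mass does not depend on the centre:
    it is \<open>h \<tau>\<close> with respect to M and \<open>n \<tau>\<close> for the projected
    Lebesgue measure of the ball.\<close>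
  define k where "k \<tau> z y = (if norm2 d (\<lambda>i. z i - y i) < \<tau> then 1 else 0 :: ennreal)" for \<tau> :: real and z y
  define h where "h \<tau> = haus_outer d (d - 1) (scap d s \<tau> y0)" for \<tau>
  define n where "n \<tau> = (\<integral>\<^sup>+x. indicator {x \<in> ?W. norm2 d (\<lambda>i. sproj d s x i - y0 i) < \<tau>} x \<partial>lebd d)" for \<tau>
  define G' where "G' y = ennreal (indicator ?S y * G y)" for y
  have G'm [measurable]: "G' \<in> borel_measurable (lebd d)"
    unfolding G'_def using borel_measurable_cont_lebd[OF _ G(1), of d] by measurable
  have km: "(\<lambda>p. k \<tau> (sproj d s (fst p)) (snd p)) \<in> borel_measurable (lebd d \<Otimes>\<^sub>M M)" for \<tau>
  proof -
    have [measurable]: "(\<lambda>p. norm2 d (\<lambda>i. sproj d s (fst p) i - snd p i)) \<in> borel_measurable (lebd d \<Otimes>\<^sub>M M)"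
      by (rule norm2_diff_measurable) measurable
    show ?thesis unfolding k_def by measurable
  qed
  have km1: "(\<lambda>y. k \<tau> z y) \<in> borel_measurable (lebd d)" if "z \<in> Rd d" for \<tau> z
  proof -
    have [measurable]: "(\<lambda>y. norm2 d (\<lambda>i. z i - y i)) \<in> borel_measurable (lebd d)"
      by (rule norm2_diff_measurable) (use that in auto)
    show ?thesis unfolding k_def by measurable
  qed
  have h_eq: "(\<integral>\<^sup>+y. k \<tau> z y \<partial>M) = h \<tau>" if z: "z \<in> ?S" for \<tau> z
  proof -
    have "(\<integral>\<^sup>+y. k \<tau> z y \<partial>M) = (\<integral>\<^sup>+y. k \<tau> z y * indicator ?S y \<partial>?H)"
      by (rule intM[OF km1[OF SR[OF z]]])
    also have "\<dots> = (\<integral>\<^sup>+y. indicator (scap d s \<tau> z) y \<partial>?H)"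
      by (intro nn_integral_cong) (auto simp: k_def scap_def indicator_def norm2_minus_commute[of d z])
    also have "\<dots> = haus_outer d (d - 1) (scap d s \<tau> z)"
      using scap_sets[OF SR[OF z]] by (simp add: emeasure_hausdorff)
    also have "\<dots> = h \<tau>" unfolding h_def
      by (intro antisym haus_outer_scap_le y0 z)
    finally show ?thesis .
  qed
  have n_eq: "(\<integral>\<^sup>+x. k \<tau> (sproj d s x) y * indicator ?W x \<partial>lebd d) = n \<tau>" if y: "y \<in> ?S" for \<tau> y
  proof -
    have "(\<integral>\<^sup>+x. k \<tau> (sproj d s x) y * indicator ?W x \<partial>lebd d)
        = (\<integral>\<^sup>+x. indicator {x \<in> ?W. norm2 d (\<lambda>i. sproj d s x i - y i) < \<tau>} x \<partial>lebd d)"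
      by (intro nn_integral_cong) (auto simp: k_def indicator_def)
    also have "\<dots> = n \<tau>" unfolding n_def by (rule nn_integral_direction_cap[OF y y0])
    finally show ?thesis .
  qed
  have h0: "h \<tau> > 0" if "\<tau> > 0" for \<tau> unfolding h_def by (rule haus_outer_scap_pos[OF d s that y0])
  have hf: "h \<tau> < \<infinity>" for \<tau>
    using haus_outer_mono[of "scap d s \<tau> y0" ?S d "d - 1"] HSf unfolding h_def HS by (auto simp: scap_def intro: le_less_trans)
  have fubini: "(\<integral>\<^sup>+x\<in>?W. (\<integral>\<^sup>+y. k \<tau> (sproj d s x) y * F y \<partial>M) \<partial>lebd d) = n \<tau> * (\<integral>\<^sup>+y. F y \<partial>M)"
    if F[measurable]: "F \<in> borel_measurable (lebd d)" for F \<tau>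
  proof -
    note km[measurable]
    have "(\<integral>\<^sup>+x\<in>?W. (\<integral>\<^sup>+y. k \<tau> (sproj d s x) y * F y \<partial>M) \<partial>lebd d)
      = (\<integral>\<^sup>+x. \<integral>\<^sup>+y. k \<tau> (sproj d s x) y * F y * indicator ?W x \<partial>M \<partial>lebd d)"
    proof (rule nn_integral_cong)
      fix x assume "x \<in> space (lebd d)"
      have "(\<lambda>y. k \<tau> (sproj d s x) y * F y) \<in> borel_measurable M"
        using km1[of "sproj d s x" \<tau>] by (simp add: sproj_def)
      then show "(\<integral>\<^sup>+y. k \<tau> (sproj d s x) y * F y \<partial>M) * indicator ?W x = (\<integral>\<^sup>+y. k \<tau> (sproj d s x) y * F y * indicator ?W x \<partial>M)"
        by (rule nn_integral_multc[symmetric])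
    qed
    also have "\<dots> = (\<integral>\<^sup>+y. \<integral>\<^sup>+x. k \<tau> (sproj d s x) y * F y * indicator ?W x \<partial>lebd d \<partial>M)"
    proof (rule P.Fubini'[symmetric])
      have "(\<lambda>p. k \<tau> (sproj d s (fst p)) (snd p) * F (snd p) * indicator ?W (fst p)) \<in> borel_measurable (lebd d \<Otimes>\<^sub>M M)"
        by measurable
      then show "(\<lambda>(x, y). k \<tau> (sproj d s x) y * F y * indicator ?W x) \<in> borel_measurable (lebd d \<Otimes>\<^sub>M M)"
        by (simp add: split_def)
    qed
    also have "\<dots> = (\<integral>\<^sup>+y. F y * n \<tau> \<partial>M)"
    proof -
      have "(\<integral>\<^sup>+y. \<integral>\<^sup>+x. k \<tau> (sproj d s x) y * F y * indicator ?W x \<partial>lebd d \<partial>M)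
        = (\<integral>\<^sup>+y. F y * (\<integral>\<^sup>+x. k \<tau> (sproj d s x) y * indicator ?W x \<partial>lebd d) \<partial>M)"
      proof (rule nn_integral_cong)
        fix y assume y: "y \<in> space M"
        have [measurable]: "(\<lambda>x. norm2 d (\<lambda>i. sproj d s x i - y i)) \<in> borel_measurable (lebd d)"
          by (rule norm2_diff_measurable) (use y in \<open>auto simp: spM\<close>)
        have "(\<lambda>x. k \<tau> (sproj d s x) y * indicator ?W x) \<in> borel_measurable (lebd d)"
          unfolding k_def by measurable
        from nn_integral_cmult[OF this, of "F y"]
        show "(\<integral>\<^sup>+x. k \<tau> (sproj d s x) y * F y * indicator ?W x \<partial>lebd d) = F y * (\<integral>\<^sup>+x. k \<tau> (sproj d s x) y * indicator ?W x \<partial>lebd d)"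
          by (simp add: mult_ac)
      qed
      also have "\<dots> = (\<integral>\<^sup>+y. F y * n \<tau> \<partial>M)"
      proof (rule nn_integral_cong_AE)
        have "AE y in M. y \<in> ?S"
          unfolding M_def by (subst AE_density) (auto simp: indicator_def)
        then show "AE y in M. F y * (\<integral>\<^sup>+x. k \<tau> (sproj d s x) y * indicator ?W x \<partial>lebd d) = F y * n \<tau>"
          by eventually_elim (simp add: n_eq)
      qed
      finally show ?thesis .
    qed
    also have "\<dots> = n \<tau> * (\<integral>\<^sup>+y. F y \<partial>M)"
      by (subst nn_integral_multc) (auto simp: mult.commute)
    finally show ?thesis .
  qed
  obtain a where a: "a > 0" "emeasure ?H ?S = ennreal a"
    using HS0 HSf by (cases "emeasure ?H ?S") auto
  let ?V = "emeasure (lebd d) ?W" and ?I = "\<integral>\<^sup>+y. G' y \<partial>M"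
  \<comment> \<open>The exchange of integrations with F = 1 shows that the two cap masses are in the
    ratio of the total masses, for every radius.\<close>
  have ratio: "n \<tau> * ennreal (1 / b) = ?V * ennreal (1 / a)" if b: "h \<tau> = ennreal b" "b > 0" for \<tau> b
  proof -
    have "(\<integral>\<^sup>+x\<in>?W. (\<integral>\<^sup>+y. k \<tau> (sproj d s x) y * 1 \<partial>M) \<partial>lebd d) = n \<tau> * (\<integral>\<^sup>+y. 1 \<partial>M)"
      by (rule fubini) simp
    also have "(\<integral>\<^sup>+y. 1 \<partial>M) = ennreal a" using MS a by simp
    also have "(\<integral>\<^sup>+x\<in>?W. (\<integral>\<^sup>+y. k \<tau> (sproj d s x) y * 1 \<partial>M) \<partial>lebd d) = (\<integral>\<^sup>+x\<in>?W. ennreal b \<partial>lebd d)"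
      by (intro nn_integral_cong)
         (auto simp: h_eq[OF sproj_in_sphere] b(1)[symmetric] indicator_def less_imp_le[OF s])
    also have "\<dots> = ennreal b * ?V" by (simp add: nn_integral_cmult_indicator)
    finally have eq: "ennreal b * ?V = n \<tau> * ennreal a" .
    have "ennreal a * ennreal (1 / a) = 1" using a(1) by (simp flip: ennreal_mult)
    then have "n \<tau> * ennreal (1 / b) = n \<tau> * (ennreal a * ennreal (1 / a)) * ennreal (1 / b)" by simp
    also have "\<dots> = (n \<tau> * ennreal a) * (ennreal (1 / a) * ennreal (1 / b))" by (simp only: mult.assoc)
    also have "\<dots> = ?V * ennreal (1 / a) * (ennreal b * ennreal (1 / b))"
      unfolding eq[symmetric] by (simp add: mult_ac)
    also have "ennreal b * ennreal (1 / b) = 1" using b(2) by (simp flip: ennreal_mult)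
    finally show ?thesis by simp
  qed
  define t where "t j = 1 / real (Suc j)" for j
  have t0: "t j > 0" for j by (simp add: t_def)
  define b where "b j = enn2real (h (t j))" for j
  have b: "h (t j) = ennreal (b j)" "b j > 0" for j
    using h0[OF t0[of j]] hf[of "t j"] by (auto simp: b_def enn2real_positive_iff)
  \<comment> \<open>The mean of G over the cap around the projection of x; its radius
    \<open>t j\<close> tends to 0.\<close>
  define A where "A j x = ennreal (1 / b j) * (\<integral>\<^sup>+y. k (t j) (sproj d s x) y * G' y \<partial>M)" for j x
  have Am: "A j \<in> borel_measurable (lebd d)" for j
  proof -
    note km[measurable]
    have "(\<lambda>p. k (t j) (sproj d s (fst p)) (snd p) * G' (snd p)) \<in> borel_measurable (lebd d \<Otimes>\<^sub>M M)" by measurable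
    then have "(\<lambda>x. \<integral>\<^sup>+y. k (t j) (sproj d s x) y * G' y \<partial>M) \<in> borel_measurable (lebd d)"
      by (intro M.borel_measurable_nn_integral) (simp add: split_def)
    then show ?thesis unfolding A_def by measurable
  qed
  have intA: "(\<integral>\<^sup>+x. A j x * indicator ?W x \<partial>lebd d) = ?V * ennreal (1 / a) * ?I" for j
  proof -
    note km[measurable]
    have "(\<lambda>p. k (t j) (sproj d s (fst p)) (snd p) * G' (snd p)) \<in> borel_measurable (lebd d \<Otimes>\<^sub>M M)" by measurable
    then have [measurable]: "(\<lambda>x. \<integral>\<^sup>+y. k (t j) (sproj d s x) y * G' y \<partial>M) \<in> borel_measurable (lebd d)"
      by (intro M.borel_measurable_nn_integral) (simp add: split_def)
    have "(\<integral>\<^sup>+x. A j x * indicator ?W x \<partial>lebd d) = ennreal (1 / b j) * (n (t j) * ?I)"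
      unfolding A_def mult.assoc by (subst nn_integral_cmult) (auto simp: fubini)
    also have "\<dots> = ?V * ennreal (1 / a) * ?I"
      using ratio[OF b(1) b(2), of j] by (simp add: mult_ac)
    finally show ?thesis .
  qed
  \<comment> \<open>By continuity G is above G z - e on small caps around z, so the cap means are
    eventually at least that. If G z - e is negative, \<open>ennreal\<close> truncates it to
    0.\<close>
  have ptw: "ennreal (G (sproj d s x)) * indicator ?W x \<le> liminf (\<lambda>j. A j x * indicator ?W x)"
    if "x \<in> space (lebd d)" for x
  proof (cases "x \<in> ?W")
    case True
    define z where "z = sproj d s x"
    have z: "z \<in> ?S" unfolding z_def by (rule sproj_in_sphere[OF True less_imp_le[OF s]])
    have "ennreal (G z) \<le> liminf (\<lambda>j. A j x)"
    proof (rule ennreal_le_epsilon)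
      fix e :: real assume e: "e > 0"
      obtain \<delta> where \<delta>: "\<delta> > 0" "\<And>y. y \<in> ?S \<Longrightarrow> (\<And>i. i < d \<Longrightarrow> \<bar>y i - z i\<bar> < \<delta>) \<Longrightarrow> \<bar>G y - G z\<bar> < e"
        using continuous_on_box[OF G(1) _ z e, of d] SR by blast
      obtain J where J: "inverse (real (Suc J)) < \<delta>" using reals_Archimedean[OF \<delta>(1)] by blast
      have "\<forall>\<^sub>F j in sequentially. ennreal (G z - e) \<le> A j x"
        unfolding eventually_sequentially
      proof (intro exI[of _ J] allI impI)
        fix j assume j: "J \<le> j"
        have "t j \<le> inverse (real (Suc J))" using j by (simp add: t_def inverse_eq_divide frac_le)
        then have tj: "t j < \<delta>" using J by simp
        have "ennreal (G z - e) = ennreal (1 / b j) * (ennreal (G z - e) * (\<integral>\<^sup>+y. k (t j) z y \<partial>M))"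
          unfolding h_eq[OF z] b(1) using b(2)[of j]
          by (simp add: mult.left_commute[of _ "ennreal (G z - e)"] flip: ennreal_mult)
        also have "ennreal (G z - e) * (\<integral>\<^sup>+y. k (t j) z y \<partial>M) = (\<integral>\<^sup>+y. ennreal (G z - e) * k (t j) z y \<partial>M)"
          using km1[OF SR[OF z], of "t j"] by (intro nn_integral_cmult[symmetric]) simp
        also have "\<dots> \<le> (\<integral>\<^sup>+y. k (t j) z y * G' y \<partial>M)"
        proof (rule nn_integral_mono_AE)
          have "AE y in M. y \<in> ?S"
            unfolding M_def by (subst AE_density) (auto simp: indicator_def)
          then show "AE y in M. ennreal (G z - e) * k (t j) z y \<le> k (t j) z y * G' y"
          proof eventually_elim
            case (elim y)
            show ?case
            proof (cases "norm2 d (\<lambda>i. z i - y i) < t j")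
              case True
              have "\<bar>y i - z i\<bar> < \<delta>" if "i < d" for i
                using abs_le_norm2[OF that, of "\<lambda>i. z i - y i"] True tj by linarith
              then have "\<bar>G y - G z\<bar> < e" by (rule \<delta>(2)[OF elim])
              then show ?thesis using elim True by (simp add: k_def G'_def ennreal_leI)
            qed (simp add: k_def)
          qed
        qed
        finally show "ennreal (G z - e) \<le> A j x" unfolding A_def z_def by (simp add: mult_left_mono)
      qed
      then have "ennreal (G z - e) \<le> liminf (\<lambda>j. A j x)" by (rule Liminf_bounded)
      moreover have "ennreal (G z) \<le> ennreal (G z - e) + ennreal e"
      proof (cases "G z \<ge> e")
        case True
        then show ?thesis using e by (simp flip: ennreal_plus)
      next
        case False
        then have "ennreal (G z) \<le> ennreal e" by (intro ennreal_leI) simp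
        then show ?thesis by (rule order_trans) simp
      qed
      ultimately show "ennreal (G z) \<le> liminf (\<lambda>j. A j x) + ennreal e"
        by (meson add_right_mono order_trans)
    qed
    then show ?thesis using True by (simp add: z_def)
  qed simp
  have "(\<integral>\<^sup>+x\<in>?W. ennreal (G (sproj d s x)) \<partial>lebd d) \<le> (\<integral>\<^sup>+x. liminf (\<lambda>j. A j x * indicator ?W x) \<partial>lebd d)"
    by (rule nn_integral_mono) (rule ptw)
  also have "\<dots> \<le> liminf (\<lambda>j. \<integral>\<^sup>+x. A j x * indicator ?W x \<partial>lebd d)"
    by (rule nn_integral_liminf) (use Am in measurable)
  also have "\<dots> = ?V * ennreal (1 / a) * ?I" unfolding intA by (simp add: Liminf_const)
  also have "?I = (\<integral>\<^sup>+y\<in>?S. ennreal (G y) \<partial>?H)"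
    by (subst intM[OF G'm]) (auto intro!: nn_integral_cong simp: G'_def indicator_def)
  also have "?V * ennreal (1 / a) * (\<integral>\<^sup>+y\<in>?S. ennreal (G y) \<partial>?H) = ?V * ((\<integral>\<^sup>+y\<in>?S. ennreal (G y) \<partial>?H) / emeasure ?H ?S)"
    using a by (simp add: divide_ennreal_def inverse_ennreal inverse_eq_divide mult_ac)
  finally show ?thesis .
qed

subsection \<open>Taylor polynomials at the origin\<close>

definition tcoef :: "nat \<Rightarrow> ((nat \<Rightarrow> real) \<Rightarrow> real) \<Rightarrow> (nat \<Rightarrow> nat) \<Rightarrow> real" where
  "tcoef d f \<beta> = Dmulti d \<beta> f (zerod d) / mfact d \<beta>"

lemma tform_tcoef: "tform d f m (zerod d) x / fact m = (\<Sum>\<beta>\<in>mindices d m. tcoef d f \<beta> * mpow d x \<beta>)"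
  by (simp add: tform_def tcoef_def)

lemma mpoly_taylor: "mpoly d k (tcoef d f) x = (\<Sum>m<k. tform d f m (zerod d) x / fact m)"
  by (simp add: mpoly_def tform_tcoef)

lemma ray_1: "x \<in> Rd d \<Longrightarrow> ray d x 1 = x"
  by (rule Rd_eqI) auto

lemma ray_0: "ray d x 0 = zerod d"
  by (rule line_0) simp

lemma mpoly_taylor_0:
  assumes "k > 0" shows "mpoly d k (tcoef d f) (zerod d) = f (zerod d)"
proof -
  have "tform d f m (zerod d) (zerod d) = (if m = 0 then f (zerod d) else 0)" for m
    using tform_scale[of d "zerod d" 0 "zerod d" f m "zerod d"] by (cases m) (simp_all add: tform_0)
  then have "mpoly d k (tcoef d f) (zerod d) = (\<Sum>m<k. if m = 0 then f (zerod d) else 0)"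
    unfolding mpoly_taylor by (intro sum.cong) auto
  then show ?thesis using assms by simp
qed

section \<open>Openness of the domains and passage to their closures\<close>

lemma boxopen_oballd: "boxopen d (oballd d R)"
  unfolding boxopen_def
proof (intro conjI ballI)
  fix x assume x: "x \<in> oballd d R"
  define e where "e = (R - norm2 d x) / (real d + 1)"
  have e: "e > 0" using x by (simp add: e_def oballd_def)
  have "y \<in> oballd d R" if y: "y \<in> Rd d" "\<forall>i<d. \<bar>y i - x i\<bar> < e" for y
  proof -
    have "norm2 d y = norm2 d (\<lambda>i. x i + (y i - x i))" by simp
    also have "\<dots> \<le> norm2 d x + norm2 d (\<lambda>i. y i - x i)" by (rule norm2_triangle)
    also have "norm2 d (\<lambda>i. y i - x i) \<le> (\<Sum>i<d. \<bar>y i - x i\<bar>)" unfolding norm2_L2 by (rule L2_set_le_sum_abs)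
    also have "\<dots> \<le> (\<Sum>i<d. e)" by (rule sum_mono) (use y in \<open>auto intro: less_imp_le\<close>)
    also have "\<dots> < (real d + 1) * e" using e by (simp add: algebra_simps)
    also have "\<dots> = R - norm2 d x" by (simp add: e_def)
    finally show ?thesis using y by (simp add: oballd_def)
  qed
  then show "\<exists>e>0. \<forall>y\<in>Rd d. (\<forall>i<d. \<bar>y i - x i\<bar> < e) \<longrightarrow> y \<in> oballd d R" using e by blast
qed (auto simp: oballd_def)

lemma boxopen_ocube: "boxopen d (ocube d)"
  unfolding boxopen_def
proof (intro conjI ballI)
  fix x assume x: "x \<in> ocube d"
  define e where "e = Min (insert 1 ((\<lambda>i. 1/2 - \<bar>x i\<bar>) ` {..<d}))"
  have xi: "\<bar>x i\<bar> < 1/2" if "i < d" for i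
  proof -
    have "x i \<in> {-1/2<..<1/2}" using x that unfolding ocube_def by (auto simp: PiE_def Pi_def)
    then show ?thesis by auto
  qed
  have e: "e > 0" unfolding e_def using xi by (subst Min_gr_iff) auto
  have ei: "e \<le> 1/2 - \<bar>x i\<bar>" if "i < d" for i unfolding e_def using that by (intro Min_le) auto
  have "y \<in> ocube d" if y: "y \<in> Rd d" "\<forall>i<d. \<bar>y i - x i\<bar> < e" for y
  proof -
    have "y i \<in> {-1/2<..<1/2}" if "i < d" for i
    proof -
      have "\<bar>y i\<bar> < 1/2" using ei[OF that] y(2) that by force
      then show ?thesis by auto
    qed
    then show ?thesis using y(1) unfolding ocube_def Rd_def by (auto simp: PiE_def Pi_def)
  qed
  then show "\<exists>e>0. \<forall>y\<in>Rd d. (\<forall>i<d. \<bar>y i - x i\<bar> < e) \<longrightarrow> y \<in> ocube d" using e by blast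
qed (auto simp: ocube_def Rd_def)

text \<open>The Taylor estimates hold in the open domain; a boundary point is reached along its ray
  from the origin.\<close>

lemma abs_le_on_closure:
  assumes F: "continuous_on K F" and x: "x \<in> K" "x \<in> Rd d" and UK: "U \<subseteq> K"
    and ray: "\<And>t. 0 < t \<Longrightarrow> t < 1 \<Longrightarrow> ray d x t \<in> U" and U: "\<And>y. y \<in> U \<Longrightarrow> \<bar>F y\<bar> \<le> (e::real)"
  shows "\<bar>F x\<bar> \<le> e"
proof -
  have ev: "\<forall>\<^sub>F t in at_left 1. 0 < t \<and> t < (1::real)"
    using eventually_at_left_real[of 0 "1::real"] by auto
  have "((\<lambda>t. ray d x t) \<longlongrightarrow> x) (at_left 1)"
  proof (rule tendsto_coordinates)
    fix i
    show "((\<lambda>t. ray d x t i) \<longlongrightarrow> x i) (at_left 1)"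
    proof (cases "i < d")
      case True
      have "((\<lambda>t. t * x i) \<longlongrightarrow> 1 * x i) (at_left (1::real))" by (intro tendsto_intros)
      then show ?thesis using True by simp
    next
      case False
      then show ?thesis using Rd_undefined[OF x(2) False] Rd_undefined[OF line_in_Rd False] by simp
    qed
  qed
  then have "((\<lambda>t. F (ray d x t)) \<longlongrightarrow> F x) (at_left 1)"
    by (rule continuous_on_tendsto_compose[OF F _ x(1)]) (use ev ray UK in \<open>auto elim!: eventually_mono\<close>)
  then have "((\<lambda>t. \<bar>F (ray d x t)\<bar>) \<longlongrightarrow> \<bar>F x\<bar>) (at_left 1)" by (rule tendsto_rabs)
  then show ?thesis
    by (rule tendsto_upperbound) (use ev ray U in \<open>auto elim!: eventually_mono\<close>)
qed

subsection \<open>The class on the cube\<close>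

lemma ocube_coord: "x \<in> ocube d \<Longrightarrow> i < d \<Longrightarrow> \<bar>x i\<bar> < 1/2"
proof -
  assume "x \<in> ocube d" "i < d"
  then have "x i \<in> {-1/2<..<1/2}" unfolding ocube_def by (auto simp: PiE_def Pi_def)
  then show ?thesis by auto
qed

lemma ocubeI:
  assumes "x \<in> Rd d" "\<And>i. i < d \<Longrightarrow> \<bar>x i\<bar> < 1/2"
  shows "x \<in> ocube d"
proof -
  have "x i \<in> {-1/2<..<1/2}" if "i < d" for i
    unfolding greaterThanLessThan_iff using assms(2)[OF that] by linarith
  then show ?thesis using assms(1) unfolding ocube_def Rd_def PiE_def Pi_def by simp
qed

lemma cube_coord: "x \<in> cube d \<Longrightarrow> i < d \<Longrightarrow> \<bar>x i\<bar> \<le> 1/2"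
proof -
  assume "x \<in> cube d" "i < d"
  then have "x i \<in> {-1/2..1/2}" unfolding cube_def by (auto simp: PiE_def Pi_def)
  then show ?thesis by auto
qed

lemma ocube_subset_cube: "ocube d \<subseteq> cube d"
  unfolding ocube_def cube_def by (rule PiE_mono) auto

lemma cube_Rd: "x \<in> cube d \<Longrightarrow> x \<in> Rd d"
  by (auto simp: cube_def Rd_def)

lemma F1_smooth: "f \<in> F1 d \<Longrightarrow> smooth_fun d (ocube d) (cube d) f"
  by (simp add: F1_def smooth_fun_def boxopen_ocube ocube_subset_cube)

lemma F1_sum_le:
  assumes f: "f \<in> F1 d" and y: "y \<in> ocube d"
  shows "(\<Sum>\<beta>\<in>mindices d k. \<bar>Dmulti d \<beta> f y\<bar> / mfact d \<beta>) \<le> 1"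
proof -
  have "ennreal (\<Sum>\<beta>\<in>mindices d k. \<bar>Dmulti d \<beta> f y\<bar> / mfact d \<beta>)
     = (\<Sum>\<beta>\<in>mindices d k. ennreal \<bar>Dmulti d \<beta> f y\<bar> / ennreal (mfact d \<beta>))"
    by (simp add: divide_ennreal sum_ennreal less_imp_le)
  also have "\<dots> \<le> (\<Sum>\<beta>\<in>mindices d k. supn (ocube d) (Dmulti d \<beta> f) / ennreal (\<Prod>i<d. fact (\<beta> i)))"
    unfolding supn_def mfact_def by (intro sum_mono divide_right_mono_ennreal SUP_upper y)
  also have "\<dots> \<le> 1" using f by (simp add: F1_def)
  finally show ?thesis by (simp add: sum_nonneg less_imp_le)
qed

text \<open>The Lagrange remainder is the sum of D^\<beta> f x^\<beta> / \<beta>! over |\<beta>| =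
  k, which is just what the class normalises. With m = 1/2 it gives the global rate, with m =
  \<open>norm2 d x\<close> the local bound for the sampling.\<close>

lemma F1_taylor:
  assumes f: "f \<in> F1 d" and x: "x \<in> ocube d" and k: "k > 0" and m: "\<And>i. i < d \<Longrightarrow> \<bar>x i\<bar> \<le> m"
    and m0: "m \<ge> 0"
  shows "\<bar>f x - mpoly d k (tcoef d f) x\<bar> \<le> m ^ k"
proof -
  interpret smooth_fun d "ocube d" "cube d" f by (rule F1_smooth[OF f])
  have xR: "x \<in> Rd d" using x URd by auto
  have L: "ray d x t \<in> ocube d" if "0 \<le> t" "t \<le> 1" for t
  proof (rule ocubeI)
    fix i assume i: "i < d"
    have "\<bar>t * x i\<bar> \<le> 1 * \<bar>x i\<bar>" unfolding abs_mult using that by (intro mult_right_mono) auto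
    then show "\<bar>ray d x t i\<bar> < 1/2" using ocube_coord[OF x i] i by simp
  qed simp
  obtain t where t: "0 < t" "t < 1"
    "f (ray d x 1) = (\<Sum>j<k. tform d f j (ray d x 0) x / fact j * 1 ^ j) + tform d f k (ray d x t) x / fact k * 1 ^ k"
    using taylor_lagrange[OF zero_less_one k L] by blast
  then have "f x - mpoly d k (tcoef d f) x = tform d f k (ray d x t) x / fact k"
    by (simp add: mpoly_taylor ray_1[OF xR] ray_0)
  also have "\<bar>\<dots>\<bar> = \<bar>\<Sum>\<beta>\<in>mindices d k. Dmulti d \<beta> f (ray d x t) * mpow d x \<beta> / mfact d \<beta>\<bar>"
    by (simp add: tform_def)
  also have "\<dots> \<le> (\<Sum>\<beta>\<in>mindices d k. \<bar>Dmulti d \<beta> f (ray d x t)\<bar> / mfact d \<beta> * m ^ k)"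
  proof (rule order_trans[OF sum_abs sum_mono])
    fix \<beta> assume "\<beta> \<in> mindices d k"
    then have "\<bar>mpow d x \<beta>\<bar> \<le> m ^ k" using m by (rule abs_mpow_le)
    then show "\<bar>Dmulti d \<beta> f (ray d x t) * mpow d x \<beta> / mfact d \<beta>\<bar> \<le> \<bar>Dmulti d \<beta> f (ray d x t)\<bar> / mfact d \<beta> * m ^ k"
      by (simp add: abs_mult less_imp_le divide_right_mono mult_left_mono)
  qed
  also have "\<dots> \<le> 1 * m ^ k"
    unfolding sum_distrib_right[symmetric]
    by (rule mult_right_mono[OF F1_sum_le[OF f L]]) (use t m0 in auto)
  finally show ?thesis by simp
qed

lemma F1_infc:
  assumes \<epsilon>: "0 < \<epsilon>" and k: "k > 0" and k2: "(1/2) ^ k \<le> \<epsilon> / 4"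
  shows "\<exists>m \<le> (d + 1) ^ (k - 1). infc (cube d) (F1 d) (err_sup (cube d)) \<epsilon> = enat m"
\<comment> \<open>The error budget is \<epsilon> / 4 for each of two remainders and \<epsilon> / 2
  for the difference of the Taylor polynomials. The ball of radius 1/4 lies in the open cube, and
  the ball of radius d contains the open cube.\<close>
proof (rule infc_taylor[where \<delta> = "1/4" and \<rho> = "real d" and \<eta> = "\<epsilon> / 2" and C = 1 and c = "tcoef d" and G = "\<lambda>g. g"])
  have sub: "x \<in> ocube d" if "x \<in> cballd d (1/4)" for x
  proof (rule ocubeI)
    show "x \<in> Rd d" using that by (simp add: cballd_def)
    fix i assume "i < d"
    then show "\<bar>x i\<bar> < 1/2" using abs_le_norm2[of i d x] that by (simp add: cballd_def)
  qed
  then show "cballd d (1/4) \<subseteq> cube d" using ocube_subset_cube by auto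
  fix f x assume "f \<in> F1 d" "x \<in> cballd d (1/4)"
  then show "\<bar>f x - mpoly d k (tcoef d f) x\<bar> \<le> 1 * norm2 d x ^ k"
    using F1_taylor[of f d x k "norm2 d x"] sub k abs_le_norm2 by simp
next
  fix f g assume fg: "f \<in> F1 d" "g \<in> F1 d"
    and T: "\<And>x. x \<in> cballd d (real d) \<Longrightarrow> \<bar>mpoly d k (tcoef d f) x - mpoly d k (tcoef d g) x\<bar> \<le> \<epsilon> / 2"
  have U: "\<bar>f x - g x\<bar> \<le> \<epsilon>" if x: "x \<in> ocube d" for x
  proof -
    have xi: "\<bar>x i\<bar> \<le> 1/2" if "i < d" for i using ocube_coord[OF x that] by simp
    have "norm2 d x \<le> (\<Sum>i<d. \<bar>x i\<bar>)" unfolding norm2_L2 by (rule L2_set_le_sum_abs)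
    also have "\<dots> \<le> (\<Sum>i<d. 1)" by (rule sum_mono) (use xi in force)
    finally have "x \<in> cballd d (real d)" using x by (auto simp: cballd_def ocube_def Rd_def)
    from T[OF this] F1_taylor[OF fg(1) x k xi] F1_taylor[OF fg(2) x k xi] k2
    show ?thesis by linarith
  qed
  have "\<bar>f x - g x\<bar> \<le> \<epsilon>" if x: "x \<in> cube d" for x
  proof (rule abs_le_on_closure[where F = "\<lambda>x. f x - g x" and K = "cube d" and U = "ocube d"])
    show "continuous_on (cube d) (\<lambda>x. f x - g x)"
      using fg by (intro continuous_on_diff) (auto simp: F1_def smooth_on_def)
    fix t :: real assume t: "0 < t" "t < 1"
    show "ray d x t \<in> ocube d"
    proof (rule ocubeI)
      fix i assume i: "i < d"
      have "\<bar>t * x i\<bar> \<le> t * (1/2)" unfolding abs_mult using t cube_coord[OF x i] by (simp add: mult_left_mono)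
      also have "\<dots> < 1/2" using t by simp
      finally show "\<bar>ray d x t i\<bar> < 1/2" using i by simp
    qed simp
  qed (use x U cube_Rd ocube_subset_cube in auto)
  then show "err_sup (cube d) f g \<le> ennreal \<epsilon>"
    unfolding err_sup_def by (intro SUP_least ennreal_leI)
qed (use assms in auto)

subsection \<open>The uniform class on the ball\<close>

lemma oballd_subset_cballd: "oballd d R \<subseteq> cballd d R"
  by (auto simp: oballd_def cballd_def)

lemma ball_smooth: "smooth_on d (oballd d R) (cballd d R) f \<Longrightarrow> smooth_fun d (oballd d R) (cballd d R) f"
  by (simp add: smooth_fun_def boxopen_oballd oballd_subset_cballd)

lemma sproj_eq_ray: "sproj d s x = ray d (\<lambda>i. x i / norm2 d x) s"
  unfolding sproj_def by (rule Rd_eqI[of _ d]) auto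

lemma sproj_self: "x \<in> Rd d \<Longrightarrow> norm2 d x > 0 \<Longrightarrow> sproj d (norm2 d x) x = x"
  unfolding sproj_def by (simp add: ray_1)

lemma norm2_sproj: "norm2 d x > 0 \<Longrightarrow> norm2 d (sproj d s x) = \<bar>s\<bar>"
  unfolding sproj_def by (simp add: norm2_ray)

text \<open>The normal direction is constant along a ray: since s is positive, it is the same unit
  vector at the projected point as at x. So normal derivatives are ordinary derivatives along the
  ray.\<close>

lemma tform_sproj:
  assumes S: "smooth_fun d (oballd d R) K f" and x: "norm2 d x > 0" and s: "0 < s" "s < R"
  shows "tform d f k (sproj d s x) (\<lambda>i. x i / norm2 d x) = ndiff d k f (sproj d s x)"
proof -
  interpret smooth_fun d "oballd d R" K f by (rule S)
  have "sproj d s x \<in> oballd d R" using norm2_sproj[OF x, of s] s by (simp add: oballd_def sproj_def)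
  from ndiff_eq[OF this, of k] have "ndiff d k f (sproj d s x) = tform d f k (sproj d s x) (\<lambda>i. sproj d s x i / norm2 d (sproj d s x))" .
  also have "\<dots> = tform d f k (sproj d s x) (\<lambda>i. x i / norm2 d x)"
    by (rule tform_cong) (use s x in \<open>simp add: norm2_sproj\<close>, simp add: sproj_eq_ray)
  finally show ?thesis by simp
qed

lemma taylor_direction:
  assumes x: "norm2 d x > 0"
  shows "tform d f m (zerod d) (\<lambda>i. x i / norm2 d x) / fact m * norm2 d x ^ m = tform d f m (zerod d) x / fact m"
proof -
  have "tform d f m (zerod d) x = norm2 d x ^ m * tform d f m (zerod d) (\<lambda>i. x i / norm2 d x)"
    by (rule tform_scale) (use x in simp)
  then show ?thesis by simp
qed

text \<open>On the ray through x the Taylor remainder is one-dimensional and involves just the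
  normal derivative of order k, which the class bounds by 1. The origin has no normal direction and
  is treated separately.\<close>

lemma F2_taylor:
  assumes f: "f \<in> F2 d R" and x: "x \<in> oballd d R" and k: "k > 0"
  shows "\<bar>f x - mpoly d k (tcoef d f) x\<bar> \<le> norm2 d x ^ k / fact k"
proof (cases "norm2 d x = 0")
  case True
  then have "x = zerod d" using x norm2_zero_iff by (auto simp: oballd_def)
  then show ?thesis using k by (simp add: mpoly_taylor_0)
next
  case False
  then have x0: "norm2 d x > 0" using norm2_nonneg[of d x] by linarith
  have S: "smooth_fun d (oballd d R) (cballd d R) f" using f by (intro ball_smooth) (simp add: F2_def)
  interpret smooth_fun d "oballd d R" "cballd d R" f by (rule S)
  have xR: "x \<in> Rd d" "norm2 d x < R" using x by (auto simp: oballd_def)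
  let ?v = "\<lambda>i. x i / norm2 d x"
  have L: "ray d ?v t \<in> oballd d R" if "0 \<le> t" "t \<le> norm2 d x" for t
    using that xR norm2_sproj[OF x0, of t] unfolding sproj_eq_ray by (simp add: oballd_def)
  obtain t where t: "0 < t" "t < norm2 d x"
    "f (ray d ?v (norm2 d x)) = (\<Sum>j<k. tform d f j (ray d ?v 0) ?v / fact j * norm2 d x ^ j) + tform d f k (ray d ?v t) ?v / fact k * norm2 d x ^ k"
    using taylor_lagrange[OF x0 k L] by blast
  have "f x - mpoly d k (tcoef d f) x = tform d f k (ray d ?v t) ?v / fact k * norm2 d x ^ k"
    using t(3) sproj_self[OF xR(1) x0] by (simp add: mpoly_taylor sproj_eq_ray ray_0 taylor_direction[OF x0] del: times_divide_eq_left)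
  moreover have "\<bar>tform d f k (ray d ?v t) ?v\<bar> \<le> 1"
  proof -
    have "tform d f k (ray d ?v t) ?v = ndiff d k f (sproj d t x)"
      using tform_sproj[OF S x0 t(1)] t(2) xR(2) by (simp add: sproj_eq_ray)
    moreover have "ennreal \<bar>ndiff d k f (sproj d t x)\<bar> \<le> supn (oballd d R - {zerod d}) (ndiff d k f)"
      unfolding supn_def
    proof (rule SUP_upper)
      have "sproj d t x \<in> pball d R" using norm2_sproj[OF x0, of t] t xR(2) by (simp add: pball_iff sproj_def)
      then show "sproj d t x \<in> oballd d R - {zerod d}" by (simp add: pball_def)
    qed
    moreover have "supn (oballd d R - {zerod d}) (ndiff d k f) \<le> 1" using f by (simp add: F2_def)
    ultimately show ?thesis by (metis ennreal_le_1 order_trans)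
  qed
  ultimately show ?thesis
    by (simp add: abs_mult mult_left_le_one_le divide_right_mono)
qed

lemma F2_infc:
  assumes R: "R > 0" and \<epsilon>: "0 < \<epsilon>" and k: "k > 0" and k2: "R ^ k / fact k \<le> \<epsilon> / 4"
  shows "\<exists>m \<le> (d + 1) ^ (k - 1). infc (cballd d R) (F2 d R) (err_sup (cballd d R)) \<epsilon> = enat m"
proof (rule infc_taylor[where \<delta> = "R / 2" and \<rho> = R and \<eta> = "\<epsilon> / 2" and C = 1 and c = "tcoef d" and G = "\<lambda>g. g"])
  show "cballd d (R / 2) \<subseteq> cballd d R" using R by (auto simp: cballd_def)
  fix f x assume f: "f \<in> F2 d R" and x: "x \<in> cballd d (R / 2)"
  have "x \<in> oballd d R" using x R by (auto simp: cballd_def oballd_def)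
  from F2_taylor[OF f this k] have "\<bar>f x - mpoly d k (tcoef d f) x\<bar> \<le> norm2 d x ^ k / fact k" .
  also have "\<dots> \<le> norm2 d x ^ k / 1" by (intro divide_left_mono) auto
  finally show "\<bar>f x - mpoly d k (tcoef d f) x\<bar> \<le> 1 * norm2 d x ^ k" by simp
next
  fix f g assume fg: "f \<in> F2 d R" "g \<in> F2 d R"
    and T: "\<And>x. x \<in> cballd d R \<Longrightarrow> \<bar>mpoly d k (tcoef d f) x - mpoly d k (tcoef d g) x\<bar> \<le> \<epsilon> / 2"
  have U: "\<bar>f x - g x\<bar> \<le> \<epsilon>" if x: "x \<in> oballd d R" for x
  proof -
    have "norm2 d x ^ k / fact k \<le> R ^ k / fact k"
      using x by (intro divide_right_mono power_mono) (auto simp: oballd_def)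
    moreover have "x \<in> cballd d R" using x oballd_subset_cballd by auto
    ultimately show ?thesis
      using T[of x] F2_taylor[OF fg(1) x k] F2_taylor[OF fg(2) x k] k2 by linarith
  qed
  have "\<bar>f x - g x\<bar> \<le> \<epsilon>" if x: "x \<in> cballd d R" for x
  proof (rule abs_le_on_closure[where F = "\<lambda>x. f x - g x" and K = "cballd d R" and U = "oballd d R"])
    show "continuous_on (cballd d R) (\<lambda>x. f x - g x)"
      using fg by (intro continuous_on_diff) (auto simp: F2_def smooth_on_def)
    fix t :: real assume t: "0 < t" "t < 1"
    have "t * norm2 d x \<le> t * R" using x t by (simp add: cballd_def)
    also have "\<dots> < R" using t R by simp
    finally show "ray d x t \<in> oballd d R" using t by (simp add: oballd_def norm2_ray)
  qed (use x U oballd_subset_cballd in \<open>auto simp: cballd_def\<close>)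
  then show "err_sup (cballd d R) f g \<le> ennreal \<epsilon>"
    unfolding err_sup_def by (intro SUP_least ennreal_leI)
qed (use assms in auto)

subsection \<open>Finite differences of forms\<close>

lemma coeff_zero_pcompose_shift:
  fixes p :: "real poly"
  assumes "\<forall>i\<ge>n. coeff p i = 0"
  shows "\<forall>i\<ge>n. coeff (pcompose p [:1, 1:]) i = 0"
proof (cases "p = 0")
  case False
  have "degree (pcompose p [:1, 1:]) \<le> degree p" using degree_pcompose_le[of p "[:1, 1:]"] by simp
  moreover have "degree p < n" using False assms by (metis leading_coeff_0_iff not_le)
  ultimately show ?thesis by (auto intro: coeff_eq_0)
qed simp

text \<open>Vanishing of the coefficients from n on replaces \<open>degree p < n\<close>, so that n
  = 0 covers exactly the zero polynomial. In the induction the difference of a + X p is X times the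
  difference of p, minus the shifted p.\<close>

lemma coeff_zero_difference:
  fixes p :: "real poly"
  assumes "\<forall>i\<ge>Suc n. coeff p i = 0"
  shows "\<forall>i\<ge>n. coeff (p - pcompose p [:1, 1:]) i = 0"
  using assms
proof (induction p arbitrary: n)
  case (pCons a p)
  have p: "\<forall>i\<ge>n. coeff p i = 0"
    using pCons.prems by (metis Suc_le_mono coeff_pCons_Suc)
  have eq: "pCons a p - pcompose (pCons a p) [:1, 1:] = pCons 0 (p - pcompose p [:1, 1:]) - pcompose p [:1, 1:]"
    by (simp add: pcompose_pCons algebra_simps)
  show ?case
  proof (cases n)
    case 0
    then have "p = 0" using p by (simp add: poly_eq_iff)
    then show ?thesis by simp
  next
    case (Suc m)
    have "\<forall>i\<ge>m. coeff (p - pcompose p [:1, 1:]) i = 0"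
      using pCons.IH[of m] p Suc by simp
    then have "\<forall>i\<ge>n. coeff (pCons 0 (p - pcompose p [:1, 1:])) i = 0"
      unfolding Suc by (auto simp: coeff_pCons split: nat.split)
    then show ?thesis unfolding eq using coeff_zero_pcompose_shift[OF p] by simp
  qed
qed simp

lemma alternating_binomial_pascal:
  fixes \<phi> :: "nat \<Rightarrow> real"
  shows "(\<Sum>i\<le>Suc n. (-1) ^ i * real (Suc n choose i) * \<phi> i)
    = (\<Sum>i\<le>n. (-1) ^ i * real (n choose i) * (\<phi> i - \<phi> (Suc i)))"
proof -
  have A: "(\<Sum>i\<le>Suc n. (-1) ^ i * real (n choose i) * \<phi> i) = (\<Sum>i\<le>n. (-1) ^ i * real (n choose i) * \<phi> i)"
    by simp
  have B: "(\<Sum>i\<le>Suc n. (-1) ^ i * real (n choose i) * \<phi> i) = \<phi> 0 + (\<Sum>i\<le>n. (-1) ^ Suc i * real (n choose Suc i) * \<phi> (Suc i))"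
    by (subst sum.atMost_Suc_shift) simp
  have "(\<Sum>i\<le>Suc n. (-1) ^ i * real (Suc n choose i) * \<phi> i)
     = \<phi> 0 + (\<Sum>i\<le>n. (-1) ^ Suc i * real (Suc n choose Suc i) * \<phi> (Suc i))"
    by (subst sum.atMost_Suc_shift) simp
  also have "(\<Sum>i\<le>n. (-1) ^ Suc i * real (Suc n choose Suc i) * \<phi> (Suc i))
     = (\<Sum>i\<le>n. (-1) ^ Suc i * real (n choose Suc i) * \<phi> (Suc i)) - (\<Sum>i\<le>n. (-1) ^ i * real (n choose i) * \<phi> (Suc i))"
    unfolding sum_subtractf[symmetric] by (intro sum.cong) (auto simp: algebra_simps)
  finally show ?thesis using A B by (simp add: algebra_simps sum_subtractf)
qed

text \<open>Up to sign this is the n-th finite difference at 0, and each difference lowers the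
  degree by one.\<close>

lemma alternating_binomial_poly:
  fixes p :: "real poly"
  assumes "\<forall>i\<ge>n. coeff p i = 0"
  shows "(\<Sum>i\<le>n. (-1) ^ i * real (n choose i) * poly p (real i)) = 0"
  using assms
proof (induction n arbitrary: p)
  case 0
  then have "p = 0" by (simp add: poly_eq_iff)
  then show ?case by simp
next
  case (Suc n)
  have "poly p (real i) - poly p (real (Suc i)) = poly (p - pcompose p [:1, 1:]) (real i)" for i
    by (simp add: poly_pcompose add.commute)
  then show ?case
    using Suc.IH[OF coeff_zero_difference[OF Suc.prems]] alternating_binomial_pascal[of n "\<lambda>i. poly p (real i)"] by simp
qed

definition hform :: "nat \<Rightarrow> nat \<Rightarrow> ((nat \<Rightarrow> nat) \<Rightarrow> real) \<Rightarrow> (nat \<Rightarrow> real) \<Rightarrow> real" where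
  "hform d k c x = (\<Sum>\<beta>\<in>mindices d k. c \<beta> * mpow d x \<beta>)"

lemma mpoly_hform: "mpoly d k c x = (\<Sum>j<k. hform d j c x)"
  by (simp add: mpoly_def hform_def)

lemma hform_scale: "(\<And>i. i < d \<Longrightarrow> w i = a * v i) \<Longrightarrow> hform d k c w = a ^ k * hform d k c v"
  unfolding hform_def by (simp add: sum_distrib_left mpow_scale mult_ac)

lemma hform_line_poly:
  "\<exists>p. degree p \<le> k \<and> (\<forall>t. poly p t = hform d k c (line d x u t))"
proof -
  define P where "P \<beta> = (\<Prod>i<d. [:x i, u i:] ^ \<beta> i)" for \<beta> :: "nat \<Rightarrow> nat"
  have deg: "degree (P \<beta>) \<le> k" if "\<beta> \<in> mindices d k" for \<beta>
  proof -
    have "degree (P \<beta>) \<le> (\<Sum>i<d. degree ([:x i, u i:] ^ \<beta> i))"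
      unfolding P_def using degree_prod_sum_le[of "{..<d}" "\<lambda>i. [:x i, u i:] ^ \<beta> i"] by simp
    also have "\<dots> \<le> (\<Sum>i<d. \<beta> i)"
    proof (rule sum_mono)
      fix i
      have "degree ([:x i, u i:] ^ \<beta> i) \<le> degree [:x i, u i:] * \<beta> i" by (rule degree_power_le)
      also have "\<dots> \<le> 1 * \<beta> i" by (rule mult_right_mono) auto
      finally show "degree ([:x i, u i:] ^ \<beta> i) \<le> \<beta> i" by simp
    qed
    finally show ?thesis using that by (simp add: mindices_def)
  qed
  have val: "poly (P \<beta>) t = mpow d (line d x u t) \<beta>" for \<beta> t
    unfolding P_def mpow_def poly_prod by (intro prod.cong) auto
  let ?p = "\<Sum>\<beta>\<in>mindices d k. smult (c \<beta>) (P \<beta>)"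
  have "degree ?p \<le> k" by (intro degree_sum_le) (auto intro: deg)
  moreover have "poly ?p t = hform d k c (line d x u t)" for t
    by (simp add: poly_sum hform_def val)
  ultimately show ?thesis by blast
qed

text \<open>On the line the form is a polynomial of degree at most k, so its difference of order k +
  1 vanishes. The value at x has coefficient 1 there and is expressed by the others.\<close>

lemma hform_difference:
  assumes x: "x \<in> Rd d"
  shows "\<bar>hform d k c x\<bar> \<le> (\<Sum>i=1..Suc k. real (Suc k choose i) * \<bar>hform d k c (line d x u (real i))\<bar>)"
proof -
  obtain p where p: "degree p \<le> k" "\<And>t. poly p t = hform d k c (line d x u t)"
    using hform_line_poly by blast
  let ?g = "\<lambda>i. (-1) ^ i * real (Suc k choose i) * poly p (real i)"
  have "(\<Sum>i\<le>Suc k. ?g i) = 0"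
    by (rule alternating_binomial_poly) (use p(1) in \<open>auto intro: coeff_eq_0\<close>)
  moreover have "{..Suc k} = insert 0 {1..Suc k}" by auto
  ultimately have "poly p 0 = - (\<Sum>i=1..Suc k. ?g i)" by simp
  also have "\<bar>\<dots>\<bar> \<le> (\<Sum>i=1..Suc k. \<bar>?g i\<bar>)" unfolding abs_minus_cancel by (rule sum_abs)
  also have "\<dots> = (\<Sum>i=1..Suc k. real (Suc k choose i) * \<bar>hform d k c (line d x u (real i))\<bar>)"
    by (simp add: abs_mult p(2))
  finally show ?thesis using line_0[OF x, of u] by (simp add: p(2))
qed

lemma mpow_measurable [measurable]: "(\<lambda>x. mpow d x \<beta>) \<in> borel_measurable (lebd d)"
  unfolding mpow_def by (intro borel_measurable_prod borel_measurable_power) auto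

lemma hform_measurable [measurable]: "hform d k c \<in> borel_measurable (lebd d)"
  unfolding hform_def[abs_def] by measurable

text \<open>The difference inequality is averaged over increments u in a small cube. The choice of
  \<eta> keeps x + i u within r / 4 of x and hence in the ball, the substitution by x + i u costs no
  factor because i^d >= 1, and the binomial coefficients sum to at most 2^(k + 1).\<close>

lemma hform_le_L1:
  fixes k :: nat
  assumes d: "d \<ge> 1" and r: "r > 0" and x: "x \<in> cballd d (r / 2)"
  defines "\<eta> \<equiv> r / (4 * (real k + 1) * d)"
  shows "ennreal (\<eta> ^ d * \<bar>hform d k c x\<bar>) \<le> 2 ^ Suc k * (\<integral>\<^sup>+y\<in>oballd d r. ennreal \<bar>hform d k c y\<bar> \<partial>lebd d)"
proof -
  let ?q = "hform d k c" and ?B = "oballd d r"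
  define Q where "Q = PiE {..<d} (\<lambda>i. {0..\<eta>})"
  have \<eta>: "\<eta> > 0" using d r by (simp add: \<eta>_def)
  have xR: "x \<in> Rd d" "norm2 d x \<le> r / 2" using x by (auto simp: cballd_def)
  have inB: "line d x u (real i) \<in> ?B" if u: "u \<in> Q" and i: "i \<in> {1..Suc k}" for u i
  proof -
    have "norm2 d (line d x u (real i)) = norm2 d (\<lambda>j. x j + real i * u j)" by (rule norm2_cong) simp
    also have "\<dots> \<le> norm2 d x + norm2 d (\<lambda>j. real i * u j)" by (rule norm2_triangle)
    also have "norm2 d (\<lambda>j. real i * u j) \<le> (\<Sum>j<d. \<bar>real i * u j\<bar>)" unfolding norm2_L2 by (rule L2_set_le_sum_abs)
    also have "\<dots> \<le> (\<Sum>j<d. (real k + 1) * \<eta>)"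
    proof (rule sum_mono)
      fix j assume "j \<in> {..<d}"
      then have "0 \<le> u j" "u j \<le> \<eta>" using u by (auto simp: Q_def PiE_def Pi_def)
      then show "\<bar>real i * u j\<bar> \<le> (real k + 1) * \<eta>" unfolding abs_mult using i by (intro mult_mono) auto
    qed
    also have "\<dots> = r / 4"
    proof -
      define a where "a = real k + 1"
      have "a > 0" by (simp add: a_def)
      then show ?thesis using d by (simp add: \<eta>_def flip: a_def)
    qed
    finally have "norm2 d (line d x u (real i)) \<le> 3 / 4 * r" using xR(2) by simp
    also have "\<dots> < r" using r by simp
    finally show ?thesis by (simp add: oballd_def)
  qed
  have lm: "(\<lambda>u. line d x u t) \<in> measurable (lebd d) (lebd d)" for t
  proof (rule measurable_lebdI)
    fix i assume i: "i < d"
    then show "(\<lambda>u. line d x u t i) \<in> borel_measurable (lebd d)" by simp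
  qed simp
  have qm: "(\<lambda>y. ennreal \<bar>?q y\<bar> * indicator ?B y) \<in> borel_measurable (lebd d)" by measurable
  have cell_le: "(\<integral>\<^sup>+u\<in>Q. ennreal \<bar>?q (line d x u (real i))\<bar> \<partial>lebd d) \<le> (\<integral>\<^sup>+y\<in>?B. ennreal \<bar>?q y\<bar> \<partial>lebd d)"
    if i: "i \<in> {1..Suc k}" for i
  proof -
    have "(\<integral>\<^sup>+u\<in>Q. ennreal \<bar>?q (line d x u (real i))\<bar> \<partial>lebd d)
        \<le> (\<integral>\<^sup>+u. (\<lambda>y. ennreal \<bar>?q y\<bar> * indicator ?B y) (line d x u (real i)) \<partial>lebd d)"
      by (intro nn_integral_mono) (use inB[OF _ i] in \<open>auto simp: indicator_def\<close>)
    also have "\<dots> = 1 * \<dots>" by simp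
    also have "\<dots> \<le> ennreal (\<bar>real i\<bar> ^ d) * (\<integral>\<^sup>+u. (\<lambda>y. ennreal \<bar>?q y\<bar> * indicator ?B y) (line d x u (real i)) \<partial>lebd d)"
      by (rule mult_right_mono) (use i in \<open>auto simp: one_le_power\<close>)
    also have "\<dots> = (\<integral>\<^sup>+y. ennreal \<bar>?q y\<bar> * indicator ?B y \<partial>lebd d)"
      by (rule nn_integral_lebd_affine[OF qm]) (use i in auto)
    finally show ?thesis .
  qed
  have "ennreal (\<eta> ^ d * \<bar>?q x\<bar>) = ennreal \<bar>?q x\<bar> * emeasure (lebd d) Q"
    using \<eta> emeasure_lebd_box[of d "\<lambda>_. 0" "\<lambda>_. \<eta>"] by (simp add: Q_def ennreal_mult mult.commute)
  also have "\<dots> = (\<integral>\<^sup>+u\<in>Q. ennreal \<bar>?q x\<bar> \<partial>lebd d)"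
    by (simp add: nn_integral_cmult_indicator Q_def)
  also have "\<dots> \<le> (\<integral>\<^sup>+u\<in>Q. (\<Sum>i=1..Suc k. ennreal (real (Suc k choose i)) * ennreal \<bar>?q (line d x u (real i))\<bar>) \<partial>lebd d)"
  proof (intro nn_integral_mono mult_right_mono)
    fix u
    have "ennreal \<bar>?q x\<bar> \<le> ennreal (\<Sum>i=1..Suc k. real (Suc k choose i) * \<bar>?q (line d x u (real i))\<bar>)"
      by (rule ennreal_leI[OF hform_difference[OF xR(1)]])
    also have "\<dots> = (\<Sum>i=1..Suc k. ennreal (real (Suc k choose i)) * ennreal \<bar>?q (line d x u (real i))\<bar>)"
      by (subst sum_ennreal[symmetric]) (auto simp: ennreal_mult)
    finally show "ennreal \<bar>?q x\<bar> \<le> \<dots>" .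
  qed simp
  also have "\<dots> = (\<integral>\<^sup>+u. (\<Sum>i=1..Suc k. ennreal (real (Suc k choose i)) * (ennreal \<bar>?q (line d x u (real i))\<bar> * indicator Q u)) \<partial>lebd d)"
    by (simp only: sum_distrib_right mult.assoc)
  also have "\<dots> = (\<Sum>i=1..Suc k. ennreal (real (Suc k choose i)) * (\<integral>\<^sup>+u\<in>Q. ennreal \<bar>?q (line d x u (real i))\<bar> \<partial>lebd d))"
  proof -
    have m: "(\<lambda>u. ennreal \<bar>?q (line d x u (real i))\<bar> * indicator Q u) \<in> borel_measurable (lebd d)" for i
    proof -
      have [measurable]: "(\<lambda>u. ?q (line d x u (real i))) \<in> borel_measurable (lebd d)"
        by (rule measurable_compose[OF lm hform_measurable])
      have [measurable]: "Q \<in> sets (lebd d)" by (simp add: Q_def)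
      show ?thesis by measurable
    qed
    show ?thesis
      by (subst nn_integral_sum) (use m in \<open>auto intro!: sum.cong nn_integral_cmult\<close>)
  qed
  also have "\<dots> \<le> (\<Sum>i=1..Suc k. ennreal (real (Suc k choose i)) * (\<integral>\<^sup>+y\<in>?B. ennreal \<bar>?q y\<bar> \<partial>lebd d))"
    by (intro sum_mono mult_left_mono cell_le) auto
  also have "\<dots> = ennreal (\<Sum>i=1..Suc k. real (Suc k choose i)) * (\<integral>\<^sup>+y\<in>?B. ennreal \<bar>?q y\<bar> \<partial>lebd d)"
    by (simp only: sum_distrib_right[symmetric]) (subst sum_ennreal, auto)
  also have "\<dots> \<le> 2 ^ Suc k * (\<integral>\<^sup>+y\<in>?B. ennreal \<bar>?q y\<bar> \<partial>lebd d)"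
  proof (rule mult_right_mono)
    have "(\<Sum>i=1..Suc k. (Suc k choose i)) \<le> (\<Sum>i\<le>Suc k. (Suc k choose i))"
      by (rule sum_mono2) auto
    also have "\<dots> = 2 ^ Suc k" by (rule choose_row_sum)
    finally have "(\<Sum>i=1..Suc k. real (Suc k choose i)) \<le> 2 ^ Suc k"
      by (metis of_nat_le_iff of_nat_numeral of_nat_power of_nat_sum)
    then have "ennreal (\<Sum>i=1..Suc k. real (Suc k choose i)) \<le> ennreal (2 ^ Suc k)" by (rule ennreal_leI)
    also have "ennreal (2 ^ Suc k) = 2 ^ Suc k" by (metis ennreal_numeral ennreal_power zero_le_numeral)
    finally show "ennreal (\<Sum>i=1..Suc k. real (Suc k choose i)) \<le> 2 ^ Suc k" .
  qed simp
  finally show ?thesis .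
qed

subsection \<open>The integral class on the ball\<close>

lemma continuous_on_coord: "continuous_on S (\<lambda>x::nat \<Rightarrow> real. x i)"
  by (rule continuous_on_subset[OF continuous_on_product_coordinates]) simp

lemma continuous_on_norm2: "continuous_on S (norm2 d)"
  unfolding norm2_def[abs_def] by (intro continuous_intros continuous_on_coord)

lemma continuous_on_mpow: "continuous_on S (\<lambda>x. mpow d x \<beta>)"
  unfolding mpow_def by (intro continuous_intros continuous_on_coord)

lemma continuous_on_mpoly: "continuous_on S (mpoly d k c)"
  unfolding mpoly_def[abs_def] by (intro continuous_intros continuous_on_mpow)

lemma (in smooth_fun) cont_f: "continuous_on U f"
  using cont[of "[]"] by simp

lemma continuous_on_ndiff:
  assumes S: "smooth_fun d (oballd d R) K f"
  shows "continuous_on (pball d R) (\<lambda>y. \<bar>ndiff d k f y\<bar>)"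
proof -
  interpret smooth_fun d "oballd d R" K f by (rule S)
  have sub: "pball d R \<subseteq> oballd d R" by (auto simp: pball_def)
  have "continuous_on (pball d R) (\<lambda>y. tform d f k y (\<lambda>i. y i / norm2 d y))"
    unfolding tform_def mpow_def
    by (intro continuous_intros continuous_on_subset[OF cont_Dmulti sub] continuous_on_coord continuous_on_norm2)
       (auto simp: pball_iff less_imp_neq[OF mfact_pos, symmetric])
  then have "continuous_on (pball d R) (\<lambda>y. ndiff d k f y)"
    by (rule continuous_on_cong[THEN iffD1, rotated 2]) (use sub in \<open>auto simp: ndiff_eq\<close>)
  then show ?thesis by (intro continuous_intros)
qed

text \<open>In the integral form of the remainder the kernel is bounded by R^(k - 1) / (k - 1)! and
  the range is extended from the norm of x to R. The bound then depends on x through its direction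
  only, which makes averages over directions applicable.\<close>

lemma remainder_le_ray_integral:
  assumes S: "smooth_fun d (oballd d R) K f" and x: "x \<in> pball d R" and k: "k > 0"
  shows "ennreal \<bar>f x - mpoly d k (tcoef d f) x\<bar>
     \<le> ennreal (R ^ (k - 1) / fact (k - 1)) * (\<integral>\<^sup>+s\<in>{0<..<R}. ennreal \<bar>ndiff d k f (sproj d s x)\<bar> \<partial>lborel)"
proof -
  interpret smooth_fun d "oballd d R" K f by (rule S)
  define b where "b = norm2 d x"
  have xR: "x \<in> Rd d" and b: "0 < b" "b < R" using x by (auto simp: pball_iff b_def)
  let ?v = "\<lambda>i. x i / b"
  have ray: "ray d ?v s = sproj d s x" for s by (simp add: sproj_eq_ray b_def)
  have L: "ray d ?v t \<in> oballd d R" if "0 \<le> t" "t \<le> b" for t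
    using that b norm2_sproj[of d x t] unfolding ray by (simp add: oballd_def b_def[symmetric]) (simp add: sproj_def)
  define Df where "Df m s = tform d f m (ray d ?v s) ?v" for m s
  have D: "(Df m has_real_derivative Df (Suc m) t) (at t)" if "0 \<le> t" "t \<le> b" for m t
    unfolding Df_def by (rule DERIV_tform[OF L[OF that]])
  define i where "i s = ((b - s) ^ (k - 1) / fact (k - 1)) * Df k s" for s
  have Df0: "Df 0 = (\<lambda>s. f (ray d ?v s))" by (rule ext) (simp add: Df_def tform_0)
  have "f (ray d ?v b) = (\<Sum>m<k. ((b - 0) ^ m / fact m) *\<^sub>R Df m 0) + integral {0..b} (\<lambda>s. ((b - s) ^ (k - 1) / fact (k - 1)) *\<^sub>R Df k s)"
    by (rule Taylor_integral[where Df = Df and f = "\<lambda>s. f (ray d ?v s)" and a = 0 and b = b, OF k Df0])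
       (use D b in \<open>auto intro: has_field_derivative_at_within simp: has_real_derivative_iff_has_vector_derivative[symmetric]\<close>)
  moreover have "ray d ?v b = x" unfolding ray using sproj_self[OF xR] b by (simp add: b_def)
  moreover have "((b - 0) ^ m / fact m) *\<^sub>R Df m 0 = tform d f m (zerod d) x / fact m" for m
    using taylor_direction[of d x f m] b by (simp add: Df_def ray_0 b_def mult.commute)
  ultimately have rem: "f x - mpoly d k (tcoef d f) x = integral {0..b} i"
    by (simp add: mpoly_taylor i_def[abs_def])
  have "continuous_on {0..b} (Df k)"
    by (intro continuous_at_imp_continuous_on ballI DERIV_isCont[OF D]) auto
  then have "continuous_on {0..b} i" unfolding i_def by (intro continuous_intros) auto
  then have si: "set_integrable lborel {0..b} i" by (rule borel_integrable_atLeastAtMost')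
  have "ennreal \<bar>f x - mpoly d k (tcoef d f) x\<bar> = ennreal (norm (LINT s:{0..b}|lborel. i s))"
    unfolding rem set_borel_integral_eq_integral(2)[OF si] by simp
  also have "\<dots> \<le> (\<integral>\<^sup>+s. norm (indicator {0..b} s *\<^sub>R i s) \<partial>lborel)"
    unfolding set_lebesgue_integral_def
    by (rule integral_norm_bound_ennreal) (use si in \<open>simp add: set_integrable_def\<close>)
  also have "\<dots> \<le> (\<integral>\<^sup>+s. ennreal (R ^ (k - 1) / fact (k - 1)) * (ennreal \<bar>ndiff d k f (sproj d s x)\<bar> * indicator {0<..<R} s) \<partial>lborel)"
  proof (rule nn_integral_mono_AE)
    show "AE s in lborel. ennreal (norm (indicator {0..b} s *\<^sub>R i s))
        \<le> ennreal (R ^ (k - 1) / fact (k - 1)) * (ennreal \<bar>ndiff d k f (sproj d s x)\<bar> * indicator {0<..<R} s)"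
      \<comment> \<open>The parameter s = 0 gives the origin, which has no normal direction; it is
        discarded as a null set.\<close>
      using AE_lborel_singleton[of "0::real"]
    proof eventually_elim
      case (elim s)
      show ?case
      proof (cases "s \<in> {0..b}")
        case True
        then have s: "0 < s" "s \<le> b" "s < R" using elim b by auto
        have "Df k s = ndiff d k f (sproj d s x)"
          using tform_sproj[OF S _ s(1,3), of x k] b unfolding Df_def ray unfolding b_def by simp
        then have "\<bar>i s\<bar> = (b - s) ^ (k - 1) / fact (k - 1) * \<bar>ndiff d k f (sproj d s x)\<bar>"
          using s by (simp add: i_def abs_mult)
        also have "\<dots> \<le> R ^ (k - 1) / fact (k - 1) * \<bar>ndiff d k f (sproj d s x)\<bar>"
          using s b by (intro mult_right_mono divide_right_mono power_mono) auto
        finally have "ennreal \<bar>i s\<bar> \<le> ennreal (R ^ (k - 1) / fact (k - 1)) * ennreal \<bar>ndiff d k f (sproj d s x)\<bar>"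
          using b by (subst ennreal_mult[symmetric]) (auto intro: ennreal_leI)
        then show ?thesis using s True by simp
      qed simp
    qed
  qed
  also have "\<dots> = ennreal (R ^ (k - 1) / fact (k - 1)) * (\<integral>\<^sup>+s\<in>{0<..<R}. ennreal \<bar>ndiff d k f (sproj d s x)\<bar> \<partial>lborel)"
  proof (rule nn_integral_cmult)
    have N: "(\<lambda>y. indicator (pball d R) y * \<bar>ndiff d k f y\<bar>) \<in> borel_measurable (lebd d)"
      by (rule borel_measurable_cont_lebd[OF pball_sets continuous_on_ndiff[OF S]])
    define h where "h s = indicator (pball d R) (sproj d s x) * \<bar>ndiff d k f (sproj d s x)\<bar>" for s
    have "(\<lambda>s. (s, x)) \<in> measurable borel (borel \<Otimes>\<^sub>M lebd d)" using xR by simp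
    from measurable_compose[OF measurable_compose[OF this sproj_measurable] N]
    have "h \<in> borel_measurable borel" unfolding h_def by simp
    then have "(\<lambda>s. ennreal (h s) * indicator {0<..<R} s) \<in> borel_measurable lborel"
      by (intro borel_measurable_times_ennreal measurable_compose[OF _ measurable_ennreal] borel_measurable_indicator) auto
    moreover have "ennreal (h s) * indicator {0<..<R} s = ennreal \<bar>ndiff d k f (sproj d s x)\<bar> * indicator {0<..<R} s" for s
      using norm2_sproj[of d x s] b by (auto simp: h_def indicator_def pball_iff b_def sproj_def)
    ultimately show "(\<lambda>s. ennreal \<bar>ndiff d k f (sproj d s x)\<bar> * indicator {0<..<R} s) \<in> borel_measurable lborel" by simp
  qed
  finally show ?thesis .
qed

text \<open>The ray estimate is integrated over the ball and the integrations are exchanged. For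
  fixed s the integral over directions is at most the average over the sphere, as the volume is at
  most one, and the class bounds the integral over s by 1.\<close>

lemma F3_remainder_L1:
  assumes d: "d \<ge> 1" and r: "R > 0" and one: "emeasure (lebd d) (cballd d R) = 1"
    and f: "f \<in> F3 d R" and k: "k > 0"
  shows "(\<integral>\<^sup>+x\<in>oballd d R. ennreal \<bar>f x - mpoly d k (tcoef d f) x\<bar> \<partial>lebd d) \<le> ennreal (R ^ (k - 1) / fact (k - 1))"
proof -
  let ?c = "ennreal (R ^ (k - 1) / fact (k - 1))" and ?W = "pball d R"
  have S: "smooth_fun d (oballd d R) (cballd d R) f" using f by (intro ball_smooth) (simp add: F3_def)
  interpret smooth_fun d "oballd d R" "cballd d R" f by (rule S)
  interpret L: sigma_finite_measure "lebd d" by (rule sigma_finite_lebd)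
  interpret P: pair_sigma_finite lborel "lebd d" ..
  \<comment> \<open>The normal derivative is cut off to the punctured ball, where it is continuous;
    this makes the integrand jointly measurable in s and x.\<close>
  define N where "N y = indicator ?W y * \<bar>ndiff d k f y\<bar>" for y
  have Nm: "N \<in> borel_measurable (lebd d)"
    unfolding N_def by (rule borel_measurable_cont_lebd[OF pball_sets continuous_on_ndiff[OF S]])
  have Ns: "N (sproj d s x) = \<bar>ndiff d k f (sproj d s x)\<bar>" if "x \<in> ?W" "s \<in> {0<..<R}" for s x
    using norm2_sproj[of d x s] that by (auto simp: N_def indicator_def pball_iff sproj_def)
  have jm: "(\<lambda>p. ennreal (N (sproj d (fst p) (snd p))) * indicator {0<..<R} (fst p) * indicator ?W (snd p))
     \<in> borel_measurable (lborel \<Otimes>\<^sub>M lebd d)"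
  proof -
    have "(\<lambda>(s, x). sproj d s x) \<in> measurable (lborel \<Otimes>\<^sub>M lebd d) (lebd d)"
      using sproj_measurable[of d] by (simp cong: measurable_cong_sets)
    from measurable_compose[OF this Nm]
    have [measurable]: "(\<lambda>p. N (sproj d (fst p) (snd p))) \<in> borel_measurable (lborel \<Otimes>\<^sub>M lebd d)"
      by (simp add: split_def)
    show ?thesis by measurable
  qed
  have "(\<integral>\<^sup>+x\<in>oballd d R. ennreal \<bar>f x - mpoly d k (tcoef d f) x\<bar> \<partial>lebd d)
    \<le> (\<integral>\<^sup>+x. ?c * (\<integral>\<^sup>+s. ennreal (N (sproj d s x)) * indicator {0<..<R} s * indicator ?W x \<partial>lborel) \<partial>lebd d)"
  proof (rule nn_integral_mono)
    fix x assume "x \<in> space (lebd d)"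
    show "ennreal \<bar>f x - mpoly d k (tcoef d f) x\<bar> * indicator (oballd d R) x
       \<le> ?c * (\<integral>\<^sup>+s. ennreal (N (sproj d s x)) * indicator {0<..<R} s * indicator ?W x \<partial>lborel)"
    proof (cases "x \<in> ?W")
      case True
      have "ennreal \<bar>f x - mpoly d k (tcoef d f) x\<bar> * indicator (oballd d R) x \<le> ennreal \<bar>f x - mpoly d k (tcoef d f) x\<bar>"
        by (simp add: indicator_def)
      also have "\<dots> \<le> ?c * (\<integral>\<^sup>+s\<in>{0<..<R}. ennreal \<bar>ndiff d k f (sproj d s x)\<bar> \<partial>lborel)"
        by (rule remainder_le_ray_integral[OF S True k])
      also have "(\<integral>\<^sup>+s\<in>{0<..<R}. ennreal \<bar>ndiff d k f (sproj d s x)\<bar> \<partial>lborel) = (\<integral>\<^sup>+s. ennreal (N (sproj d s x)) * indicator {0<..<R} s * indicator ?W x \<partial>lborel)"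
        by (intro nn_integral_cong) (auto simp: indicator_def Ns[OF True] True)
      finally show ?thesis .
    next
      case False
      \<comment> \<open>At the origin the remainder is zero, outside the ball the indicator
        is.\<close>
      then show ?thesis using mpoly_taylor_0[OF k, of d f] by (auto simp: indicator_def pball_def)
    qed
  qed
  also have "\<dots> = ?c * (\<integral>\<^sup>+x. (\<integral>\<^sup>+s. ennreal (N (sproj d s x)) * indicator {0<..<R} s * indicator ?W x \<partial>lborel) \<partial>lebd d)"
  proof (rule nn_integral_cmult)
    have "(\<lambda>p. ennreal (N (sproj d (snd p) (fst p))) * indicator {0<..<R} (snd p) * indicator ?W (fst p))
       \<in> borel_measurable (lebd d \<Otimes>\<^sub>M lborel)"
      using measurable_compose[OF measurable_pair_swap' jm] by (simp add: split_def)
    then show "(\<lambda>x. \<integral>\<^sup>+s. ennreal (N (sproj d s x)) * indicator {0<..<R} s * indicator ?W x \<partial>lborel) \<in> borel_measurable (lebd d)"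
      by (intro lborel.borel_measurable_nn_integral) (simp add: split_def)
  qed
  also have "(\<integral>\<^sup>+x. (\<integral>\<^sup>+s. ennreal (N (sproj d s x)) * indicator {0<..<R} s * indicator ?W x \<partial>lborel) \<partial>lebd d)
     = (\<integral>\<^sup>+s. (\<integral>\<^sup>+x. ennreal (N (sproj d s x)) * indicator {0<..<R} s * indicator ?W x \<partial>lebd d) \<partial>lborel)"
    by (rule P.Fubini') (use jm in \<open>simp add: split_def\<close>)
  also have "\<dots> \<le> (\<integral>\<^sup>+s\<in>{0<..<R}. sph_avg d (ndiff d k f) s \<partial>lborel)"
  proof (rule nn_integral_mono)
    fix s :: real
    show "(\<integral>\<^sup>+x. ennreal (N (sproj d s x)) * indicator {0<..<R} s * indicator ?W x \<partial>lebd d) \<le> sph_avg d (ndiff d k f) s * indicator {0<..<R} s"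
    proof (cases "s \<in> {0<..<R}")
      case True
      have sub: "sphered d s \<subseteq> ?W" using True by (auto simp: sphered_def pball_iff)
      have "(\<integral>\<^sup>+x. ennreal (N (sproj d s x)) * indicator {0<..<R} s * indicator ?W x \<partial>lebd d)
         = (\<integral>\<^sup>+x\<in>?W. ennreal \<bar>ndiff d k f (sproj d s x)\<bar> \<partial>lebd d)"
        by (intro nn_integral_cong) (use True in \<open>auto simp: indicator_def Ns\<close>)
      also have "\<dots> \<le> emeasure (lebd d) ?W * sph_avg d (ndiff d k f) s"
        unfolding sph_avg_def
        by (rule nn_integral_direction_le_sphere_avg[OF d, where G = "\<lambda>y. \<bar>ndiff d k f y\<bar>"])
           (use True continuous_on_subset[OF continuous_on_ndiff[OF S] sub] in auto)
      also have "\<dots> \<le> 1 * sph_avg d (ndiff d k f) s"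
      proof (rule mult_right_mono)
        have "?W \<subseteq> cballd d R" by (auto simp: pball_iff cballd_def)
        then show "emeasure (lebd d) ?W \<le> 1" using emeasure_mono[of ?W "cballd d R" "lebd d"] one by simp
      qed simp
      finally show ?thesis using True by simp
    qed simp
  qed
  also have "\<dots> \<le> 1" using f by (simp add: F3_def)
  finally show ?thesis by (simp add: mult_left_mono)
qed

lemma hform_tcoef_remainder:
  "hform d j (tcoef d f) x = (f x - mpoly d j (tcoef d f) x) - (f x - mpoly d (Suc j) (tcoef d f) x)"
  by (simp add: mpoly_hform)

lemma remainder_measurable:
  assumes S: "smooth_fun d (oballd d R) K f"
  shows "(\<lambda>x. ennreal \<bar>f x - mpoly d k c x\<bar> * indicator (oballd d R) x) \<in> borel_measurable (lebd d)"
proof -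
  interpret smooth_fun d "oballd d R" K f by (rule S)
  have "continuous_on (oballd d R) (\<lambda>x. f x - mpoly d k c x)"
    by (intro continuous_on_diff cont_f continuous_on_mpoly)
  from borel_measurable_cont_lebd[OF oballd_sets this]
  have "(\<lambda>x. ennreal \<bar>indicator (oballd d R) x * (f x - mpoly d k c x)\<bar>) \<in> borel_measurable (lebd d)" by measurable
  moreover have "ennreal \<bar>indicator (oballd d R) x * (f x - mpoly d k c x)\<bar> = ennreal \<bar>f x - mpoly d k c x\<bar> * indicator (oballd d R) x" for x
    by (simp add: indicator_def)
  ultimately show ?thesis by simp
qed

text \<open>A form is the difference of two consecutive remainders, whose L1 norms are at most R^n /
  n! with n = j - 1 and n = j.\<close>

lemma F3_form_L1:
  assumes d: "d \<ge> 1" and r: "R > 0" and one: "emeasure (lebd d) (cballd d R) = 1"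
    and f: "f \<in> F3 d R" and j: "j > 0"
  shows "(\<integral>\<^sup>+x\<in>oballd d R. ennreal \<bar>hform d j (tcoef d f) x\<bar> \<partial>lebd d) \<le> ennreal (2 * max 1 R ^ j)"
proof -
  let ?r = "\<lambda>k x. f x - mpoly d k (tcoef d f) x" and ?B = "oballd d R"
  have S: "smooth_fun d (oballd d R) (cballd d R) f" using f by (intro ball_smooth) (simp add: F3_def)
  have bound: "R ^ n / fact n \<le> max 1 R ^ j" if "n \<le> j" for n
  proof -
    have "R ^ n / fact n \<le> R ^ n / 1" using r by (intro divide_left_mono) auto
    also have "\<dots> \<le> max 1 R ^ n" using r by (simp add: power_mono)
    also have "\<dots> \<le> max 1 R ^ j" by (rule power_increasing[OF that]) simp
    finally show ?thesis .
  qed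
  have "(\<integral>\<^sup>+x\<in>?B. ennreal \<bar>hform d j (tcoef d f) x\<bar> \<partial>lebd d)
     \<le> (\<integral>\<^sup>+x. ennreal \<bar>?r j x\<bar> * indicator ?B x + ennreal \<bar>?r (Suc j) x\<bar> * indicator ?B x \<partial>lebd d)"
  proof (rule nn_integral_mono)
    fix x
    have "ennreal \<bar>hform d j (tcoef d f) x\<bar> \<le> ennreal (\<bar>?r j x\<bar> + \<bar>?r (Suc j) x\<bar>)"
      unfolding hform_tcoef_remainder by (rule ennreal_leI) (rule abs_triangle_ineq4)
    then show "ennreal \<bar>hform d j (tcoef d f) x\<bar> * indicator ?B x \<le> ennreal \<bar>?r j x\<bar> * indicator ?B x + ennreal \<bar>?r (Suc j) x\<bar> * indicator ?B x"
      by (simp add: indicator_def)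
  qed
  also have "\<dots> = (\<integral>\<^sup>+x\<in>?B. ennreal \<bar>?r j x\<bar> \<partial>lebd d) + (\<integral>\<^sup>+x\<in>?B. ennreal \<bar>?r (Suc j) x\<bar> \<partial>lebd d)"
    by (rule nn_integral_add) (rule remainder_measurable[OF S])+
  also have "\<dots> \<le> ennreal (R ^ (j - 1) / fact (j - 1)) + ennreal (R ^ (Suc j - 1) / fact (Suc j - 1))"
    by (intro add_mono F3_remainder_L1[OF d r one f]) (use j in auto)
  also have "\<dots> \<le> ennreal (max 1 R ^ j) + ennreal (max 1 R ^ j)"
    by (intro add_mono ennreal_leI bound) auto
  also have "\<dots> = ennreal (2 * max 1 R ^ j)" by (simp flip: ennreal_plus)
  finally show ?thesis .
qed

text \<open>The L1 bound becomes a pointwise one on the ball of radius R / 2, and homogeneity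
  extends it to all x. The loss (j + 1)^d is estimated by 2^(j d), so that the dependence on j is
  geometric and the forms are summable near the origin.\<close>

lemma F3_form_bound:
  assumes d: "d \<ge> 1" and r: "R > 0" and one: "emeasure (lebd d) (cballd d R) = 1"
    and f: "f \<in> F3 d R" and j: "j > 0" and x: "x \<in> Rd d"
  shows "\<bar>hform d j (tcoef d f) x\<bar> \<le> 4 * (4 * d / R) ^ d * (2 * (2 * max 1 R * 2 ^ d) / R * norm2 d x) ^ j"
proof -
  let ?q = "hform d j (tcoef d f)"
  define A where "A = 4 * (4 * real d / R) ^ d"
  define B where "B = 2 * max 1 R * 2 ^ d"
  have half: "\<bar>?q y\<bar> \<le> A * B ^ j" if y: "y \<in> cballd d (R / 2)" for y
  proof -
    define \<eta> where "\<eta> = R / (4 * (real j + 1) * d)"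
    have \<eta>: "\<eta> > 0" using d r by (simp add: \<eta>_def)
    have "ennreal (\<eta> ^ d * \<bar>?q y\<bar>) \<le> 2 ^ Suc j * (\<integral>\<^sup>+y\<in>oballd d R. ennreal \<bar>?q y\<bar> \<partial>lebd d)"
      unfolding \<eta>_def by (rule hform_le_L1[OF d r y])
    also have "\<dots> \<le> 2 ^ Suc j * ennreal (2 * max 1 R ^ j)"
      by (intro mult_left_mono F3_form_L1[OF d r one f j]) simp
    also have "\<dots> = ennreal (2 ^ Suc j * (2 * max 1 R ^ j))"
    proof -
      have "(2::ennreal) ^ Suc j = ennreal (2 ^ Suc j)" by (metis ennreal_numeral ennreal_power zero_le_numeral)
      then show ?thesis by (simp only:) (rule ennreal_mult[symmetric], auto)
    qed
    finally have "\<eta> ^ d * \<bar>?q y\<bar> \<le> 2 ^ Suc j * (2 * max 1 R ^ j)"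
      by (subst (asm) ennreal_le_iff) auto
    then have "\<bar>?q y\<bar> \<le> 2 ^ Suc j * (2 * max 1 R ^ j) / \<eta> ^ d"
      using \<eta> by (simp add: pos_le_divide_eq mult.commute)
    also have "\<dots> = 2 ^ Suc j * (2 * max 1 R ^ j) * (4 * d / R) ^ d * (real j + 1) ^ d"
    proof -
      have "1 / \<eta> = (4 * d / R) * (real j + 1)" using d r by (simp add: \<eta>_def field_simps)
      then have e: "1 / \<eta> ^ d = (4 * d / R) ^ d * (real j + 1) ^ d"
        by (metis power_one_over power_mult_distrib)
      have "2 ^ Suc j * (2 * max 1 R ^ j) / \<eta> ^ d = 2 ^ Suc j * (2 * max 1 R ^ j) * (1 / \<eta> ^ d)" by simp
      then show ?thesis by (simp only: e mult.assoc)
    qed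
    also have "\<dots> \<le> 2 ^ Suc j * (2 * max 1 R ^ j) * (4 * d / R) ^ d * (2 ^ j) ^ d"
    proof (intro mult_left_mono power_mono)
      have "Suc j \<le> 2 ^ j" by (rule Suc_leI[OF less_exp])
      then show "real j + 1 \<le> 2 ^ j" by (metis of_nat_Suc of_nat_le_iff of_nat_numeral of_nat_power add.commute)
    qed (use r in auto)
    also have "\<dots> = A * B ^ j"
      by (simp add: A_def B_def power_mult_distrib power_mult[symmetric] mult.commute[of j d] mult_ac)
    finally show ?thesis .
  qed
  have "\<bar>?q x\<bar> \<le> A * (2 * B / R * norm2 d x) ^ j"
  proof (cases "norm2 d x = 0")
    case True
    then have "x = zerod d" using norm2_zero_iff[OF x] by simp
    then have "?q x = 0 ^ j * ?q x" by (intro hform_scale) simp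
    then have "?q x = 0" using j by (simp add: power_0_left)
    then show ?thesis using True j by (simp add: power_0_left)
  next
    case False
    then have x0: "norm2 d x > 0" using norm2_nonneg[of d x] by linarith
    define y where "y = ray d x (R / 2 / norm2 d x)"
    have "norm2 d y = R / 2" using x0 r by (simp add: y_def norm2_ray)
    then have "y \<in> cballd d (R / 2)" by (simp add: cballd_def y_def)
    then have "\<bar>?q y\<bar> \<le> A * B ^ j" by (rule half)
    moreover have "?q x = (norm2 d x / (R / 2)) ^ j * ?q y"
      by (rule hform_scale) (use x0 r in \<open>simp add: y_def\<close>)
    ultimately have "\<bar>?q x\<bar> \<le> (norm2 d x / (R / 2)) ^ j * (A * B ^ j)"
      using r by (simp add: abs_mult mult_left_mono)
    also have "\<dots> = A * (2 * B / R * norm2 d x) ^ j"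
      by (simp add: power_mult_distrib power_divide)
    finally show ?thesis .
  qed
  then show ?thesis by (simp add: A_def B_def)
qed

lemma geometric_sum_le:
  fixes z :: real
  assumes "0 \<le> z" "z \<le> 1/2"
  shows "(\<Sum>j=k..<m. z ^ j) \<le> 2 * z ^ k"
proof -
  have "(\<Sum>j<n. z ^ j) \<le> 2 - 2 * z ^ n" for n
  proof (induction n)
    case (Suc n)
    have "2 * z * z ^ n \<le> 1 * z ^ n" using assms by (intro mult_right_mono) auto
    then show ?case using Suc by simp
  qed simp
  moreover have "z ^ n \<ge> 0" for n using assms by simp
  ultimately have le2: "(\<Sum>j<n. z ^ j) \<le> 2" for n by (smt (verit))
  show ?thesis
  proof (cases "k \<le> m")
    case True
    have "(\<Sum>j=k..<m. z ^ j) = (\<Sum>j<m - k. z ^ (j + k))"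
      using True sum.shift_bounds_nat_ivl[of "\<lambda>j. z ^ j" 0 k "m - k"] by (simp add: lessThan_atLeast0)
    also have "\<dots> = z ^ k * (\<Sum>j<m - k. z ^ j)" by (simp add: power_add sum_distrib_left mult.commute)
    also have "\<dots> \<le> z ^ k * 2" by (rule mult_left_mono[OF le2]) (use assms in simp)
    finally show ?thesis by simp
  qed (use assms in simp)
qed

lemma power_over_fact_tendsto_0: "(\<lambda>n. R ^ n / fact n :: real) \<longlonglongrightarrow> 0"
  using summable_LIMSEQ_zero[OF summable_exp[of R]] by (simp add: divide_inverse mult.commute)

text \<open>If the remainder of order k violated the bound at one point, it would by continuity do
  so on a small box with a uniform margin. The forms of orders k to n are dominated by a geometric
  series, so the remainder of order n + 1 keeps this margin on the box for all n; but its L1 norm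
  tends to 0.\<close>

lemma F3_near:
  assumes d: "d \<ge> 1" and r: "R > 0" and one: "emeasure (lebd d) (cballd d R) = 1" and k: "k > 0"
  obtains \<delta> C where "\<delta> > 0" "\<delta> \<le> R" "C \<ge> 0"
    "\<And>f x. f \<in> F3 d R \<Longrightarrow> x \<in> cballd d \<delta> \<Longrightarrow> \<bar>f x - mpoly d k (tcoef d f) x\<bar> \<le> C * norm2 d x ^ k"
proof -
  define A where "A = 4 * (4 * real d / R) ^ d"
  define D where "D = 2 * (2 * max 1 R * 2 ^ d) / R"
  have A: "A \<ge> 0" and D: "D > 0" using r by (auto simp: A_def D_def max_def)
  \<comment> \<open>Within this radius \<open>D * norm2 d y\<close> is at most 1/2, and the
    geometric series of the form bounds is at most twice its first term.\<close>
  define \<delta> where "\<delta> = min (R / 2) (1 / (2 * D))"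
  have \<delta>: "\<delta> > 0" "\<delta> < R" "D * \<delta> \<le> 1/2" using r D by (auto simp: \<delta>_def min_def field_simps)
  have main: "\<bar>f x0 - mpoly d k (tcoef d f) x0\<bar> \<le> 2 * A * (D * norm2 d x0) ^ k"
    if f: "f \<in> F3 d R" and x0: "x0 \<in> oballd d \<delta>" for f x0
  proof (rule ccontr)
    let ?r = "\<lambda>k x. f x - mpoly d k (tcoef d f) x"
    \<comment> \<open>The amount by which the bound fails; half of its value at x0 will persist on
      the box Q.\<close>
    define F where "F x = \<bar>?r k x\<bar> - 2 * A * (D * norm2 d x) ^ k" for x
    assume "\<not> ?thesis"
    then have F0: "F x0 > 0" by (simp add: F_def)
    have S: "smooth_fun d (oballd d R) (cballd d R) f" using f by (intro ball_smooth) (simp add: F3_def)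
    interpret smooth_fun d "oballd d R" "cballd d R" f by (rule S)
    have sub: "oballd d \<delta> \<subseteq> oballd d R" using \<delta> by (auto simp: oballd_def)
    have "continuous_on (oballd d \<delta>) F"
      unfolding F_def
      by (intro continuous_intros continuous_on_mpoly continuous_on_norm2 continuous_on_subset[OF cont_f sub])
    moreover have "oballd d \<delta> \<subseteq> Rd d" by (auto simp: oballd_def)
    moreover have "F x0 / 2 > 0" using F0 by simp
    ultimately obtain e1 where e1: "e1 > 0" "\<And>y. y \<in> oballd d \<delta> \<Longrightarrow> (\<And>i. i < d \<Longrightarrow> \<bar>y i - x0 i\<bar> < e1) \<Longrightarrow> \<bar>F y - F x0\<bar> < F x0 / 2"
      using continuous_on_box[OF _ _ x0, of F d "F x0 / 2"] by blast
    obtain e2 where e2: "e2 > 0" "\<And>y. y \<in> Rd d \<Longrightarrow> (\<And>i. i < d \<Longrightarrow> \<bar>y i - x0 i\<bar> < e2) \<Longrightarrow> y \<in> oballd d \<delta>"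
      using boxopenD[OF boxopen_oballd x0] by blast
    define e where "e = min e1 e2 / 2"
    have e: "e > 0" "e < e1" "e < e2" using e1(1) e2(1) by (auto simp: e_def)
    define Q where "Q = PiE {..<d} (\<lambda>i. {x0 i - e..x0 i + e})"
    have Q: "y \<in> oballd d \<delta> \<and> F y > F x0 / 2" if y: "y \<in> Q" for y
    proof -
      have c: "\<bar>y i - x0 i\<bar> \<le> e" if "i < d" for i
      proof -
        have "y i \<in> {x0 i - e..x0 i + e}" using y that by (auto simp: Q_def PiE_def Pi_def)
        then show ?thesis by auto
      qed
      have yR: "y \<in> Rd d" using y by (auto simp: Q_def Rd_def PiE_def)
      have "y \<in> oballd d \<delta>" by (rule e2(2)[OF yR]) (use c e in force)
      moreover have "\<bar>F y - F x0\<bar> < F x0 / 2" by (rule e1(2)[OF calculation]) (use c e in force)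
      ultimately show ?thesis by linarith
    qed
    define v where "v = F x0 / 2 * (2 * e) ^ d"
    have v: "v > 0" using F0 e by (simp add: v_def)
    have low: "v \<le> R ^ n / fact n" if n: "k \<le> n" for n
    proof -
      have big: "F x0 / 2 \<le> \<bar>?r (Suc n) y\<bar>" if y: "y \<in> Q" for y
      proof -
        have y\<delta>: "y \<in> Rd d" "norm2 d y < \<delta>" using Q[OF y] by (auto simp: oballd_def)
        define z where "z = D * norm2 d y"
        have "D * norm2 d y \<le> D * \<delta>" using y\<delta> D by simp
        then have "z \<le> 1/2" unfolding z_def using \<delta>(3) by (rule order_trans)
        moreover have "0 \<le> z" using D by (simp add: z_def)
        ultimately have z: "0 \<le> z" "z \<le> 1/2" by auto
        have "mpoly d (Suc n) (tcoef d f) y - mpoly d k (tcoef d f) y = (\<Sum>j=k..<Suc n. hform d j (tcoef d f) y)"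
          unfolding mpoly_hform lessThan_atLeast0
          using sum.atLeastLessThan_concat[of 0 k "Suc n" "\<lambda>j. hform d j (tcoef d f) y"] n by simp
        also have "\<bar>\<dots>\<bar> \<le> (\<Sum>j=k..<Suc n. A * z ^ j)"
        proof (rule order_trans[OF sum_abs sum_mono])
          fix j assume "j \<in> {k..<Suc n}"
          then have j: "j > 0" using k by simp
          show "\<bar>hform d j (tcoef d f) y\<bar> \<le> A * z ^ j"
            using F3_form_bound[OF d r one f j y\<delta>(1)] by (simp add: A_def D_def z_def)
        qed
        also have "\<dots> = A * (\<Sum>j=k..<Suc n. z ^ j)" by (rule sum_distrib_left[symmetric])
        also have "\<dots> \<le> A * (2 * z ^ k)" by (rule mult_left_mono[OF geometric_sum_le[OF z] A])
        finally have "\<bar>mpoly d (Suc n) (tcoef d f) y - mpoly d k (tcoef d f) y\<bar> \<le> 2 * A * z ^ k" by (simp add: mult_ac)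
        moreover have "\<bar>?r k y\<bar> - 2 * A * z ^ k > F x0 / 2" using Q[OF y] by (simp add: F_def z_def)
        ultimately show ?thesis by linarith
      qed
      have em: "emeasure (lebd d) Q = ennreal ((2 * e) ^ d)"
        using e emeasure_lebd_box[of d "\<lambda>i. x0 i - e" "\<lambda>i. x0 i + e"] by (simp add: Q_def)
      have "ennreal v = ennreal (F x0 / 2) * emeasure (lebd d) Q"
        unfolding em v_def by (rule ennreal_mult) (use e F0 in auto)
      also have "\<dots> = (\<integral>\<^sup>+y\<in>Q. ennreal (F x0 / 2) \<partial>lebd d)" by (simp add: nn_integral_cmult_indicator Q_def)
      also have "\<dots> \<le> (\<integral>\<^sup>+y\<in>oballd d R. ennreal \<bar>?r (Suc n) y\<bar> \<partial>lebd d)"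
        by (intro nn_integral_mono) (use Q big sub in \<open>auto simp: indicator_def intro!: ennreal_leI\<close>)
      also have "\<dots> \<le> ennreal (R ^ (Suc n - 1) / fact (Suc n - 1))"
        by (rule F3_remainder_L1[OF d r one f]) simp
      finally have "ennreal v \<le> ennreal (R ^ n / fact n)" by simp
      then show ?thesis using r by (subst (asm) ennreal_le_iff) auto
    qed
    have "\<forall>\<^sub>F n in sequentially. R ^ n / fact n < v"
      using order_tendstoD(2)[OF power_over_fact_tendsto_0 v] .
    then obtain n0 where "\<And>n. n0 \<le> n \<Longrightarrow> R ^ n / fact n < v" by (auto simp: eventually_sequentially)
    from this[of "max n0 k"] low[of "max n0 k"] show False by simp
  qed
  show ?thesis
  \<comment> \<open>Halving the radius passes from the closed ball to the open one on which the
    bound was shown.\<close>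
  proof (rule that[of "\<delta> / 2" "2 * A * D ^ k"])
    fix f x assume f: "f \<in> F3 d R" and x: "x \<in> cballd d (\<delta> / 2)"
    have "x \<in> oballd d \<delta>" using x \<delta> by (auto simp: cballd_def oballd_def)
    from main[OF f this] show "\<bar>f x - mpoly d k (tcoef d f) x\<bar> \<le> 2 * A * D ^ k * norm2 d x ^ k"
      by (simp add: power_mult_distrib mult_ac)
  qed (use \<delta> A D in auto)
qed

text \<open>Each remainder contributes at most \<epsilon> / 4 to the L1 error, and the Taylor
  polynomials at most \<epsilon> / 2 as the volume is one. The remainder estimates concern the open
  ball, whose boundary is a null set.\<close>

lemma F3_infc:
  assumes d: "d \<ge> 1" and R: "R > 0" and one: "emeasure (lebd d) (cballd d R) = 1"
    and \<epsilon>: "0 < \<epsilon>" and k: "k > 0" and k2: "R ^ (k - 1) / fact (k - 1) \<le> \<epsilon> / 4"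
  shows "\<exists>m \<le> (d + 1) ^ (k - 1). infc (cballd d R) (F3 d R) (err_L1 d (cballd d R)) \<epsilon> = enat m"
proof -
  let ?K = "cballd d R" and ?U = "oballd d R"
  obtain \<delta> C where near: "\<delta> > 0" "\<delta> \<le> R" "C \<ge> 0"
    "\<And>f x. f \<in> F3 d R \<Longrightarrow> x \<in> cballd d \<delta> \<Longrightarrow> \<bar>f x - mpoly d k (tcoef d f) x\<bar> \<le> C * norm2 d x ^ k"
    using F3_near[OF d R one k, of thesis] by blast
  show ?thesis
  proof (rule infc_taylor[where \<delta> = \<delta> and \<rho> = R and \<eta> = "\<epsilon> / 2" and C = C and c = "tcoef d" and G = "\<lambda>g x. indicator ?K x * g x"])
    show "cballd d \<delta> \<subseteq> ?K" using near(2) by (auto simp: cballd_def)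
    fix f g assume fg: "f \<in> F3 d R" "g \<in> F3 d R"
      and T: "\<And>x. x \<in> ?K \<Longrightarrow> \<bar>mpoly d k (tcoef d f) x - mpoly d k (tcoef d g) x\<bar> \<le> \<epsilon> / 2"
    have "continuous_on ?K g" using fg(2) by (simp add: F3_def smooth_on_def)
    then have gm: "(\<lambda>x. indicator ?K x * g x) \<in> borel_measurable (lebd d)"
      by (rule borel_measurable_cont_lebd[OF cballd_sets])
    have S: "smooth_fun d ?U ?K f" "smooth_fun d ?U ?K g" using fg by (auto intro!: ball_smooth simp: F3_def)
    let ?r = "\<lambda>f x. ennreal \<bar>f x - mpoly d k (tcoef d f) x\<bar> * indicator ?U x"
    have "AE x in lebd d. x \<notin> sphered d R"
      by (rule AE_not_in) (simp add: null_sets_def emeasure_sphere_0[OF d R one])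
    then have "(\<integral>\<^sup>+x\<in>?K. ennreal \<bar>f x - indicator ?K x * g x\<bar> \<partial>lebd d)
        \<le> (\<integral>\<^sup>+x. (?r f x + ?r g x) + ennreal (\<epsilon> / 2) * indicator ?U x \<partial>lebd d)"
    proof (intro nn_integral_mono_AE, eventually_elim)
      case (elim x)
      show ?case
      proof (cases "x \<in> ?K")
        case True
        then have U: "x \<in> ?U" using elim by (auto simp: cballd_def oballd_def sphered_def)
        have "\<bar>f x - g x\<bar> \<le> \<bar>f x - mpoly d k (tcoef d f) x\<bar> + \<bar>g x - mpoly d k (tcoef d g) x\<bar> + \<epsilon> / 2"
          using T[OF True] by linarith
        then have "ennreal \<bar>f x - g x\<bar> \<le> ennreal (\<bar>f x - mpoly d k (tcoef d f) x\<bar> + \<bar>g x - mpoly d k (tcoef d g) x\<bar> + \<epsilon> / 2)"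
          by (rule ennreal_leI)
        then show ?thesis using True U \<epsilon> by simp
      qed simp
    qed
    also have "\<dots> = ((\<integral>\<^sup>+x. ?r f x \<partial>lebd d) + (\<integral>\<^sup>+x. ?r g x \<partial>lebd d)) + (\<integral>\<^sup>+x. ennreal (\<epsilon> / 2) * indicator ?U x \<partial>lebd d)"
      using remainder_measurable[OF S(1), of k "tcoef d f"] remainder_measurable[OF S(2), of k "tcoef d g"]
      by (subst nn_integral_add; simp add: nn_integral_add)
    also have "\<dots> \<le> (ennreal (\<epsilon> / 4) + ennreal (\<epsilon> / 4)) + ennreal (\<epsilon> / 2)"
    proof (intro add_mono)
      show "(\<integral>\<^sup>+x. ?r f x \<partial>lebd d) \<le> ennreal (\<epsilon> / 4)"
        using F3_remainder_L1[OF d R one fg(1) k] ennreal_leI[OF k2] by (rule order_trans)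
      show "(\<integral>\<^sup>+x. ?r g x \<partial>lebd d) \<le> ennreal (\<epsilon> / 4)"
        using F3_remainder_L1[OF d R one fg(2) k] ennreal_leI[OF k2] by (rule order_trans)
      have "emeasure (lebd d) ?U \<le> 1"
        using emeasure_mono[of ?U ?K "lebd d"] oballd_subset_cballd[of d R] one by simp
      then have "ennreal (\<epsilon> / 2) * emeasure (lebd d) ?U \<le> ennreal (\<epsilon> / 2) * 1" by (rule mult_left_mono) simp
      then show "(\<integral>\<^sup>+x. ennreal (\<epsilon> / 2) * indicator ?U x \<partial>lebd d) \<le> ennreal (\<epsilon> / 2)"
        by (simp add: nn_integral_cmult_indicator)
    qed
    also have "\<dots> = ennreal \<epsilon>" using \<epsilon> by (simp flip: ennreal_plus)
    finally show "err_L1 d ?K f (\<lambda>x. indicator ?K x * g x) \<le> ennreal \<epsilon>"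
      using gm by (simp add: err_L1_def)
  qed (use near \<epsilon> k R in auto)
qed

subsection \<open>Rates\<close>

text \<open>A single term of the exponential series gives (e R)^k / k! <= exp (e R); then e <=
  3.\<close>

lemma power_over_fact_le:
  fixes R :: real
  assumes "R \<ge> 0"
  shows "R ^ k / fact k \<le> exp (3 * R - k)"
proof -
  define E where "E = exp (1::real)"
  have E: "E \<le> 3" "E > 0" unfolding E_def using exp_le by auto
  have "(E * R) ^ k / fact k \<le> exp (E * R)"
  proof -
    have s: "summable (\<lambda>n. inverse (fact n) *\<^sub>R (E * R) ^ n)" by (rule summable_exp_generic)
    have "(\<Sum>n\<in>{k}. inverse (fact n) *\<^sub>R (E * R) ^ n) \<le> (\<Sum>n. inverse (fact n) *\<^sub>R (E * R) ^ n)"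
      by (rule sum_le_suminf[OF s]) (use assms E in auto)
    then show ?thesis by (simp add: exp_def divide_inverse mult.commute)
  qed
  then have "E ^ k * (R ^ k / fact k) \<le> exp (E * R)" by (simp add: power_mult_distrib)
  moreover have "E ^ k = exp (real k)" by (simp add: E_def exp_of_nat_mult[symmetric])
  ultimately have "R ^ k / fact k \<le> exp (E * R) / exp (real k)"
    by (simp add: pos_le_divide_eq mult.commute)
  also have "\<dots> \<le> exp (3 * R) / exp (real k)"
    using E(1) assms by (intro divide_right_mono) (auto simp: mult_right_mono)
  finally show ?thesis by (simp add: exp_diff)
qed

text \<open>With x = 1 / \<epsilon> + d everything is bounded by a function of x alone: ln m is at
  most k ln (d + 1), which is of order sqrt x ln x.\<close>

lemma weakly_tractableI:
  assumes N: "\<And>\<epsilon> d. 0 < \<epsilon> \<Longrightarrow> \<epsilon> < 1 \<Longrightarrow> d \<ge> 1 \<Longrightarrow>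
    \<exists>m k. N \<epsilon> d = enat m \<and> m \<le> (d + 1) ^ k \<and> real k \<le> 2 * sqrt d + ln (1 / \<epsilon>) + 4"
  shows "weakly_tractable N"
  unfolding weakly_tractable_def
proof (intro conjI allI impI)
  fix \<epsilon> d assume "0 < (\<epsilon>::real) \<and> \<epsilon> < 1 \<and> (d::nat) \<ge> 1"
  then show "N \<epsilon> d \<noteq> \<infinity>" using N[of \<epsilon> d] by auto
next
  fix \<eta> :: real assume \<eta>: "\<eta> > 0"
  have "((\<lambda>x::real. (2 * sqrt x + ln x + 4) * ln x / x) \<longlongrightarrow> 0) at_top" by real_asymp
  then have "\<forall>\<^sub>F x in at_top. (2 * sqrt x + ln x + 4) * ln x / x < \<eta>" using \<eta> by (rule order_tendstoD)
  then obtain M where M: "\<And>x. x \<ge> M \<Longrightarrow> (2 * sqrt x + ln x + 4) * ln x / x < \<eta>"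
    by (auto simp: eventually_at_top_linorder)
  show "\<exists>M. \<forall>\<epsilon> d. 0 < \<epsilon> \<and> \<epsilon> < 1 \<and> d \<ge> 1 \<and> 1 / \<epsilon> + real d \<ge> M \<longrightarrow>
        \<bar>ln (real (the_enat (N \<epsilon> d))) / (1 / \<epsilon> + real d)\<bar> < \<eta>"
  proof (intro exI[of _ M] allI impI)
    fix \<epsilon> :: real and d :: nat
    assume a: "0 < \<epsilon> \<and> \<epsilon> < 1 \<and> d \<ge> 1 \<and> 1 / \<epsilon> + real d \<ge> M"
    define x where "x = 1 / \<epsilon> + real d"
    have \<epsilon>1: "1 / \<epsilon> > 1" using a by simp
    have "real d \<ge> 1" using a by simp
    then have x: "x > 2" "real d \<le> x" "real d + 1 \<le> x" "1 / \<epsilon> \<le> x" using \<epsilon>1 unfolding x_def by linarith+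
    obtain m k where mk: "N \<epsilon> d = enat m" "m \<le> (d + 1) ^ k" "real k \<le> 2 * sqrt d + ln (1 / \<epsilon>) + 4"
      using N[of \<epsilon> d] a by blast
    have lnm: "\<bar>ln (real m)\<bar> \<le> (2 * sqrt x + ln x + 4) * ln x"
    \<comment> \<open>By convention \<open>ln 0 = 0\<close>, so the value m = 0 satisfies the bound
      as well.\<close>
    proof (cases "m = 0")
      case True
      then show ?thesis using x by simp
    next
      case False
      then have "ln (real m) \<ge> 0" by simp
      moreover have "ln (real m) \<le> real k * ln (real d + 1)"
      proof -
        have "real m \<le> (real d + 1) ^ k" using mk(2) by (metis of_nat_1 of_nat_add of_nat_le_iff of_nat_power)
        then have "ln (real m) \<le> ln ((real d + 1) ^ k)" using False by simp
        then show ?thesis by (simp add: ln_realpow)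
      qed
      moreover have "real k * ln (real d + 1) \<le> (2 * sqrt x + ln x + 4) * ln x"
      proof (rule mult_mono)
        have "ln (1 / \<epsilon>) \<le> ln x" using x a by (subst ln_le_cancel_iff) auto
        moreover have "sqrt (real d) \<le> sqrt x" using x by simp
        ultimately show "real k \<le> 2 * sqrt x + ln x + 4" using mk(3) by linarith
        show "ln (real d + 1) \<le> ln x" using x by simp
        show "2 * sqrt x + ln x + 4 \<ge> 0" using x by (intro add_nonneg_nonneg) auto
      qed simp
      ultimately show ?thesis by linarith
    qed
    have "\<bar>ln (real (the_enat (N \<epsilon> d))) / (1 / \<epsilon> + real d)\<bar> = \<bar>ln (real m)\<bar> / x"
      using x by (simp add: mk(1) x_def[symmetric] abs_divide)
    also have "\<dots> \<le> (2 * sqrt x + ln x + 4) * ln x / x" using lnm x by (intro divide_right_mono) auto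
    also have "\<dots> < \<eta>" using a by (intro M) (simp add: x_def)
    finally show "\<bar>ln (real (the_enat (N \<epsilon> d))) / (1 / \<epsilon> + real d)\<bar> < \<eta>" .
  qed
qed

text \<open>Since 3 R <= 2 sqrt d, any k >= 2 sqrt d + ln (4 / \<epsilon>) makes the exponent 3 R -
  k at most - ln (4 / \<epsilon>). The summand 4 accounts for ln 4 <= 3 and for rounding up.\<close>

lemma unit_ball_order:
  assumes d: "d \<ge> 1" and R: "R > 0" and one: "emeasure (lebd d) (cballd d R) = 1"
    and \<epsilon>: "0 < \<epsilon>" "\<epsilon> < 1"
  obtains k where "R ^ k / fact k \<le> \<epsilon> / 4" "k > 0" "real k \<le> 2 * sqrt d + ln (1 / \<epsilon>) + 4"
proof -
  define y where "y = 2 * sqrt d + ln (4 / \<epsilon>)"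
  define k where "k = nat \<lceil>y\<rceil>"
  have ln4: "ln (4 / \<epsilon>) = ln 4 + ln (1 / \<epsilon>)" using \<epsilon> by (simp add: ln_div)
  have l: "ln (1 / \<epsilon>) > 0" using \<epsilon> by simp
  have l4: "ln (4::real) > 0" "ln (4::real) \<le> 3" using ln_le_minus_one[of "4::real"] by auto
  have y: "y > 0" using d l l4 unfolding y_def ln4 by (intro add_nonneg_pos) auto
  have k: "real k \<ge> y" "real k \<le> y + 1" using y by (auto simp: k_def)
  have R2: "3 * R \<le> 2 * sqrt d" using unit_ball_radius_le[OF d R one] real_sqrt_ge_zero[of "real d"] by linarith
  have "R ^ k / fact k \<le> exp (3 * R - k)" by (rule power_over_fact_le) (use R in simp)
  also have "\<dots> \<le> exp (- ln (4 / \<epsilon>))" using R2 k(1) by (simp add: y_def)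
  also have "\<dots> = \<epsilon> / 4" using \<epsilon> by (simp add: exp_minus)
  finally have 1: "R ^ k / fact k \<le> \<epsilon> / 4" .
  show ?thesis
  proof (rule that[OF 1])
    show "k > 0" using k(1) y by (intro gr0I) auto
    show "real k \<le> 2 * sqrt d + ln (1 / \<epsilon>) + 4" using k(2) l4 unfolding y_def ln4 by linarith
  qed
qed

lemma F1_quasi_poly: "quasi_poly_tractable (\<lambda>\<epsilon> d. infc (cube d) (F1 d) (err_sup (cube d)) \<epsilon>)"
  unfolding quasi_poly_tractable_def
proof (rule exI[of _ 1], rule exI[of _ 2], intro conjI allI impI)
  fix \<epsilon> :: real and d :: nat assume a: "0 < \<epsilon> \<and> \<epsilon> < 1 \<and> d \<ge> 1"
  define y where "y = log 2 (4 / \<epsilon>)"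
  define k where "k = nat \<lceil>y\<rceil>"
  define L where "L = ln (1 / \<epsilon>)"
  have L: "L > 0" using a by (simp add: L_def)
  \<comment> \<open>This bounds the binary logarithm y by 2 + 2 L, which is the origin of the
    witness t = 2.\<close>
  have ln2: "ln (2::real) \<ge> 1/2" using ln_add_one_self_le_self2[of "-1/2"] by (simp add: ln_div)
  have "y = (ln 4 + L) / ln 2" using a by (simp add: y_def L_def log_def ln_div)
  also have "ln (4::real) = 2 * ln 2" using ln_realpow[of 2 2] by simp
  finally have y_eq: "y = 2 + L / ln 2" by (simp add: add_divide_distrib)
  have "L / ln 2 \<le> L / (1/2)" using L ln2 by (intro divide_left_mono) auto
  then have y2: "y \<le> 2 + 2 * L" "y > 0" using y_eq L by (auto intro: add_pos_pos)
  have k: "real k \<ge> y" "real k < y + 1" using y2(2) unfolding k_def by linarith+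
  have k0: "k > 0" using k(1) y2(2) by (intro gr0I) auto
  have "(4 / \<epsilon>) = 2 powr y" using a by (simp add: y_def)
  also have "\<dots> \<le> 2 powr real k" using k(1) by simp
  also have "\<dots> = 2 ^ k" by (simp add: powr_realpow)
  finally have "(1/2) ^ k \<le> \<epsilon> / 4" using a by (simp add: power_divide field_simps)
  from F1_infc[OF _ k0 this, of d] obtain m where m: "m \<le> (d + 1) ^ (k - 1)"
    "infc (cube d) (F1 d) (err_sup (cube d)) \<epsilon> = enat m" using a by blast
  have "real m \<le> (real d + 1) ^ (k - 1)" using m(1) by (metis of_nat_1 of_nat_add of_nat_le_iff of_nat_power)
  also have "\<dots> = exp (real (k - 1) * ln (real d + 1))" by (simp add: exp_of_nat_mult)
  also have "\<dots> \<le> exp (2 * (1 + L) * (1 + ln (real d)))"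
  proof -
    have "real (k - 1) \<le> 2 * (1 + L)" using k(2) y2(1) k0 by (simp add: of_nat_diff)
    \<comment> \<open>From d + 1 <= 2 d <= e d.\<close>
    moreover have "ln (real d + 1) \<le> 1 + ln (real d)"
    proof -
      have "ln (real d + 1) \<le> ln (exp 1 * real d)"
        using a exp_ge_add_one_self[of 1] by (subst ln_le_cancel_iff) (auto intro: order_trans[OF _ mult_right_mono[of 2 "exp 1"]])
      also have "\<dots> = 1 + ln (real d)" using a by (simp add: ln_mult)
      finally show ?thesis .
    qed
    ultimately show ?thesis using L by (auto intro!: mult_mono)
  qed
  finally have "real m \<le> 1 * exp (2 * (1 + ln (1 / \<epsilon>)) * (1 + ln (real d)))" by (simp add: L_def)
  then show "\<exists>n. infc (cube d) (F1 d) (err_sup (cube d)) \<epsilon> = enat n \<and> real n \<le> 1 * exp (2 * (1 + ln (1 / \<epsilon>)) * (1 + ln (real d)))"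
    using m(2) by blast
qed auto

theorem theorem1p1:
  fixes r :: "nat \<Rightarrow> real"
  assumes "\<forall>d\<ge>1. r d > 0 \<and> emeasure (lebd d) (cballd d (r d)) = 1"
  shows "quasi_poly_tractable (\<lambda>\<epsilon> d. infc (cube d) (F1 d) (err_sup (cube d)) \<epsilon>)
       \<and> weakly_tractable (\<lambda>\<epsilon> d. infc (cballd d (r d)) (F2 d (r d)) (err_sup (cballd d (r d))) \<epsilon>)
       \<and> weakly_tractable (\<lambda>\<epsilon> d. infc (cballd d (r d)) (F3 d (r d)) (err_L1 d (cballd d (r d))) \<epsilon>)"
proof (intro conjI F1_quasi_poly weakly_tractableI)
  fix \<epsilon> :: real and d :: nat assume \<epsilon>: "0 < \<epsilon>" "\<epsilon> < 1" and d: "d \<ge> 1"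
  have R: "r d > 0" and one: "emeasure (lebd d) (cballd d (r d)) = 1" using assms d by auto
  obtain k where k: "r d ^ k / fact k \<le> \<epsilon> / 4" "k > 0" "real k \<le> 2 * sqrt d + ln (1 / \<epsilon>) + 4"
    using unit_ball_order[OF d R one \<epsilon>] by blast
  have k1: "real (k - 1) \<le> 2 * sqrt d + ln (1 / \<epsilon>) + 4" using k(2,3) by (simp add: of_nat_diff)
  show "\<exists>m k. infc (cballd d (r d)) (F2 d (r d)) (err_sup (cballd d (r d))) \<epsilon> = enat m \<and>
      m \<le> (d + 1) ^ k \<and> real k \<le> 2 * sqrt d + ln (1 / \<epsilon>) + 4"
    using F2_infc[OF R \<epsilon>(1) k(2,1), of d] k1 by blast
  \<comment> \<open>The L1 remainder of order k is bounded by R^(k - 1) / (k - 1)!, one power less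
    than in the uniform case, so the order is raised to \<open>Suc k\<close>.\<close>
  have "\<exists>m\<le>(d + 1) ^ (Suc k - 1). infc (cballd d (r d)) (F3 d (r d)) (err_L1 d (cballd d (r d))) \<epsilon> = enat m"
    by (rule F3_infc[OF d R one \<epsilon>(1)]) (use k(1) in auto)
  then show "\<exists>m k. infc (cballd d (r d)) (F3 d (r d)) (err_L1 d (cballd d (r d))) \<epsilon> = enat m \<and>
      m \<le> (d + 1) ^ k \<and> real k \<le> 2 * sqrt d + ln (1 / \<epsilon>) + 4"
    using k(3) by auto
qed

end
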